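(* Let $d,n\ge1$ be integers, let $\Omega\subset\mathbb{R}^d$ be a bounded connected open set with $C^2$ boundary, let $d_1,\dots,d_n>0$, and let $F=(f_1,\dots,f_n):\mathbb{R}^n\to\mathbb{R}^n$ be locally Lipschitz continuous and satisfy $$\forall i\in\{1,\dots,n\},\ \forall (u_j)_{j\neq i}\in[0,\infty)^{n-1},\quad f_i(u_1,\dots,u_{i-1},0,u_{i+1},\dots,u_n)\ge 0 .$$ Let $U(t,x)=(u_1(t,x),\dots,u_n(t,x))$ be any maximal positive trajectory of the reaction-diffusion system with homogeneous Dirichlet boundary conditions $$\frac{\partial u_i}{\partial t}-d_i\Delta u_i=f_i(u_1,\dots,u_n)\ \text{ in }\mathbb{R}^+\times\Omega,\qquad u_i=0\ \text{ on }\mathbb{R}^+\times\partial\Omega,\qquad i=1,\dots,n,$$ whose initial vector $U(0)=(u_{0,1},\dots,u_{0,n})\in C_0(\Omega)^n$ satisfies $u_{0,i}(x)\ge0$ for all $x\in\Omega$ and all $i\in\{1,\dots,n\}$. Then $u_i(t,x)\ge0$ for all $i\in\{1,\dots,n\}$, all $x\in\Omega$ and all $t\in[0,T_{\max})$. Moreover, whenever $j\in\{1,\dots,n\}$ is such that $u_j(0,\cdot)\not\equiv0$, we have $$\forall t\in(0,T_{\max}),\ \forall x\in\Omega,\quad u_j(t,x)>0 .$$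
   Context: $C_0(\Omega)=\{u\in C(\overline\Omega): u=0 \text{ throughout }\partial\Omega\}$ (real-valued, sup norm). $S_i(t)=\exp(td_i\Delta)$ denotes the heat semigroup with homogeneous Dirichlet boundary conditions: it is generated on $L^2(\Omega)$ by $d_i$ times the Dirichlet Laplacian, acts as a contraction semigroup on $C_0(\Omega)$, and is applied to any bounded measurable function. A maximal positive trajectory is a maximal (in forward time, on $[0,T_{\max})$, $0<T_{\max}\le\infty$) mild solution, i.e. $U=(u_1,\dots,u_n)\in C([0,T_{\max}),C_0(\Omega)^n)$ with $$u_i(t)=S_i(t)u_i(0)+\int_0^tS_i(t-s)f_i(u_1(s),\dots,u_n(s))\,ds,\qquad t\in[0,T_{\max}),\ i=1,\dots,n .$$ "Positive" in "positive trajectory" refers to the time direction. *)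

theory Defs
  imports "HOL-Analysis.Analysis"
begin

section \<open>Smooth functions and domains of class C2\<close>

definition partial_deriv :: "'a::euclidean_space \<Rightarrow> ('a \<Rightarrow> real) \<Rightarrow> 'a \<Rightarrow> real" where
  "partial_deriv b f x = frechet_derivative f (at x) b"

text \<open>Meaningful for open \<open>A\<close>: the derivatives are two-sided.\<close>
primrec Ck_on :: "nat \<Rightarrow> ('a::euclidean_space \<Rightarrow> real) \<Rightarrow> 'a set \<Rightarrow> bool" where
  "Ck_on 0 f A \<longleftrightarrow> continuous_on A f"
| "Ck_on (Suc k) f A \<longleftrightarrow>
     (\<forall>x\<in>A. f differentiable (at x)) \<and> (\<forall>b\<in>Basis. Ck_on k (partial_deriv b f) A)"

text \<open>Near each boundary point, \<open>\<Omega>\<close> is the part of space lying strictly above the graph of a C2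
  function over a hyperplane.  The unit vector \<open>\<nu>\<close> is the vertical direction; a function on
  the hyperplane orthogonal to \<open>\<nu>\<close> is encoded as a function \<open>\<gamma>\<close> on the whole space
  that does not depend on the \<open>\<nu>\<close>-coordinate.\<close>
definition C2_boundary :: "'a::euclidean_space set \<Rightarrow> bool" where
  "C2_boundary \<Omega> \<longleftrightarrow>
     (\<forall>p\<in>frontier \<Omega>. \<exists>r>0. \<exists>\<nu> \<gamma>. norm \<nu> = 1 \<and> Ck_on 2 \<gamma> UNIV \<and>
        (\<forall>x s. \<gamma> (x + s *\<^sub>R \<nu>) = \<gamma> x) \<and>
        \<Omega> \<inter> ball p r = {x \<in> ball p r. x \<bullet> \<nu> > \<gamma> x})"

definition test_function :: "'a::euclidean_space set \<Rightarrow> ('a \<Rightarrow> real) \<Rightarrow> bool" where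
  "test_function \<Omega> \<phi> \<longleftrightarrow>
     (\<forall>k. Ck_on k \<phi> UNIV) \<and> compact (closure {x. \<phi> x \<noteq> 0}) \<and> closure {x. \<phi> x \<noteq> 0} \<subseteq> \<Omega>"

section \<open>The Dirichlet Laplacian on L2\<close>

text \<open>Elements of L2 are represented by functions; equality in L2 is equality almost everywhere
  with respect to \<^term>\<open>lebesgue_on \<Omega>\<close>.\<close>
definition L2 :: "'a::euclidean_space set \<Rightarrow> ('a \<Rightarrow> real) set" where
  "L2 \<Omega> = {f \<in> borel_measurable (lebesgue_on \<Omega>). integrable (lebesgue_on \<Omega>) (\<lambda>x. (f x)\<^sup>2)}"

definition l2norm :: "'a::euclidean_space set \<Rightarrow> ('a \<Rightarrow> real) \<Rightarrow> real" where
  "l2norm \<Omega> f = sqrt (LINT x|lebesgue_on \<Omega>. (f x)\<^sup>2)"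

definition weak_gradient ::
    "'a::euclidean_space set \<Rightarrow> ('a \<Rightarrow> real) \<Rightarrow> ('a \<Rightarrow> 'a \<Rightarrow> real) \<Rightarrow> bool" where
  "weak_gradient \<Omega> u g \<longleftrightarrow> u \<in> L2 \<Omega> \<and> (\<forall>b\<in>Basis. g b \<in> L2 \<Omega> \<and>
     (\<forall>\<phi>. test_function \<Omega> \<phi> \<longrightarrow>
        (LINT x|lebesgue_on \<Omega>. u x * partial_deriv b \<phi> x) = - (LINT x|lebesgue_on \<Omega>. g b x * \<phi> x)))"

text \<open>The closure of the test functions in the Sobolev space H1.\<close>
definition H10 :: "'a::euclidean_space set \<Rightarrow> ('a \<Rightarrow> real) set" where
  "H10 \<Omega> = {u. \<exists>g \<phi>. weak_gradient \<Omega> u g \<and> (\<forall>k::nat. test_function \<Omega> (\<phi> k)) \<and>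
     (\<lambda>k. l2norm \<Omega> (\<lambda>x. \<phi> k x - u x)) \<longlonglongrightarrow> 0 \<and>
     (\<forall>b\<in>Basis. (\<lambda>k. l2norm \<Omega> (\<lambda>x. partial_deriv b (\<phi> k) x - g b x)) \<longlonglongrightarrow> 0)}"

definition laplacian :: "('a::euclidean_space \<Rightarrow> real) \<Rightarrow> 'a \<Rightarrow> real" where
  "laplacian \<phi> x = (\<Sum>b\<in>Basis. partial_deriv b (partial_deriv b \<phi>) x)"

text \<open>Graph of the Dirichlet Laplacian: its domain consists of the \<open>u\<close> in \<^term>\<open>H10 \<Omega>\<close> whose
  distributional Laplacian \<open>w\<close> lies in \<^term>\<open>L2 \<Omega>\<close>.\<close>
definition dirichlet_laplacian ::
    "'a::euclidean_space set \<Rightarrow> ('a \<Rightarrow> real) \<Rightarrow> ('a \<Rightarrow> real) \<Rightarrow> bool" where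
  "dirichlet_laplacian \<Omega> u w \<longleftrightarrow> u \<in> H10 \<Omega> \<and> w \<in> L2 \<Omega> \<and>
     (\<forall>\<phi>. test_function \<Omega> \<phi> \<longrightarrow>
        (LINT x|lebesgue_on \<Omega>. u x * laplacian \<phi> x) = (LINT x|lebesgue_on \<Omega>. w x * \<phi> x))"

section \<open>The Dirichlet heat semigroup\<close>

definition L2_C0_semigroup ::
    "'a::euclidean_space set \<Rightarrow> (real \<Rightarrow> ('a \<Rightarrow> real) \<Rightarrow> 'a \<Rightarrow> real) \<Rightarrow> bool" where
  "L2_C0_semigroup \<Omega> S \<longleftrightarrow>
     (\<forall>t\<ge>0. \<forall>f\<in>L2 \<Omega>. S t f \<in> L2 \<Omega>) \<and>
     (\<forall>t\<ge>0. \<forall>f\<in>L2 \<Omega>. \<forall>g\<in>L2 \<Omega>. (AE x in lebesgue_on \<Omega>. f x = g x) \<longrightarrow>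
        (AE x in lebesgue_on \<Omega>. S t f x = S t g x)) \<and>
     (\<forall>t\<ge>0. \<forall>f\<in>L2 \<Omega>. \<forall>g\<in>L2 \<Omega>. \<forall>a b.
        AE x in lebesgue_on \<Omega>. S t (\<lambda>y. a * f y + b * g y) x = a * S t f x + b * S t g x) \<and>
     (\<forall>t\<ge>0. \<exists>K. \<forall>f\<in>L2 \<Omega>. l2norm \<Omega> (S t f) \<le> K * l2norm \<Omega> f) \<and>
     (\<forall>f\<in>L2 \<Omega>. AE x in lebesgue_on \<Omega>. S 0 f x = f x) \<and>
     (\<forall>s\<ge>0. \<forall>t\<ge>0. \<forall>f\<in>L2 \<Omega>. AE x in lebesgue_on \<Omega>. S (s + t) f x = S s (S t f) x) \<and>
     (\<forall>f\<in>L2 \<Omega>. ((\<lambda>t. l2norm \<Omega> (\<lambda>x. S t f x - f x)) \<longlongrightarrow> 0) (at_right 0))"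

definition L2_generator ::
    "'a::euclidean_space set \<Rightarrow> (real \<Rightarrow> ('a \<Rightarrow> real) \<Rightarrow> 'a \<Rightarrow> real) \<Rightarrow> ('a \<Rightarrow> real) \<Rightarrow> ('a \<Rightarrow> real) \<Rightarrow> bool"
  where
  "L2_generator \<Omega> S u w \<longleftrightarrow> u \<in> L2 \<Omega> \<and> w \<in> L2 \<Omega> \<and>
     ((\<lambda>h. l2norm \<Omega> (\<lambda>x. (S h u x - u x) / h - w x)) \<longlongrightarrow> 0) (at_right 0)"

text \<open>Only the values on \<^term>\<open>closure \<Omega>\<close> matter.\<close>
definition C0 :: "'a::euclidean_space set \<Rightarrow> ('a \<Rightarrow> real) set" where
  "C0 \<Omega> = {u. continuous_on (closure \<Omega>) u \<and> (\<forall>x\<in>frontier \<Omega>. u x = 0)}"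

definition supnorm :: "'a::euclidean_space set \<Rightarrow> ('a \<Rightarrow> real) \<Rightarrow> real" where
  "supnorm \<Omega> u = (SUP x\<in>closure \<Omega>. \<bar>u x\<bar>)"

definition bounded_measurable :: "'a::euclidean_space set \<Rightarrow> ('a \<Rightarrow> real) set" where
  "bounded_measurable \<Omega> = {f \<in> borel_measurable (lebesgue_on \<Omega>). bounded (f ` \<Omega>)}"

text \<open>\<open>S\<close> is the semigroup \<open>exp (t \<kappa> \<Delta>)\<close> with Dirichlet boundary conditions.  The first two
  conjuncts determine \<open>S t f\<close> almost everywhere, for \<open>f\<close> in \<^term>\<open>L2 \<Omega>\<close>.  The remaining ones
  say that \<open>S\<close> restricts to a strongly continuous contraction semigroup on \<^term>\<open>C0 \<Omega>\<close>
  (linearity and the semigroup law are inherited from L2, two continuous functions that agree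
  almost everywhere in \<open>\<Omega>\<close> being equal on its closure), and that for \<open>t > 0\<close> and bounded
  measurable \<open>f\<close>, \<open>S t f\<close> denotes the representative belonging to \<^term>\<open>C0 \<Omega>\<close>, which
  exists by parabolic smoothing and is unique on \<^term>\<open>closure \<Omega>\<close>.\<close>
definition dirichlet_heat_semigroup ::
    "'a::euclidean_space set \<Rightarrow> real \<Rightarrow> (real \<Rightarrow> ('a \<Rightarrow> real) \<Rightarrow> 'a \<Rightarrow> real) \<Rightarrow> bool" where
  "dirichlet_heat_semigroup \<Omega> \<kappa> S \<longleftrightarrow>
     L2_C0_semigroup \<Omega> S \<and>
     (\<forall>u w. L2_generator \<Omega> S u w \<longleftrightarrow>
        w \<in> L2 \<Omega> \<and> (\<exists>v. dirichlet_laplacian \<Omega> u v \<and> (AE x in lebesgue_on \<Omega>. w x = \<kappa> * v x))) \<and>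
     (\<forall>t\<ge>0. \<forall>f\<in>C0 \<Omega>. S t f \<in> C0 \<Omega> \<and> supnorm \<Omega> (S t f) \<le> supnorm \<Omega> f) \<and>
     (\<forall>f\<in>C0 \<Omega>. uniform_limit (closure \<Omega>) (\<lambda>t. S t f) f (at_right 0)) \<and>
     (\<forall>t>0. \<forall>f\<in>bounded_measurable \<Omega>. S t f \<in> C0 \<Omega>)"

section \<open>Mild solutions and maximal positive trajectories\<close>

definition time_interval :: "ereal \<Rightarrow> real set" where
  "time_interval T = {t. 0 \<le> t \<and> ereal t < T}"

text \<open>\<open>U t x $ i\<close> is the value of the \<open>i\<close>-th component at time \<open>t\<close> and point \<open>x\<close>.
  Continuity in time is with respect to the sup norm over \<^term>\<open>closure \<Omega>\<close>.  The integral in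
  the variation-of-constants formula is evaluated at each point \<open>x\<close>; evaluation being
  continuous for the sup norm, this is the value at \<open>x\<close> of the function-valued integral.\<close>
definition mild_solution ::
    "(real^'d) set \<Rightarrow> ('n \<Rightarrow> real \<Rightarrow> (real^'d \<Rightarrow> real) \<Rightarrow> real^'d \<Rightarrow> real) \<Rightarrow>
     (real^'n \<Rightarrow> real^'n) \<Rightarrow> ereal \<Rightarrow> (real \<Rightarrow> real^'d \<Rightarrow> real^'n) \<Rightarrow> bool" where
  "mild_solution \<Omega> S F T U \<longleftrightarrow> 0 < T \<and>
     (\<forall>t\<in>time_interval T. \<forall>i. (\<lambda>x. U t x $ i) \<in> C0 \<Omega>) \<and>
     (\<forall>t\<in>time_interval T. uniform_limit (closure \<Omega>) U (U t) (at t within time_interval T)) \<and>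
     (\<forall>t\<in>time_interval T. \<forall>i. \<forall>x\<in>closure \<Omega>.
        (\<lambda>s. S i (t - s) (\<lambda>y. F (U s y) $ i) x) integrable_on {0..t} \<and>
        U t x $ i = S i t (\<lambda>y. U 0 y $ i) x
                    + integral {0..t} (\<lambda>s. S i (t - s) (\<lambda>y. F (U s y) $ i) x))"

definition maximal_positive_trajectory ::
    "(real^'d) set \<Rightarrow> ('n \<Rightarrow> real \<Rightarrow> (real^'d \<Rightarrow> real) \<Rightarrow> real^'d \<Rightarrow> real) \<Rightarrow>
     (real^'n \<Rightarrow> real^'n) \<Rightarrow> ereal \<Rightarrow> (real \<Rightarrow> real^'d \<Rightarrow> real^'n) \<Rightarrow> bool" where
  "maximal_positive_trajectory \<Omega> S F T U \<longleftrightarrow> mild_solution \<Omega> S F T U \<and>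
     \<not> (\<exists>T' V. T < T' \<and> mild_solution \<Omega> S F T' V \<and>
          (\<forall>t\<in>time_interval T. \<forall>x\<in>closure \<Omega>. V t x = U t x))"

definition locally_lipschitz :: "('a::metric_space \<Rightarrow> 'b::metric_space) \<Rightarrow> bool" where
  "locally_lipschitz F \<longleftrightarrow> (\<forall>x. \<exists>r>0. \<exists>L. L-lipschitz_on (cball x r) F)"

definition quasi_positive :: "(real^'n \<Rightarrow> real^'n) \<Rightarrow> bool" where
  "quasi_positive F \<longleftrightarrow> (\<forall>i u. u $ i = 0 \<and> (\<forall>j. j \<noteq> i \<longrightarrow> 0 \<le> u $ j) \<longrightarrow> 0 \<le> F u $ i)"

end

theory Submission
  imports Defs
begin

text \<open>The heat semigroup enters only through its generator.  Testing the equation with a smooth convex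
  penalty of \<open>u - M\<close> shows that the generator is dissipative, which yields the comparison principle
  \<open>f \<le> M \<Longrightarrow> S t f \<le> M\<close> for \<open>M \<ge> 0\<close>, first for test functions and then by density.  Comparing with
  the subsolution \<open>exp (- l t) * exp (- 1 / (\<rho>\<^sup>2 + c t - |x - x0|\<^sup>2))\<close>, whose support grows to a
  prescribed ball in a prescribed time, and chaining balls in the connected domain gives \<open>S t f > 0\<close>
  for \<open>f \<ge> 0\<close> not identically zero.

  For the nonlinear problem, quasi-positivity and the Lipschitz condition give
  \<open>F\<^sub>i(U) \<ge> - L U\<^sub>i - C b\<close> as long as all components are at least \<open>- b\<close>.  The variation-of-constants
  formula restarted at time \<open>t\<close> then yields
  \<open>U\<^sub>i(t + h) \<ge> (1 - L h) S h (U\<^sub>i(t)) - h (C b + o(1))\<close> uniformly in space, and a Gronwall argument along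
  this one-sided inequality shows first \<open>U \<ge> 0\<close> and then \<open>U\<^sub>j(t) \<ge> exp (- 2 L t) S t (U\<^sub>j(0))\<close>.\<close>

section \<open>Smooth functions and bumps\<close>

text \<open>The defining clauses of \<open>dirichlet_heat_semigroup\<close> contain no order
  statement, and the usual passage from sup-norm contraction to positivity uses the constant 1,
  which is not in \<open>C0\<close>. All order information is therefore extracted from the weak form
  of the Dirichlet Laplacian.

  Two gaps shape the rest. Statements in L2 hold almost everywhere, whereas the mild formula is
  pointwise on the closure, so identities are transferred through continuous representatives. And
  \<open>F 0\<close> may be nonzero: the source term then does not vanish on the boundary, where the
  semigroup is not strongly continuous at time 0 in the sup norm, so restarting the mild formula
  needs a limiting argument.

  The barrier is flat to infinite order at the edge of its support. It is thus a test function at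
  each time, lies in the domain of the generator and needs no separate boundary treatment. The
  trajectory itself is never differentiated in time: every estimate is a one-step inequality with a
  small error per unit time, iterated by continuous induction.\<close>

definition smooth :: "('a::euclidean_space \<Rightarrow> real) \<Rightarrow> bool" where
  "smooth f \<longleftrightarrow> (\<forall>k. Ck_on k f UNIV)"

lemma partial_deriv_eq:
  "(f has_derivative f') (at x) \<Longrightarrow> partial_deriv b f x = f' b"
  unfolding partial_deriv_def by (metis frechet_derivative_at)

lemma differentiable_has_derivative_partial:
  assumes "f differentiable (at x)"
  shows "(f has_derivative (\<lambda>b. partial_deriv b f x)) (at x)"
  using assms frechet_derivative_works[of f "at x"] unfolding partial_deriv_def by (simp add: eta_contract_eq)

lemma Ck_on_Suc_imp: "Ck_on (Suc k) f UNIV \<Longrightarrow> Ck_on k f UNIV"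
proof (induction k arbitrary: f)
  case 0
  then show ?case
    by (auto intro!: differentiable_imp_continuous_on simp: differentiable_on_def)
next
  case (Suc k)
  then show ?case by (metis Ck_on.simps(2))
qed

lemma Ck_on_add:
  "Ck_on k f UNIV \<Longrightarrow> Ck_on k g UNIV \<Longrightarrow> Ck_on k (\<lambda>x. f x + g x) UNIV"
proof (induction k arbitrary: f g)
  case (Suc k)
  then have d: "f differentiable (at x)" "g differentiable (at x)" for x by auto
  have "partial_deriv b (\<lambda>x. f x + g x) = (\<lambda>x. partial_deriv b f x + partial_deriv b g x)" for b
    by (rule ext, rule partial_deriv_eq) (intro derivative_intros differentiable_has_derivative_partial d)
  with Suc d show ?case by auto
qed (auto intro: continuous_intros)

lemma Ck_on_mult:
  "Ck_on k f UNIV \<Longrightarrow> Ck_on k g UNIV \<Longrightarrow> Ck_on k (\<lambda>x. f x * g x) UNIV"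
proof (induction k arbitrary: f g)
  case (Suc k)
  then have d: "f differentiable (at x)" "g differentiable (at x)" for x by auto
  have "partial_deriv b (\<lambda>x. f x * g x) = (\<lambda>x. f x * partial_deriv b g x + partial_deriv b f x * g x)" for b
    by (rule ext, rule partial_deriv_eq) (intro derivative_intros differentiable_has_derivative_partial d)
  with Suc d show ?case by (auto intro!: Ck_on_add Suc.IH Ck_on_Suc_imp[of k f] Ck_on_Suc_imp[of k g])
qed (auto intro: continuous_intros)

lemma Ck_on_const: "Ck_on k (\<lambda>x. c) UNIV"
proof (induction k arbitrary: c)
  case (Suc k)
  have "partial_deriv b (\<lambda>x. c) = (\<lambda>x. 0)" for b :: 'a
    by (rule ext, rule partial_deriv_eq) (intro derivative_intros)
  with Suc show ?case by auto
qed auto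

lemma Ck_on_inner: "Ck_on k (\<lambda>x. x \<bullet> v) UNIV"
proof (cases k)
  case (Suc k)
  have "partial_deriv b (\<lambda>x. x \<bullet> v) = (\<lambda>x. b \<bullet> v)" for b
    by (rule ext, rule partial_deriv_eq) (intro derivative_intros)
  with Suc Ck_on_const show ?thesis by (auto simp: inner_commute)
qed (auto intro: continuous_intros)

lemma partial_deriv_compose:
  fixes h :: "real \<Rightarrow> real"
  assumes "f differentiable (at x)" "h differentiable (at (f x))"
  shows "partial_deriv b (\<lambda>x. h (f x)) x = partial_deriv 1 h (f x) * partial_deriv b f x"
proof -
  obtain D where D: "(h has_real_derivative D) (at (f x))"
    using assms(2) by (auto simp: real_differentiable_def)
  then have "partial_deriv 1 h (f x) = D"
    using partial_deriv_eq[of h "(*) D" "f x" 1] by (simp add: has_field_derivative_def)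
  moreover have "((\<lambda>x. h (f x)) has_derivative (\<lambda>b. D * partial_deriv b f x)) (at x)"
    using has_derivative_compose[OF differentiable_has_derivative_partial[OF assms(1)]
        D[unfolded has_field_derivative_def]] by simp
  ultimately show ?thesis
    using partial_deriv_eq by blast
qed

lemma Ck_on_compose:
  fixes h :: "real \<Rightarrow> real"
  shows "Ck_on k f UNIV \<Longrightarrow> Ck_on k h UNIV \<Longrightarrow> Ck_on k (\<lambda>x. h (f x)) UNIV"
proof (induction k arbitrary: f h)
  case (Suc k)
  then have d: "f differentiable (at x)" "h differentiable (at y)" for x y by auto
  have "(\<lambda>x. h (f x)) differentiable (at x)" for x
    using differentiable_chain_at[of f x h] d by (simp add: o_def)
  moreover have "Ck_on k (\<lambda>x. partial_deriv 1 h (f x) * partial_deriv b f x) UNIV" if "b \<in> Basis" for b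
    proof (rule Ck_on_mult)
    show "Ck_on k (\<lambda>x. partial_deriv 1 h (f x)) UNIV"
      by (rule Suc.IH[OF Ck_on_Suc_imp[OF Suc.prems(1)]]) (use Suc.prems(2) in simp)
  qed (use Suc.prems that in simp)
  moreover have "partial_deriv b (\<lambda>x. h (f x)) = (\<lambda>x. partial_deriv 1 h (f x) * partial_deriv b f x)" for b
    using partial_deriv_compose[OF d(1) d(2), of b] by (intro ext)
  ultimately show ?case by simp
next
  case 0
  then show ?case using continuous_on_compose2[of UNIV h UNIV f] by simp
qed

lemma smooth_const [simp]: "smooth (\<lambda>x. c)"
  and smooth_inner [simp]: "smooth (\<lambda>x. x \<bullet> v)"
  and smooth_add: "smooth f \<Longrightarrow> smooth g \<Longrightarrow> smooth (\<lambda>x. f x + g x)"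
  and smooth_mult: "smooth f \<Longrightarrow> smooth g \<Longrightarrow> smooth (\<lambda>x. f x * g x)"
  unfolding smooth_def by (simp_all only: Ck_on_const Ck_on_inner Ck_on_add Ck_on_mult simp_thms)

lemma smooth_compose: "smooth f \<Longrightarrow> smooth h \<Longrightarrow> smooth (\<lambda>x. h (f x :: real))"
  by (simp add: smooth_def Ck_on_compose)

lemma smooth_ident [simp]: "smooth (\<lambda>x::real. x)"
  using smooth_inner[of "1::real"] by simp

lemma smooth_diff: "smooth f \<Longrightarrow> smooth g \<Longrightarrow> smooth (\<lambda>x. f x - g x)"
  using smooth_add[of f "\<lambda>x. (-1) * g x"] smooth_mult[of "\<lambda>x. -1" g] by simp

lemma smooth_sum:
  assumes "\<And>i. i \<in> I \<Longrightarrow> smooth (f i)"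
  shows "smooth (\<lambda>x. \<Sum>i\<in>I. f i x)"
  using assms by (induction I rule: infinite_finite_induct) (auto intro: smooth_add)

lemma smooth_power: "smooth f \<Longrightarrow> smooth (\<lambda>x. f x ^ n)"
  by (induction n) (auto intro: smooth_mult)

lemma smooth_inner_self: "smooth (\<lambda>x::'a::euclidean_space. (x - a) \<bullet> (x - a))"
proof -
  have "smooth (\<lambda>x. \<Sum>b\<in>Basis. (x \<bullet> b - a \<bullet> b) * (x \<bullet> b - a \<bullet> b))"
    by (intro smooth_sum smooth_mult smooth_diff smooth_inner smooth_const)
  then show ?thesis by (subst euclidean_inner) (simp add: inner_diff_left)
qed

lemma smooth_differentiable: "smooth f \<Longrightarrow> f differentiable (at x)"
  unfolding smooth_def using Ck_on.simps(2)[of 0 f UNIV] by blast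

lemma smooth_has_derivative: "smooth f \<Longrightarrow> (f has_derivative (\<lambda>b. partial_deriv b f x)) (at x)"
  by (intro differentiable_has_derivative_partial smooth_differentiable)

lemma smooth_continuous: "smooth f \<Longrightarrow> continuous_on A f"
  unfolding smooth_def using Ck_on.simps(1)[of f UNIV] continuous_on_subset by blast

lemma smooth_partial_deriv: "smooth f \<Longrightarrow> b \<in> Basis \<Longrightarrow> smooth (partial_deriv b f)"
  unfolding smooth_def by (meson Ck_on.simps(2))

lemma real_differentiable_at: "(f has_real_derivative D) (at x) \<Longrightarrow> f differentiable (at x)"
  by (auto simp: real_differentiable_def)

text \<open>\<open>D i\<close> is the index of the derivative of the member \<open>f i\<close>.
  Because the family is closed under differentiation, the induction on the order can run over all
  members at once.\<close>

lemma smooth_realI: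
  fixes f :: "'i \<Rightarrow> real \<Rightarrow> real"
  assumes "\<And>i x. (f i has_real_derivative f (D i) x) (at x)"
  shows "smooth (f i)"
proof -
  have p: "partial_deriv 1 (f i) = f (D i)" for i
    using partial_deriv_eq[OF assms[unfolded has_field_derivative_def]] by auto
  have "Ck_on k (f i) UNIV" for k i
  proof (induction k arbitrary: i)
    case 0
    show ?case using assms by (auto intro!: DERIV_continuous_on)
  next
    case (Suc k)
    show ?case using assms Suc by (auto simp: p intro: real_differentiable_at)
  qed
  then show ?thesis by (simp add: smooth_def)
qed

lemma partial_deriv_real:
  "(f has_real_derivative D) (at x) \<Longrightarrow> partial_deriv 1 f x = D"
  using partial_deriv_eq[of f "(*) D" x 1] by (simp add: has_field_derivative_def)

lemma partial_deriv_smooth_compose: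
  fixes h h' :: "real \<Rightarrow> real"
  assumes "smooth f" "\<And>y. (h has_real_derivative h' y) (at y)"
  shows "partial_deriv b (\<lambda>x. h (f x)) x = h' (f x) * partial_deriv b f x"
  using partial_deriv_compose[OF smooth_differentiable[OF assms(1)] real_differentiable_at[OF assms(2)], of b x]
    partial_deriv_real[OF assms(2)[of "f x"]] by simp

text \<open>The polynomial parameter makes the family closed under differentiation, whence smoothness at \<open>0\<close>.\<close>
definition bump :: "real poly \<Rightarrow> real \<Rightarrow> real" where
  "bump p x = (if x > 0 then poly p (1 / x) * exp (- (1 / x)) else 0)"

text \<open>The factor \<open>y ^ k\<close> serves the induction over the polynomial:
  \<open>pCons a p\<close> stands for \<open>a + y * p\<close>, and the extra \<open>y\<close> moves
  into the power.\<close>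

lemma tendsto_poly_mult_exp_minus: "((\<lambda>y::real. y ^ k * poly p y * exp (- y)) \<longlongrightarrow> 0) at_top"
proof (induction p arbitrary: k)
  case (pCons a p)
  have "((\<lambda>y. a * (y ^ k / exp y) + y ^ Suc k * poly p y * exp (- y)) \<longlongrightarrow> a * 0 + 0) at_top"
    by (intro tendsto_add tendsto_mult tendsto_const tendsto_power_div_exp_0 pCons.IH)
  then show ?case by (simp add: algebra_simps exp_minus divide_inverse)
qed auto

text \<open>In the variable \<open>y = 1 / x\<close>, differentiating
  \<open>p(y) * exp (- y)\<close> with respect to \<open>x\<close> gives
  \<open>y\<^sup>2 * (p(y) - p'(y)) * exp (- y)\<close>; the polynomial \<open>[:0,0,1:]\<close> is
  \<open>y\<^sup>2\<close>. Only the point 0 needs a limit.\<close>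

lemma bump_has_derivative:
  "(bump p has_real_derivative bump ([:0,0,1:] * (p - pderiv p)) x) (at x)"
proof (cases x "0::real" rule: linorder_cases)
  case greater
  have "((\<lambda>x. poly p (1 / x) * exp (- (1 / x))) has_real_derivative bump ([:0,0,1:] * (p - pderiv p)) x) (at x)"
    using greater
    by (auto intro!: derivative_eq_intros poly_DERIV[THEN DERIV_chain2] simp: bump_def field_simps)
  then show ?thesis
    by (rule has_field_derivative_transform_within_open[where S="{0<..}"]) (use greater in \<open>auto simp: bump_def\<close>)
next
  case less
  have "((\<lambda>x. 0) has_real_derivative bump ([:0,0,1:] * (p - pderiv p)) x) (at x)"
    using less by (auto simp: bump_def)
  then show ?thesis
    by (rule has_field_derivative_transform_within_open[where S="{..<0}"]) (use less in \<open>auto simp: bump_def\<close>)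
next
  case equal
  \<comment> \<open>With \<open>y = 1 / h\<close> this is the difference quotient
    \<open>bump p h / h\<close> for \<open>h > 0\<close>.\<close>
  have "((\<lambda>y. poly p y * y * exp (- y)) \<longlongrightarrow> 0) at_top"
    using tendsto_poly_mult_exp_minus[of 1 p] by (simp add: ac_simps)
  from filterlim_compose[OF this filterlim_inverse_at_top_right]
  have "((\<lambda>h. bump p h / h) \<longlongrightarrow> 0) (at_right 0)"
    by (rule Lim_transform_eventually)
      (auto simp: bump_def eventually_at_right_less divide_inverse intro!: eventually_mono[OF eventually_at_right_less[of 0]])
  moreover have "((\<lambda>h. bump p h / h) \<longlongrightarrow> 0) (at_left 0)"
    by (rule Lim_transform_eventually[OF tendsto_const])
      (auto simp: bump_def intro!: eventually_at_leftI[of "-1"])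
  ultimately have "((\<lambda>h. bump p h / h) \<longlongrightarrow> 0) (at 0)"
    by (simp add: filterlim_at_split)
  then show ?thesis
    using equal by (simp add: has_field_derivative_iff bump_def)
qed

lemma smooth_bump: "smooth (bump p)"
  by (rule smooth_realI[of bump]) (rule bump_has_derivative)

section \<open>Test functions\<close>

lemma test_functionI:
  assumes "smooth f" "compact K" "\<And>x. x \<notin> K \<Longrightarrow> f x = 0" "K \<subseteq> D"
  shows "test_function D f"
proof -
  have "closure {x. f x \<noteq> 0} \<subseteq> K"
    using assms(2,3) by (intro closure_minimal) (auto simp: compact_imp_closed)
  then have "compact (closure {x. f x \<noteq> 0})"
    using assms(2) compact_closure bounded_subset compact_imp_bounded closure_subset by metis
  with \<open>closure _ \<subseteq> K\<close> assms show ?thesis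
    by (auto simp: test_function_def smooth_def)
qed

lemma test_functionE:
  assumes "test_function D f"
  obtains K where "smooth f" "compact K" "\<And>x. x \<notin> K \<Longrightarrow> f x = 0" "K \<subseteq> D"
proof (rule that)
  show "smooth f" "compact (closure {x. f x \<noteq> 0})" "closure {x. f x \<noteq> 0} \<subseteq> D"
    using assms by (auto simp: test_function_def smooth_def)
  show "f x = 0" if "x \<notin> closure {x. f x \<noteq> 0}" for x
    using that closure_subset[of "{x. f x \<noteq> 0}"] by auto
qed

lemma test_function_smooth: "test_function D f \<Longrightarrow> smooth f"
  by (auto simp: test_function_def smooth_def)

lemma test_function_eq_0: "test_function D f \<Longrightarrow> x \<notin> D \<Longrightarrow> f x = 0"
  by (elim test_functionE) auto

lemma test_function_mult:
  "test_function D f \<Longrightarrow> smooth g \<Longrightarrow> test_function D (\<lambda>x. f x * g x)"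
  by (elim test_functionE, rule test_functionI, rule smooth_mult) auto

lemma test_function_cmult:
  "test_function D f \<Longrightarrow> test_function D (\<lambda>x. c * f x)"
  using test_function_mult[of D f "\<lambda>x. c"] by (simp add: mult.commute)

lemma test_function_compose:
  "test_function D f \<Longrightarrow> smooth h \<Longrightarrow> h 0 = 0 \<Longrightarrow> test_function D (\<lambda>x. h (f x))"
  by (elim test_functionE, rule test_functionI, rule smooth_compose) auto

lemma test_function_0: "test_function D (\<lambda>x. 0)"
  by (rule test_functionI[of _ "{}"]) auto

lemma test_function_add:
  assumes "test_function D f" "test_function D g"
  shows "test_function D (\<lambda>x. f x + g x)"
proof -
  obtain K where K: "smooth f" "compact K" "\<And>x. x \<notin> K \<Longrightarrow> f x = 0" "K \<subseteq> D"
    using test_functionE[OF assms(1)] by blast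
  obtain L where L: "smooth g" "compact L" "\<And>x. x \<notin> L \<Longrightarrow> g x = 0" "L \<subseteq> D"
    using test_functionE[OF assms(2)] by blast
  show ?thesis
    by (rule test_functionI[of _ "K \<union> L"]) (use K L in \<open>auto intro: smooth_add\<close>)
qed

lemma test_function_sum:
  "(\<And>i. i \<in> I \<Longrightarrow> test_function D (f i)) \<Longrightarrow> test_function D (\<lambda>x. \<Sum>i\<in>I. f i x)"
  by (induction I rule: infinite_finite_induct) (simp_all add: test_function_add test_function_0)

lemma test_function_partial_deriv:
  assumes "test_function D f" "b \<in> Basis"
  shows "test_function D (partial_deriv b f)"
proof -
  obtain K where K: "smooth f" "compact K" "\<And>x. x \<notin> K \<Longrightarrow> f x = 0" "K \<subseteq> D"
    using test_functionE[OF assms(1)] by blast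
  have "partial_deriv b f x = 0" if "x \<notin> K" for x
  proof -
    have "(f has_derivative (\<lambda>_. 0)) (at x)"
      by (rule has_derivative_transform_within_open[where f="\<lambda>_. 0" and s="- K"])
        (use K that in \<open>auto simp: compact_imp_closed open_Compl\<close>)
    then show ?thesis
      using partial_deriv_eq by blast
  qed
  then show ?thesis
    by (intro test_functionI[of _ K] smooth_partial_deriv K assms) auto
qed

lemma test_function_laplacian: "test_function D f \<Longrightarrow> test_function D (laplacian f)"
  unfolding laplacian_def[abs_def] by (intro test_function_sum test_function_partial_deriv)

lemma bump_pos_iff: "bump 1 x > 0 \<longleftrightarrow> x > 0"
  and bump_nonneg: "bump 1 x \<ge> 0"
  by (auto simp: bump_def)

lemma smooth_ball_bump: "smooth (\<lambda>x::'a::euclidean_space. bump p (R - (x - a) \<bullet> (x - a)))"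
  by (intro smooth_compose[OF _ smooth_bump] smooth_diff smooth_const smooth_inner_self)

lemma test_function_ball_bump:
  assumes "cball a r \<subseteq> D" "R \<le> r\<^sup>2" "r \<ge> 0"
  shows "test_function D (\<lambda>x. bump p (R - (x - a) \<bullet> (x - a)))"
proof (rule test_functionI[OF smooth_ball_bump compact_cball _ assms(1)], rule ccontr)
  fix x assume x: "x \<notin> cball a r" and "bump p (R - (x - a) \<bullet> (x - a)) \<noteq> 0"
  then have "(norm (x - a))\<^sup>2 < r\<^sup>2"
    using assms by (auto simp: bump_def power2_norm_eq_inner split: if_splits)
  with x show False
    using assms(3) by (auto simp: dist_norm norm_minus_commute dest: power2_less_imp_less)
qed

text \<open>A countable cover by balls whose closures lie in \<open>D\<close> gives bumps
  \<open>b j\<close> whose partial sums \<open>s k\<close> are test functions and become positive at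
  each point of \<open>D\<close> from some index on. It remains to turn positivity into convergence
  to 1.\<close>

lemma test_function_cutoffs:
  fixes D :: "'a::euclidean_space set"
  assumes "open D"
  obtains ct :: "nat \<Rightarrow> 'a \<Rightarrow> real"
  where "\<And>k. test_function D (ct k)" "\<And>k x. 0 \<le> ct k x" "\<And>k x. ct k x \<le> 1"
    "\<And>x. x \<in> D \<Longrightarrow> (\<lambda>k. ct k x) \<longlonglongrightarrow> 1"
proof (cases "D = {}")
  case True
  then show ?thesis using that[of "\<lambda>k x. 0"] test_function_0 by auto
next
  case False
  have "\<forall>x\<in>D. \<exists>r>0. cball x r \<subseteq> D"
    using assms open_contains_cball by blast
  then obtain r where r: "\<And>x. x \<in> D \<Longrightarrow> r x > 0 \<and> cball x (r x) \<subseteq> D"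
    by metis
  obtain \<F> where \<F>: "\<F> \<subseteq> (\<lambda>x. ball x (r x)) ` D" "countable \<F>" "\<Union>\<F> = \<Union>((\<lambda>x. ball x (r x)) ` D)"
    using Lindelof[of "(\<lambda>x. ball x (r x)) ` D"] by auto
  obtain A where A: "countable A" "A \<subseteq> D" "\<F> = (\<lambda>x. ball x (r x)) ` A"
    using countable_subset_image[of \<F> "\<lambda>x. ball x (r x)" D] \<F> by blast
  have cover: "\<exists>a\<in>A. x \<in> ball a (r a)" if "x \<in> D" for x
  proof -
    have "x \<in> \<Union>((\<lambda>x. ball x (r x)) ` D)" using that r by force
    then have "x \<in> \<Union>((\<lambda>x. ball x (r x)) ` A)" by (simp only: \<F>(3)[symmetric] A(3)[symmetric])
    then show ?thesis by blast
  qed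
  then have "A \<noteq> {}" using False by blast
  define c where "c = from_nat_into A"
  have cA: "c j \<in> A" for j
    using \<open>A \<noteq> {}\<close> by (simp add: c_def from_nat_into)
  define b where "b = (\<lambda>j x. bump 1 ((r (c j))\<^sup>2 - (x - c j) \<bullet> (x - c j)))"
  have b: "test_function D (b j)" for j
    unfolding b_def
    by (rule test_function_ball_bump[where r="r (c j)"]) (use r[of "c j"] cA[of j] A(2) in \<open>auto intro: less_imp_le\<close>)
  have b0: "b j x \<ge> 0" for j x
    by (simp add: b_def bump_nonneg)
  define s where "s = (\<lambda>k x. \<Sum>j<k. b j x)"
  have s0: "s k x \<ge> 0" for k x
    by (simp add: s_def b0 sum_nonneg)
  \<comment> \<open>The map \<open>1 - exp (- y)\<close> sends 0 to 0, which preserves compact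
    support, and stays in the unit interval for \<open>y \<ge> 0\<close>; the factor
    \<open>k\<close> drives it to 1 wherever the sums stay away from 0.\<close>
  define ct where "ct = (\<lambda>k x. 1 - exp (- (real k * s k x)))"
  have expm: "smooth (\<lambda>y::real. 1 - exp (- y))"
  proof -
    have "smooth (\<lambda>y::real. \<alpha> * exp (- y))" for \<alpha> :: real
      by (rule smooth_realI[of "\<lambda>\<alpha> y. \<alpha> * exp (- y)" uminus]) (auto intro!: derivative_eq_intros)
    from smooth_diff[OF smooth_const[of 1] this[of 1]] show ?thesis by simp
  qed
  show ?thesis
  proof (rule that)
    show "test_function D (ct k)" for k
      unfolding ct_def s_def
      by (rule test_function_compose[OF _ expm]) (auto intro!: test_function_cmult test_function_sum b)
    show "0 \<le> ct k x" "ct k x \<le> 1" for k x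
      using s0 by (auto simp: ct_def)
    show "(\<lambda>k. ct k x) \<longlonglongrightarrow> 1" if x: "x \<in> D" for x
    proof -
      obtain a where "a \<in> A" "x \<in> ball a (r a)"
        using cover[OF x] by blast
      then obtain j where j: "x \<in> ball (c j) (r (c j))"
        using from_nat_into_surj[OF A(1)] unfolding c_def by metis
      have "(norm (x - c j))\<^sup>2 < (r (c j))\<^sup>2"
        using j by (intro power_strict_mono) (auto simp: dist_norm norm_minus_commute)
      then have bj: "b j x > 0"
        by (simp add: b_def bump_pos_iff power2_norm_eq_inner)
      have "s k x \<ge> b j x" if "k > j" for k
        unfolding s_def by (rule member_le_sum) (use that b0 in auto)
      then have "\<forall>\<^sub>F k in sequentially. b j x * real k \<le> real k * s k x"
        by (intro eventually_sequentiallyI[of "Suc j"]) (auto simp: mult.commute intro!: mult_left_mono)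
      moreover have "filterlim (\<lambda>k. b j x * real k) at_top sequentially"
        by (rule filterlim_tendsto_pos_mult_at_top[OF tendsto_const bj filterlim_real_sequentially])
      ultimately have "filterlim (\<lambda>k. real k * s k x) at_top sequentially"
        by (rule filterlim_at_top_mono[rotated])
      then have "(\<lambda>k. exp (- (real k * s k x))) \<longlonglongrightarrow> 0"
        by (intro filterlim_compose[OF exp_at_bot] filterlim_compose[OF filterlim_uminus_at_bot_at_top])
      then show ?thesis
        unfolding ct_def using tendsto_diff[OF tendsto_const] by fastforce
    qed
  qed
qed

section \<open>Integration by parts for compactly supported functions\<close>

lemma continuous_integrable_lborel:
  fixes f :: "'a::euclidean_space \<Rightarrow> real"
  assumes "continuous_on UNIV f" "compact K" "\<And>x. x \<notin> K \<Longrightarrow> f x = 0"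
  shows "integrable lborel f"
proof -
  have "integrable lborel (\<lambda>x. indicator K x *\<^sub>R f x)"
    by (rule borel_integrable_compact) (use assms(1,2) continuous_on_subset[of UNIV f K] in auto)
  moreover have "(\<lambda>x. indicator K x *\<^sub>R f x) = f"
    using assms(3) by (auto simp: indicator_def fun_eq_iff)
  ultimately show ?thesis by simp
qed

lemma test_function_integrable_lborel: "test_function D f \<Longrightarrow> integrable lborel f"
  by (elim test_functionE) (auto intro!: continuous_integrable_lborel smooth_continuous)

text \<open>Transfers integrals over \<open>D\<close> to the whole space, where translation
  invariance of Lebesgue measure can be used.\<close>

lemma lebesgue_on_vanishing:
  fixes f :: "'a::euclidean_space \<Rightarrow> real"
  assumes "\<And>x. x \<notin> D \<Longrightarrow> f x = 0" "D \<in> sets lebesgue" "integrable lborel f"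
  shows "integrable (lebesgue_on D) f" "(LINT x|lebesgue_on D. f x) = (LINT x|lborel. f x)"
proof -
  have eq: "(\<lambda>x. indicator D x * f x) = f"
    using assms(1) by (auto simp: indicator_def fun_eq_iff)
  show "integrable (lebesgue_on D) f"
    using assms by (simp add: integrable_restrict_space eq integrable_completion)
  show "(LINT x|lebesgue_on D. f x) = (LINT x|lborel. f x)"
    using assms by (simp add: integral_restrict_space eq integral_completion)
qed

lemma test_function_integrable:
  "test_function D f \<Longrightarrow> D \<in> sets lebesgue \<Longrightarrow> integrable (lebesgue_on D) f"
  by (rule lebesgue_on_vanishing) (auto intro: test_function_eq_0 test_function_integrable_lborel)

lemma test_function_L2:
  assumes "test_function D f" "D \<in> sets lebesgue"
  shows "f \<in> L2 D"
  using test_function_integrable[OF assms]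
    test_function_integrable[OF test_function_mult[OF assms(1) test_function_smooth[OF assms(1)]] assms(2)]
  by (auto simp: L2_def power2_eq_square)

text \<open>By translation invariance every difference quotient of \<open>f\<close> in direction
  \<open>b\<close> has integral 0; dominated convergence passes this on to the derivative, without
  Fubini or iterated integrals.\<close>

lemma integral_partial_deriv_eq_0_lborel:
  fixes f :: "'a::euclidean_space \<Rightarrow> real"
  assumes f: "test_function UNIV f" and b: "b \<in> Basis"
  shows "(LINT x|lborel. partial_deriv b f x) = 0"
proof -
  obtain K where K: "smooth f" "compact K" "\<And>x. x \<notin> K \<Longrightarrow> f x = 0" "K \<subseteq> UNIV"
    using test_functionE[OF f] by blast
  obtain R where R: "\<And>x. x \<in> K \<Longrightarrow> norm x \<le> R"
    using compact_imp_bounded[OF K(2)] by (auto simp: bounded_iff)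
  obtain B where B: "\<And>x. \<bar>partial_deriv b f x\<bar> \<le> B"
  proof -
    obtain L where L: "smooth (partial_deriv b f)" "compact L" "\<And>x. x \<notin> L \<Longrightarrow> partial_deriv b f x = 0" "L \<subseteq> UNIV"
      using test_functionE[OF test_function_partial_deriv[OF f b]] by blast
    have "bounded (partial_deriv b f ` L)"
      by (intro compact_imp_bounded compact_continuous_image smooth_continuous L)
    then obtain B where B: "\<And>x. x \<in> L \<Longrightarrow> \<bar>partial_deriv b f x\<bar> \<le> B"
      by (auto simp: bounded_iff)
    show ?thesis
    proof (rule that)
      fix x show "\<bar>partial_deriv b f x\<bar> \<le> max 0 B"
        using B[of x] L(3) by (cases "x \<in> L") force+
    qed
  qed
  have der: "((\<lambda>t. f (x + t *\<^sub>R b)) has_real_derivative partial_deriv b f (x + s *\<^sub>R b)) (at s)" for x s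
  proof -
    have "((\<lambda>t. f (x + t *\<^sub>R b)) has_derivative (\<lambda>h. partial_deriv (0 + h *\<^sub>R b) f (x + s *\<^sub>R b))) (at s)"
      by (rule has_derivative_compose[OF _ smooth_has_derivative[OF K(1)]]) (auto intro!: derivative_eq_intros)
    moreover have "partial_deriv (h *\<^sub>R b) f y = partial_deriv b f y * h" for h y
      using linear_cmul[OF has_derivative_linear[OF smooth_has_derivative[OF K(1), of y]], of h b] by simp
    ultimately show ?thesis
      by (simp add: has_field_derivative_def)
  qed
  \<comment> \<open>Steps of length at most 1 keep the supports of all quotients in the fixed ball
    of radius \<open>R + 1\<close>.\<close>
  define h where "h = (\<lambda>n. 1 / (real n + 1))"
  have h: "0 < h n" "h n \<le> 1" for n by (auto simp: h_def)
  define q where "q = (\<lambda>n x. (f (x + h n *\<^sub>R b) - f x) / h n)"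
  have int_f: "integrable lborel f"
    by (rule test_function_integrable_lborel[OF f])
  have shift: "integrable lborel (\<lambda>x. f (x + v))" "(LINT x|lborel. f (x + v)) = (LINT x|lborel. f x)" for v
  proof -
    have "f \<in> borel_measurable borel"
      using smooth_continuous[OF K(1)] by (rule borel_measurable_continuous_onI)
    then show "(LINT x|lborel. f (x + v)) = (LINT x|lborel. f x)"
      using integral_distr[of "(+) v" lborel borel f] by (simp add: lborel_distr_plus add.commute)
    show "integrable lborel (\<lambda>x. f (x + v))"
      using integrable_distr[of "(+) v" lborel borel f] int_f by (simp add: lborel_distr_plus add.commute)
  qed
  have "(LINT x|lborel. q n x) = 0" for n
    unfolding q_def using shift int_f by (simp add: Bochner_Integration.integral_diff)
  moreover have "(\<lambda>n. LINT x|lborel. q n x) \<longlonglongrightarrow> (LINT x|lborel. partial_deriv b f x)"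
  proof (rule integral_dominated_convergence)
    show "partial_deriv b f \<in> borel_measurable lborel"
      using borel_measurable_continuous_onI[OF smooth_continuous[OF smooth_partial_deriv[OF K(1) b]]] by simp
    show "q n \<in> borel_measurable lborel" for n
      unfolding q_def using shift(1) int_f by (intro borel_measurable_divide borel_measurable_diff) auto
    show "integrable lborel (\<lambda>x. indicator (cball 0 (R + 1)) x *\<^sub>R B)"
      by (rule borel_integrable_compact) auto
    show "AE x in lborel. (\<lambda>n. q n x) \<longlonglongrightarrow> partial_deriv b f x"
    proof (rule AE_I2)
      fix x
      have "((\<lambda>t. (f (x + t *\<^sub>R b) - f x) / t) \<longlongrightarrow> partial_deriv b f x) (at 0)"
        using der[of x 0] by (simp add: has_field_derivative_iff)
      moreover have "h \<longlonglongrightarrow> 0"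
        using LIMSEQ_inverse_real_of_nat by (simp add: h_def inverse_eq_divide add.commute)
      then have "filterlim h (at 0) sequentially"
        using h(1) by (intro filterlim_atI) (auto simp: less_imp_neq[symmetric])
      ultimately show "(\<lambda>n. q n x) \<longlonglongrightarrow> partial_deriv b f x"
        unfolding q_def by (rule filterlim_compose)
    qed
    show "AE x in lborel. norm (q n x) \<le> indicator (cball 0 (R + 1)) x *\<^sub>R B" for n
    proof (rule AE_I2)
      fix x
      \<comment> \<open>The mean value theorem bounds the quotient by the maximum of the derivative,
        independently of \<open>n\<close>.\<close>
      have "\<exists>z. 0 < z \<and> z < h n \<and> f (x + h n *\<^sub>R b) - f (x + 0 *\<^sub>R b) = (h n - 0) * partial_deriv b f (x + z *\<^sub>R b)"
        by (rule MVT2[of 0 "h n" "\<lambda>t. f (x + t *\<^sub>R b)"]) (use h der in auto)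
      then obtain z where "f (x + h n *\<^sub>R b) - f x = h n * partial_deriv b f (x + z *\<^sub>R b)"
        by auto
      then have le: "\<bar>q n x\<bar> \<le> B"
        using h[of n] B by (simp add: q_def abs_mult)
      show "norm (q n x) \<le> indicator (cball 0 (R + 1)) x *\<^sub>R B"
      proof (cases "norm x \<le> R + 1")
        case False
        then have "norm (x + h n *\<^sub>R b) > R"
          using norm_triangle_ineq4[of "x + h n *\<^sub>R b" "h n *\<^sub>R b"] h[of n] b by auto
        then have "f x = 0" "f (x + h n *\<^sub>R b) = 0"
          using False R K(3) by (force)+
        then show ?thesis using le by (simp add: q_def)
      qed (use le in auto)
    qed
  qed
  ultimately show ?thesis
    by (simp add: LIMSEQ_const_iff)
qed

text \<open>The product \<open>f * g\<close> inherits compact support from \<open>f\<close>, so the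
  derivative of the product integrates to 0 although \<open>g\<close> may be an arbitrary smooth
  function.\<close>

lemma integration_by_parts:
  assumes f: "test_function D f" and g: "smooth g" and b: "b \<in> Basis" and D: "D \<in> sets lebesgue"
  shows "(LINT x|lebesgue_on D. f x * partial_deriv b g x) = - (LINT x|lebesgue_on D. partial_deriv b f x * g x)"
proof -
  have fg: "test_function UNIV (\<lambda>x. f x * g x)"
    using test_function_mult[OF f g] by (auto simp: test_function_def)
  have eq: "partial_deriv b (\<lambda>x. f x * g x) x = f x * partial_deriv b g x + partial_deriv b f x * g x" for x
    by (rule partial_deriv_eq) (intro has_derivative_mult smooth_has_derivative test_function_smooth[OF f] g)
  have t1: "test_function D (\<lambda>x. f x * partial_deriv b g x)"
    by (intro test_function_mult f smooth_partial_deriv g b)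
  have t2: "test_function D (\<lambda>x. partial_deriv b f x * g x)"
    by (intro test_function_mult test_function_partial_deriv f g b)
  note i = test_function_integrable_lborel[OF t1] test_function_integrable_lborel[OF t2]
  have "(LINT x|lborel. f x * partial_deriv b g x) + (LINT x|lborel. partial_deriv b f x * g x) = 0"
    using integral_partial_deriv_eq_0_lborel[OF fg b] i by (simp add: eq)
  then show ?thesis
    using lebesgue_on_vanishing(2)[OF test_function_eq_0[OF t1] D i(1)]
      lebesgue_on_vanishing(2)[OF test_function_eq_0[OF t2] D i(2)] by simp
qed

section \<open>Square-integrable functions\<close>

lemma L2_measurable: "f \<in> L2 D \<Longrightarrow> f \<in> borel_measurable (lebesgue_on D)"
  by (simp add: L2_def)

lemma L2_integrable_square: "f \<in> L2 D \<Longrightarrow> integrable (lebesgue_on D) (\<lambda>x. (f x)\<^sup>2)"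
  by (simp add: L2_def)

lemma L2_integrable_mult:
  assumes "f \<in> L2 D" "g \<in> L2 D"
  shows "integrable (lebesgue_on D) (\<lambda>x. f x * g x)"
proof (rule Bochner_Integration.integrable_bound)
  show "integrable (lebesgue_on D) (\<lambda>x. (f x)\<^sup>2 + (g x)\<^sup>2)"
    using assms by (intro Bochner_Integration.integrable_add L2_integrable_square)
  show "(\<lambda>x. f x * g x) \<in> borel_measurable (lebesgue_on D)"
    using assms by (intro borel_measurable_times L2_measurable)
  have "\<bar>a * b\<bar> \<le> a\<^sup>2 + b\<^sup>2" for a b :: real
    using sum_squares_bound[of "\<bar>a\<bar>" "\<bar>b\<bar>"] zero_le_power2[of a] zero_le_power2[of b]
    unfolding abs_mult power2_abs by linarith
  then show "AE x in lebesgue_on D. norm (f x * g x) \<le> norm ((f x)\<^sup>2 + (g x)\<^sup>2)"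
    by (intro AE_I2) simp
qed

lemma L2_dominated:
  assumes "f \<in> L2 D" "g \<in> borel_measurable (lebesgue_on D)"
    "AE x in lebesgue_on D. \<bar>g x\<bar> \<le> c * \<bar>f x\<bar>"
  shows "g \<in> L2 D"
proof -
  have "integrable (lebesgue_on D) (\<lambda>x. (g x)\<^sup>2)"
  proof (rule Bochner_Integration.integrable_bound)
    show "integrable (lebesgue_on D) (\<lambda>x. c\<^sup>2 * (f x)\<^sup>2)"
      using assms by (intro integrable_mult_right L2_integrable_square)
    show "AE x in lebesgue_on D. norm ((g x)\<^sup>2) \<le> norm (c\<^sup>2 * (f x)\<^sup>2)"
      using assms(3)
    proof eventually_elim
      case (elim x)
      from power_mono[OF this, of 2] show ?case
        by (simp add: power_mult_distrib)
    qed
  qed (use assms in measurable)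
  with assms show ?thesis by (simp add: L2_def)
qed

lemma L2_cmult: "f \<in> L2 D \<Longrightarrow> (\<lambda>x. c * f x) \<in> L2 D"
  by (rule L2_dominated[of f _ _ "\<bar>c\<bar>"]) (auto simp: abs_mult intro!: borel_measurable_times intro: L2_measurable)

lemma L2_add:
  assumes "f \<in> L2 D" "g \<in> L2 D"
  shows "(\<lambda>x. f x + g x) \<in> L2 D"
proof -
  have "(\<lambda>x. (f x + g x)\<^sup>2) = (\<lambda>x. (f x)\<^sup>2 + (g x)\<^sup>2 + 2 * (f x * g x))"
    by (auto simp: power2_sum)
  then show ?thesis
    using assms L2_integrable_mult[OF assms] by (simp add: L2_def borel_measurable_add)
qed

lemma L2_diff: "f \<in> L2 D \<Longrightarrow> g \<in> L2 D \<Longrightarrow> (\<lambda>x. f x - g x) \<in> L2 D"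
  using L2_add[of f D "\<lambda>x. (-1) * g x"] L2_cmult[of g D "-1"] by simp

lemma L2_sum_cmult: "f \<in> L2 D \<Longrightarrow> g \<in> L2 D \<Longrightarrow> (\<lambda>x. a * f x + b * g x) \<in> L2 D"
  by (intro L2_add L2_cmult)

lemma L2_divide: "f \<in> L2 D \<Longrightarrow> (\<lambda>x. f x / c) \<in> L2 D"
  using L2_cmult[of f D "inverse c"] by (simp add: divide_inverse mult.commute)

lemma l2norm_nonneg: "l2norm D f \<ge> 0"
  by (simp add: l2norm_def)

lemma l2norm_power2: "(l2norm D f)\<^sup>2 = (LINT x|lebesgue_on D. (f x)\<^sup>2)"
  by (simp add: l2norm_def)

lemma l2norm_cmult: "l2norm D (\<lambda>x. c * f x) = \<bar>c\<bar> * l2norm D f"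
  by (simp add: l2norm_def power_mult_distrib real_sqrt_mult)

lemma l2norm_cong_AE:
  assumes "AE x in lebesgue_on D. f x = g x" "f \<in> L2 D" "g \<in> L2 D"
  shows "l2norm D f = l2norm D g"
proof -
  have "(LINT x|lebesgue_on D. (f x)\<^sup>2) = (LINT x|lebesgue_on D. (g x)\<^sup>2)"
    using assms by (intro integral_cong_AE) (auto intro!: borel_measurable_power intro: L2_measurable)
  then show ?thesis by (simp add: l2norm_def)
qed

lemma L2_Cauchy_Schwarz:
  assumes "f \<in> L2 D" "g \<in> L2 D"
  shows "\<bar>LINT x|lebesgue_on D. f x * g x\<bar> \<le> l2norm D f * l2norm D g"
proof -
  define a b c where "a = (LINT x|lebesgue_on D. (f x)\<^sup>2)" and "b = (LINT x|lebesgue_on D. f x * g x)"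
    and "c = (LINT x|lebesgue_on D. (g x)\<^sup>2)"
  have quad: "a * t\<^sup>2 + 2 * b * t + c \<ge> 0" for t
  proof -
    have "(\<lambda>x. (t * f x + g x)\<^sup>2) = (\<lambda>x. t\<^sup>2 * (f x)\<^sup>2 + (2 * t) * (f x * g x) + (g x)\<^sup>2)"
      by (auto simp: power2_sum power_mult_distrib)
    then have "(LINT x|lebesgue_on D. (t * f x + g x)\<^sup>2) = t\<^sup>2 * a + (2 * t) * b + c"
      using assms L2_integrable_mult[OF assms] by (simp only: L2_def a_def b_def c_def mem_Collect_eq
        Bochner_Integration.integral_add integrable_mult_right Bochner_Integration.integrable_add integral_mult_right_zero)
    moreover have "(LINT x|lebesgue_on D. (t * f x + g x)\<^sup>2) \<ge> 0" by simp
    ultimately show ?thesis by (simp add: mult_ac)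
  qed
  have a: "a \<ge> 0" and c: "c \<ge> 0" by (auto simp: a_def c_def)
  have "b\<^sup>2 \<le> a * c"
  proof (cases "a = 0")
    case True
    have "b = 0"
    proof (rule ccontr)
      assume "b \<noteq> 0"
      \<comment> \<open>For \<open>a = 0\<close> the quadratic is affine in \<open>t\<close>, and
        this value of \<open>t\<close> makes it equal to -1.\<close>
      then show False using quad[of "- (c + 1) / (2 * b)"] True by (simp add: field_simps)
    qed
    then show ?thesis using a c by simp
  next
    case False
    then have "a > 0" using a by simp
    with quad[of "- b / a"] have "c - b\<^sup>2 / a \<ge> 0"
      by (simp add: power2_eq_square field_simps)
    then show ?thesis using \<open>a > 0\<close> by (simp add: field_simps)
  qed
  then have "sqrt (b\<^sup>2) \<le> sqrt (a * c)" by (rule real_sqrt_le_mono)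
  then show ?thesis
    by (simp add: l2norm_def real_sqrt_mult a_def b_def c_def)
qed

lemma l2norm_triangle:
  assumes "f \<in> L2 D" "g \<in> L2 D"
  shows "l2norm D (\<lambda>x. f x + g x) \<le> l2norm D f + l2norm D g"
proof -
  have "(\<lambda>x. (f x + g x)\<^sup>2) = (\<lambda>x. (f x)\<^sup>2 + 2 * (f x * g x) + (g x)\<^sup>2)"
    by (auto simp: power2_sum)
  then have "(l2norm D (\<lambda>x. f x + g x))\<^sup>2
      = (l2norm D f)\<^sup>2 + 2 * (LINT x|lebesgue_on D. f x * g x) + (l2norm D g)\<^sup>2"
    using assms L2_integrable_mult[OF assms] by (simp add: L2_def l2norm_power2)
  also have "\<dots> \<le> (l2norm D f + l2norm D g)\<^sup>2"
    using L2_Cauchy_Schwarz[OF assms] by (simp add: power2_sum)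
  finally show ?thesis
    by (rule power2_le_imp_le) (simp add: l2norm_nonneg)
qed

lemma l2norm_triangle_diff:
  assumes "f \<in> L2 D" "g \<in> L2 D"
  shows "l2norm D (\<lambda>x. f x - g x) \<le> l2norm D f + l2norm D g"
  using l2norm_triangle[OF assms(1) L2_cmult[OF assms(2)], of "-1"] l2norm_cmult[of D "-1" g] by simp

lemma L2_bounded:
  assumes "f \<in> borel_measurable (lebesgue_on D)" "D \<in> lmeasurable" "\<And>x. x \<in> D \<Longrightarrow> \<bar>f x\<bar> \<le> B"
  shows "f \<in> L2 D" "l2norm D f \<le> \<bar>B\<bar> * sqrt (measure lebesgue D)"
proof -
  have fin: "finite_measure (lebesgue_on D)"
    using assms(2) by (rule finite_measure_lebesgue_on)
  have le: "(f x)\<^sup>2 \<le> B\<^sup>2" if "x \<in> D" for x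
    using power_mono[OF assms(3)[OF that], of 2] by simp
  have int: "integrable (lebesgue_on D) (\<lambda>x. (f x)\<^sup>2)"
    by (rule finite_measure.integrable_const_bound[OF fin, of _ "B\<^sup>2"]) (use assms le in \<open>auto intro!: AE_I2\<close>)
  with assms show "f \<in> L2 D" by (simp add: L2_def)
  have "(LINT x|lebesgue_on D. (f x)\<^sup>2) \<le> (LINT x|lebesgue_on D. B\<^sup>2)"
    by (rule integral_mono[OF int]) (use le fin in \<open>auto simp: finite_measure.integrable_const\<close>)
  also have "\<dots> = B\<^sup>2 * measure lebesgue D"
    using assms(2) by (simp add: measure_restrict_space mult.commute fmeasurableD)
  finally have "l2norm D f \<le> sqrt (B\<^sup>2 * measure lebesgue D)"
    unfolding l2norm_def by (rule real_sqrt_le_mono)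
  then show "l2norm D f \<le> \<bar>B\<bar> * sqrt (measure lebesgue D)"
    by (simp add: real_sqrt_mult)
qed

section \<open>Dissipativity of the Dirichlet Laplacian\<close>

text \<open>Supplies the known elements of the generator's domain. The constant sequence
  \<open>f\<close> witnesses membership in \<open>H10\<close>, and integrating by parts twice
  identifies the distributional Laplacian.\<close>

lemma dirichlet_laplacian_test_function:
  assumes f: "test_function D f" and D: "D \<in> sets lebesgue"
  shows "dirichlet_laplacian D f (laplacian f)"
proof -
  note L2 = test_function_L2[OF _ D]
  have "weak_gradient D f (\<lambda>b. partial_deriv b f)"
    unfolding weak_gradient_def
    by (intro conjI ballI allI impI L2 test_function_partial_deriv f integration_by_parts[OF _ _ _ D] test_function_smooth)
  then have "f \<in> H10 D"
    unfolding H10_def using f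
    by (intro CollectI exI[of _ "\<lambda>b. partial_deriv b f"] exI[of _ "\<lambda>k. f"]) (auto simp: l2norm_def)
  moreover have "(LINT x|lebesgue_on D. f x * laplacian g x) = (LINT x|lebesgue_on D. laplacian f x * g x)"
    if g: "test_function D g" for g
  proof -
    have eq: "(LINT x|lebesgue_on D. f x * partial_deriv b (partial_deriv b g) x)
        = (LINT x|lebesgue_on D. partial_deriv b (partial_deriv b f) x * g x)" if b: "b \<in> Basis" for b
    proof -
      note integration_by_parts[OF f smooth_partial_deriv[OF test_function_smooth[OF g] b] b D]
      also note integration_by_parts[OF test_function_partial_deriv[OF f b] test_function_smooth[OF g] b D]
      finally show ?thesis by (simp only: minus_minus)
    qed
    have "(LINT x|lebesgue_on D. f x * laplacian g x)
        = (\<Sum>b\<in>Basis. LINT x|lebesgue_on D. f x * partial_deriv b (partial_deriv b g) x)"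
      unfolding laplacian_def sum_distrib_left
      by (rule Bochner_Integration.integral_sum)
        (intro L2_integrable_mult L2 test_function_partial_deriv f g)
    also have "\<dots> = (\<Sum>b\<in>Basis. LINT x|lebesgue_on D. partial_deriv b (partial_deriv b f) x * g x)"
      by (rule sum.cong) (auto simp: eq)
    also have "\<dots> = (LINT x|lebesgue_on D. laplacian f x * g x)"
      unfolding laplacian_def sum_distrib_right
      by (rule Bochner_Integration.integral_sum[symmetric])
        (intro L2_integrable_mult L2 test_function_partial_deriv f g)
    finally show ?thesis .
  qed
  ultimately show ?thesis
    by (auto simp: dirichlet_laplacian_def intro: L2 test_function_laplacian f)
qed

lemma lipschitz_of_bounded_derivative:
  fixes \<theta> :: "real \<Rightarrow> real"
  assumes "\<And>y. (\<theta> has_real_derivative \<theta>' y) (at y)" "\<And>y. 0 \<le> \<theta>' y" "\<And>y. \<theta>' y \<le> L"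
  shows "\<bar>\<theta> a - \<theta> b\<bar> \<le> L * \<bar>a - b\<bar>"
proof -
  have "0 \<le> L" using assms(2,3)[of 0] by linarith
  have "norm (\<theta> a - \<theta> b) \<le> L * norm (a - b)"
    by (rule differentiable_bound[where S=UNIV and f'="\<lambda>x. (*) (\<theta>' x)"])
      (use assms \<open>0 \<le> L\<close> in \<open>auto simp: has_field_derivative_def abs_mult intro!: onorm_bound mult_right_mono\<close>)
  then show ?thesis by simp
qed

lemma L2_compose:
  assumes "f \<in> L2 D" "\<theta> \<in> borel_measurable borel" "\<And>y. \<bar>\<theta> y\<bar> \<le> L * \<bar>y\<bar>"
  shows "(\<lambda>x. \<theta> (f x)) \<in> L2 D" "l2norm D (\<lambda>x. \<theta> (f x)) \<le> L * l2norm D f"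
proof -
  have meas: "(\<lambda>x. \<theta> (f x)) \<in> borel_measurable (lebesgue_on D)"
    using assms(1,2) by (auto intro: measurable_compose[OF L2_measurable])
  show L2: "(\<lambda>x. \<theta> (f x)) \<in> L2 D"
    by (rule L2_dominated[OF assms(1) meas]) (use assms(3) in auto)
  have "L \<ge> 0" using assms(3)[of 1] by simp
  have "(LINT x|lebesgue_on D. (\<theta> (f x))\<^sup>2) \<le> (LINT x|lebesgue_on D. (L * f x)\<^sup>2)"
  proof (rule integral_mono[OF L2_integrable_square[OF L2] L2_integrable_square[OF L2_cmult[OF assms(1)]]])
    fix x show "(\<theta> (f x))\<^sup>2 \<le> (L * f x)\<^sup>2"
      using power_mono[OF assms(3)[of "f x"], of 2] by (simp add: power_mult_distrib)
  qed
  then have "l2norm D (\<lambda>x. \<theta> (f x)) \<le> l2norm D (\<lambda>x. L * f x)"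
    by (simp add: l2norm_def)
  then show "l2norm D (\<lambda>x. \<theta> (f x)) \<le> L * l2norm D f"
    using \<open>L \<ge> 0\<close> by (simp add: l2norm_cmult)
qed

text \<open>Since the gradients \<open>p\<close> of the approximating test functions satisfy
  \<open>g p \<ge> - (g - p)\<^sup>2 / 4\<close>, no chain rule for weak derivatives is needed.\<close>
lemma dirichlet_laplacian_dissipative:
  assumes uw: "dirichlet_laplacian D u w" and D: "D \<in> sets lebesgue"
    and \<theta>: "smooth \<theta>" "\<And>y. (\<theta> has_real_derivative \<theta>' y) (at y)" "\<And>y. 0 \<le> \<theta>' y" "\<And>y. \<theta>' y \<le> L" "\<theta> 0 = 0"
  shows "(LINT x|lebesgue_on D. w x * \<theta> (u x)) \<le> 0"
proof -
  obtain g \<phi> where g: "weak_gradient D u g" and \<phi>: "\<And>k::nat. test_function D (\<phi> k)"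
    and lim0: "(\<lambda>k. l2norm D (\<lambda>x. \<phi> k x - u x)) \<longlonglongrightarrow> 0"
    and lim1: "\<And>b. b \<in> Basis \<Longrightarrow> (\<lambda>k. l2norm D (\<lambda>x. partial_deriv b (\<phi> k) x - g b x)) \<longlonglongrightarrow> 0"
    using uw unfolding dirichlet_laplacian_def H10_def by blast
  have w: "w \<in> L2 D" using uw by (simp add: dirichlet_laplacian_def)
  have u: "u \<in> L2 D" and gL2: "\<And>b. b \<in> Basis \<Longrightarrow> g b \<in> L2 D"
    using g by (auto simp: weak_gradient_def)
  note L2 = test_function_L2[OF _ D]
  have Lip: "\<bar>\<theta> a - \<theta> b\<bar> \<le> L * \<bar>a - b\<bar>" for a b
    by (rule lipschitz_of_bounded_derivative[OF \<theta>(2-4)])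
  have L0: "L \<ge> 0" using \<theta>(3)[of 0] \<theta>(4)[of 0] by linarith
  have \<theta>meas: "\<theta> \<in> borel_measurable borel"
    using smooth_continuous[OF \<theta>(1)] by (rule borel_measurable_continuous_onI)
  have \<theta>u: "(\<lambda>x. \<theta> (u x)) \<in> L2 D"
    by (rule L2_compose(1)[OF u \<theta>meas, of L]) (use Lip[of _ 0] \<theta>(5) in simp)
  \<comment> \<open>The composition is formed with the approximating test functions, not with
    \<open>u\<close>: since \<open>\<theta> 0 = 0\<close>, each \<open>\<psi> k\<close> is again a
    test function and may be inserted into both weak formulations.\<close>
  define \<psi> where "\<psi> = (\<lambda>k x. \<theta> (\<phi> k x))"
  have \<psi>: "test_function D (\<psi> k)" for k
    unfolding \<psi>_def by (rule test_function_compose[OF \<phi> \<theta>(1,5)])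
  have pd: "partial_deriv b (\<psi> k) x = \<theta>' (\<phi> k x) * partial_deriv b (\<phi> k) x" for b k x
    unfolding \<psi>_def by (rule partial_deriv_smooth_compose[OF test_function_smooth[OF \<phi>] \<theta>(2)])
  define e where "e = (\<lambda>b k. (l2norm D (\<lambda>x. partial_deriv b (\<phi> k) x - g b x))\<^sup>2)"
  have main: "(LINT x|lebesgue_on D. w x * \<psi> k x) \<le> (\<Sum>b\<in>Basis. L / 4 * e b k)" for k
  proof -
    have "(LINT x|lebesgue_on D. w x * \<psi> k x) = (LINT x|lebesgue_on D. u x * laplacian (\<psi> k) x)"
      using uw \<psi> by (simp add: dirichlet_laplacian_def)
    also have "\<dots> = (\<Sum>b\<in>Basis. LINT x|lebesgue_on D. u x * partial_deriv b (partial_deriv b (\<psi> k)) x)"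
      unfolding laplacian_def sum_distrib_left
      by (rule Bochner_Integration.integral_sum) (intro L2_integrable_mult L2 test_function_partial_deriv u \<psi>)
    also have "\<dots> \<le> (\<Sum>b\<in>Basis. L / 4 * e b k)"
    proof (rule sum_mono)
      fix b :: 'a assume b: "b \<in> Basis"
      have "(LINT x|lebesgue_on D. u x * partial_deriv b (partial_deriv b (\<psi> k)) x)
          = - (LINT x|lebesgue_on D. g b x * partial_deriv b (\<psi> k) x)"
        using g b test_function_partial_deriv[OF \<psi> b] unfolding weak_gradient_def by blast
      also have "\<dots> = (LINT x|lebesgue_on D. - (g b x * partial_deriv b (\<psi> k) x))"
        by simp
      also have "\<dots> \<le> (LINT x|lebesgue_on D. L / 4 * (partial_deriv b (\<phi> k) x - g b x)\<^sup>2)"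
      proof (rule integral_mono)
        show "integrable (lebesgue_on D) (\<lambda>x. - (g b x * partial_deriv b (\<psi> k) x))"
          by (intro Bochner_Integration.integrable_minus L2_integrable_mult gL2 L2 test_function_partial_deriv b \<psi>)
        show "integrable (lebesgue_on D) (\<lambda>x. L / 4 * (partial_deriv b (\<phi> k) x - g b x)\<^sup>2)"
          by (intro integrable_mult_right L2_integrable_square L2_diff gL2 L2 test_function_partial_deriv b \<phi>)
        fix x
        define p where "p = partial_deriv b (\<phi> k) x"
        define t where "t = \<theta>' (\<phi> k x)"
        have "- (4 * (g b x * p)) \<le> (p - g b x)\<^sup>2"
          using zero_le_power2[of "g b x + p"] by (simp add: power2_eq_square algebra_simps)
        then have "t * (- (4 * (g b x * p))) \<le> t * (p - g b x)\<^sup>2"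
          using \<theta>(3) by (intro mult_left_mono) (auto simp: t_def)
        also have "\<dots> \<le> L * (p - g b x)\<^sup>2"
          using \<theta>(4) by (intro mult_right_mono) (auto simp: t_def)
        finally show "- (g b x * partial_deriv b (\<psi> k) x) \<le> L / 4 * (partial_deriv b (\<phi> k) x - g b x)\<^sup>2"
          by (simp add: pd p_def[symmetric] t_def[symmetric] mult_ac)
      qed
      also have "\<dots> = L / 4 * e b k"
        by (simp add: e_def l2norm_power2)
      finally show "(LINT x|lebesgue_on D. u x * partial_deriv b (partial_deriv b (\<psi> k)) x) \<le> L / 4 * e b k" .
    qed
    finally show ?thesis .
  qed
  \<comment> \<open>Exchanging \<open>\<psi> k\<close> for \<open>\<theta> (u x)\<close> costs at
    most the Lipschitz constant times the L2 distance of \<open>\<phi> k\<close> to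
    \<open>u\<close>, so both error terms vanish in the limit.\<close>
  have lhs: "(LINT x|lebesgue_on D. w x * \<theta> (u x)) \<le> (\<Sum>b\<in>Basis. L / 4 * e b k)
      + l2norm D w * (L * l2norm D (\<lambda>x. \<phi> k x - u x))" for k
  proof -
    have d: "(\<lambda>x. \<phi> k x - u x) \<in> L2 D" by (intro L2_diff L2 \<phi> u)
    have d2: "(\<lambda>x. \<theta> (u x) - \<psi> k x) \<in> L2 D" by (intro L2_diff L2 \<psi> \<theta>u)
    have "(LINT x|lebesgue_on D. w x * \<theta> (u x)) - (LINT x|lebesgue_on D. w x * \<psi> k x)
        = (LINT x|lebesgue_on D. w x * (\<theta> (u x) - \<psi> k x))"
      using L2_integrable_mult[OF w \<theta>u] L2_integrable_mult[OF w L2[OF \<psi>]]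
      by (simp add: right_diff_distrib)
    also have "\<dots> \<le> l2norm D w * l2norm D (\<lambda>x. \<theta> (u x) - \<psi> k x)"
      using L2_Cauchy_Schwarz[OF w d2] by simp
    also have "l2norm D (\<lambda>x. \<theta> (u x) - \<psi> k x) \<le> l2norm D (\<lambda>x. L * (\<phi> k x - u x))"
      unfolding l2norm_def
    proof (intro real_sqrt_le_mono integral_mono L2_integrable_square d2 L2_cmult d)
      fix x show "(\<theta> (u x) - \<psi> k x)\<^sup>2 \<le> (L * (\<phi> k x - u x))\<^sup>2"
        using power_mono[OF Lip[of "\<phi> k x" "u x"], of 2]
        by (simp add: \<psi>_def power_mult_distrib power2_commute)
    qed
    finally show ?thesis
      using main[of k] l2norm_nonneg[of D w] L0 by (simp add: l2norm_cmult mult_left_mono)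
  qed
  have "(\<lambda>k. (\<Sum>b\<in>Basis. L / 4 * e b k) + l2norm D w * (L * l2norm D (\<lambda>x. \<phi> k x - u x)))
      \<longlonglongrightarrow> (\<Sum>b\<in>(Basis::'a set). L / 4 * 0\<^sup>2) + l2norm D w * (L * 0)"
    unfolding e_def by (intro tendsto_intros lim0 lim1)
  then show ?thesis
    using LIMSEQ_le_const[of _ 0 "LINT x|lebesgue_on D. w x * \<theta> (u x)"] lhs by auto
qed

text \<open>For \<open>x > 0\<close> this is \<open>x\<^sup>2 * exp (- 1 / x)\<close>, a smooth
  substitute for the squared positive part. The bump alone is concave for large \<open>x\<close>;
  the factor \<open>x\<^sup>2\<close> makes the function convex, with bounded second derivative and
  quadratic growth suited to L2.\<close>

definition penalty :: "real \<Rightarrow> real" where "penalty x = x\<^sup>2 * bump 1 x"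
definition penalty' :: "real \<Rightarrow> real" where "penalty' x = (2 * x + 1) * bump 1 x"
definition penalty'' :: "real \<Rightarrow> real" where "penalty'' x = 2 * bump 1 x + (2 * x + 1) * bump [:0, 0, 1:] x"

lemma bump_1_has_derivative: "(bump 1 has_real_derivative bump [:0, 0, 1:] x) (at x)"
  using bump_has_derivative[of 1 x] by (simp add: pderiv_1)

lemma bump_square: "x\<^sup>2 * bump [:0, 0, 1:] x = bump 1 x"
  by (auto simp: bump_def power2_eq_square)

lemma penalty_has_derivative: "(penalty has_real_derivative penalty' x) (at x)"
proof -
  have "((\<lambda>x. x\<^sup>2 * bump 1 x) has_real_derivative 2 * x * bump 1 x + bump [:0, 0, 1:] x * x\<^sup>2) (at x)"
    by (rule derivative_eq_intros bump_1_has_derivative refl)+ simp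
  then show ?thesis
    using bump_square[of x] by (simp add: penalty_def[abs_def] penalty'_def algebra_simps)
qed

lemma penalty'_has_derivative: "(penalty' has_real_derivative penalty'' x) (at x)"
proof -
  have "((\<lambda>x. (2 * x + 1) * bump 1 x) has_real_derivative 2 * bump 1 x + bump [:0, 0, 1:] x * (2 * x + 1)) (at x)"
    by (rule derivative_eq_intros bump_1_has_derivative refl)+ simp
  then show ?thesis
    by (simp add: penalty'_def[abs_def] penalty''_def algebra_simps)
qed

lemma smooth_penalty': "smooth penalty'"
  unfolding penalty'_def[abs_def] by (intro smooth_mult smooth_add smooth_const smooth_ident smooth_bump)

lemma smooth_penalty: "smooth penalty"
  unfolding penalty_def[abs_def] by (intro smooth_mult smooth_power smooth_ident smooth_bump)

text \<open>With \<open>y = 1 / x\<close> the value is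
  \<open>(2 + 2 * y + y\<^sup>2) * exp (- y)\<close>. The quadratic Taylor bound for
  \<open>exp y\<close> makes each of the three terms at most 2, whence the constant 6.\<close>

lemma penalty''_bounds: "0 \<le> penalty'' x" "penalty'' x \<le> 6"
proof -
  have "0 \<le> penalty'' x \<and> penalty'' x \<le> 6"
  proof (cases "x > 0")
    case True
    define y where "y = 1 / x"
    have y: "y > 0" "x = 1 / y" using True by (auto simp: y_def)
    have eq: "penalty'' x = 2 * exp (- y) + 2 * (y * exp (- y)) + y\<^sup>2 * exp (- y)"
      using True y(1) by (simp add: penalty''_def bump_def y(2) field_simps power2_eq_square)
    have "1 + y + y\<^sup>2 / 2 \<le> exp y" using y by (intro exp_lower_Taylor_quadratic) simp
    then have "y \<le> exp y" "y\<^sup>2 \<le> 2 * exp y" using y zero_le_power2[of y] by linarith+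
    then have "y * exp (- y) \<le> 1" "y\<^sup>2 * exp (- y) \<le> 2" "exp (- y) \<le> 1"
      using y by (auto simp: exp_minus field_simps)
    moreover have "0 \<le> y * exp (- y)" "0 \<le> y\<^sup>2 * exp (- y)" "0 \<le> exp (- y)" using y by auto
    ultimately show ?thesis unfolding eq by linarith
  qed (auto simp: penalty''_def bump_def)
  then show "0 \<le> penalty'' x" "penalty'' x \<le> 6" by auto
qed

lemma penalty'_nonneg: "penalty' x \<ge> 0"
  by (auto simp: penalty'_def bump_def)

lemma penalty'_eq_0: "x \<le> 0 \<Longrightarrow> penalty' x = 0"
  by (auto simp: penalty'_def bump_def)

lemma penalty_nonneg: "penalty x \<ge> 0"
  by (auto simp: penalty_def bump_def)

lemma penalty_eq_0_iff: "penalty x = 0 \<longleftrightarrow> x \<le> 0"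
  by (auto simp: penalty_def bump_def)

lemma penalty'_lipschitz: "\<bar>penalty' a - penalty' b\<bar> \<le> 6 * \<bar>a - b\<bar>"
  by (rule lipschitz_of_bounded_derivative[OF penalty'_has_derivative penalty''_bounds])

text \<open>The mean value theorem gives the slope \<open>penalty' c\<close> at a point
  \<open>c\<close> no farther from \<open>a\<close> than \<open>b\<close> is; the Lipschitz bound
  for \<open>penalty'\<close> then yields the quadratic remainder.\<close>

lemma penalty_expansion: "\<bar>penalty b - penalty a - penalty' a * (b - a)\<bar> \<le> 6 * (b - a)\<^sup>2"
proof (cases "a = b")
  case False
  have "\<exists>c. \<bar>c - a\<bar> \<le> \<bar>b - a\<bar> \<and> penalty b - penalty a = penalty' c * (b - a)"
  proof (cases "a < b")
    case True
    from MVT2[OF True, of penalty penalty'] penalty_has_derivative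
    obtain z where "a < z" "z < b" "penalty b - penalty a = (b - a) * penalty' z" by blast
    then show ?thesis by (intro exI[of _ z]) auto
  next
    case F: False
    then have "b < a" using False by simp
    from MVT2[OF this, of penalty penalty'] penalty_has_derivative
    obtain z where "b < z" "z < a" "penalty a - penalty b = (a - b) * penalty' z" by blast
    then show ?thesis by (intro exI[of _ z]) (auto simp: algebra_simps)
  qed
  then obtain c where c: "\<bar>c - a\<bar> \<le> \<bar>b - a\<bar>" "penalty b - penalty a = penalty' c * (b - a)" by blast
  have "\<bar>penalty b - penalty a - penalty' a * (b - a)\<bar> = \<bar>penalty' c - penalty' a\<bar> * \<bar>b - a\<bar>"
    unfolding c(2) abs_mult[symmetric] by (simp add: algebra_simps)
  also have "\<dots> \<le> (6 * \<bar>b - a\<bar>) * \<bar>b - a\<bar>"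
    using penalty'_lipschitz[of c a] c(1) by (intro mult_right_mono) auto
  finally show ?thesis by (simp add: power2_eq_square abs_mult[symmetric] mult.assoc)
qed simp

text \<open>For \<open>M \<ge> 0\<close> this vanishes iff \<open>f \<le> M\<close> almost everywhere; it is the Lyapunov functional behind
  the maximum principle.\<close>
definition excess :: "'a::euclidean_space set \<Rightarrow> real \<Rightarrow> ('a \<Rightarrow> real) \<Rightarrow> real" where
  "excess D M f = (LINT x|lebesgue_on D. penalty (f x - M))"

lemma penalty_measurable [measurable]: "penalty \<in> borel_measurable borel"
  and penalty'_measurable [measurable]: "penalty' \<in> borel_measurable borel"
  using borel_measurable_continuous_onI[OF smooth_continuous[OF smooth_penalty]]
    borel_measurable_continuous_onI[OF smooth_continuous[OF smooth_penalty']] by simp_all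

text \<open>\<open>M \<ge> 0\<close> puts \<open>- M\<close> into the zero set of
  \<open>penalty\<close> and \<open>penalty'\<close>, so at \<open>y - M\<close> they are bounded by
  \<open>6 * y\<^sup>2\<close> and \<open>6 * \<bar>y\<bar>\<close>. Hence everything is controlled
  by the L2 norm of \<open>f\<close>.\<close>

lemma
  assumes "f \<in> L2 D" "M \<ge> 0"
  shows penalty'_L2: "(\<lambda>x. penalty' (f x - M)) \<in> L2 D"
    and penalty'_l2norm: "l2norm D (\<lambda>x. penalty' (f x - M)) \<le> 6 * l2norm D f"
    and penalty_integrable: "integrable (lebesgue_on D) (\<lambda>x. penalty (f x - M))"
proof -
  have "\<bar>penalty' (y - M)\<bar> \<le> 6 * \<bar>y\<bar>" for y
    using penalty'_lipschitz[of "y - M" "- M"] assms(2) by (simp add: penalty'_eq_0)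
  then show "(\<lambda>x. penalty' (f x - M)) \<in> L2 D" "l2norm D (\<lambda>x. penalty' (f x - M)) \<le> 6 * l2norm D f"
    using L2_compose[OF assms(1), of "\<lambda>y. penalty' (y - M)" 6] by auto
  have [measurable]: "f \<in> borel_measurable (lebesgue_on D)" by (rule L2_measurable[OF assms(1)])
  show "integrable (lebesgue_on D) (\<lambda>x. penalty (f x - M))"
  proof (rule Bochner_Integration.integrable_bound)
    show "integrable (lebesgue_on D) (\<lambda>x. 6 * (f x)\<^sup>2)"
      using assms by (intro integrable_mult_right L2_integrable_square)
    show "AE x in lebesgue_on D. norm (penalty (f x - M)) \<le> norm (6 * (f x)\<^sup>2)"
    proof (rule AE_I2)
      fix x
      show "norm (penalty (f x - M)) \<le> norm (6 * (f x)\<^sup>2)"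
        using penalty_expansion[of "f x - M" "- M"] assms(2) penalty_eq_0_iff[of "- M"] penalty'_eq_0[of "- M"] by simp
    qed
  qed measurable
qed

text \<open>The pointwise expansion, integrated: \<open>excess D M\<close> is differentiable on L2
  with a quadratic remainder. This gives its continuity as well as its right derivative along a
  curve.\<close>

lemma excess_expansion:
  assumes f: "f \<in> L2 D" and g: "g \<in> L2 D" and M: "M \<ge> 0"
  shows "\<bar>excess D M g - excess D M f - (LINT x|lebesgue_on D. penalty' (f x - M) * (g x - f x))\<bar>
    \<le> 6 * (l2norm D (\<lambda>x. g x - f x))\<^sup>2"
proof -
  have d: "(\<lambda>x. g x - f x) \<in> L2 D" by (intro L2_diff f g)
  have i: "integrable (lebesgue_on D) (\<lambda>x. penalty' (f x - M) * (g x - f x))"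
    by (rule L2_integrable_mult[OF penalty'_L2[OF f M] d])
  have i': "integrable (lebesgue_on D) (\<lambda>x. penalty (g x - M) - penalty (f x - M) - penalty' (f x - M) * (g x - f x))"
    using penalty_integrable[OF f M] penalty_integrable[OF g M] i by simp
  have eq: "excess D M g - excess D M f - (LINT x|lebesgue_on D. penalty' (f x - M) * (g x - f x))
      = (LINT x|lebesgue_on D. penalty (g x - M) - penalty (f x - M) - penalty' (f x - M) * (g x - f x))"
    unfolding excess_def using penalty_integrable[OF f M] penalty_integrable[OF g M] i by simp
  have "\<bar>LINT x|lebesgue_on D. penalty (g x - M) - penalty (f x - M) - penalty' (f x - M) * (g x - f x)\<bar>
      \<le> (LINT x|lebesgue_on D. \<bar>penalty (g x - M) - penalty (f x - M) - penalty' (f x - M) * (g x - f x)\<bar>)"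
    by (rule integral_abs_bound)
  also have "\<dots> \<le> (LINT x|lebesgue_on D. 6 * (g x - f x)\<^sup>2)"
  proof (rule integral_mono)
    show "integrable (lebesgue_on D) (\<lambda>x. \<bar>penalty (g x - M) - penalty (f x - M) - penalty' (f x - M) * (g x - f x)\<bar>)"
      by (rule integrable_abs[OF i'])
    show "integrable (lebesgue_on D) (\<lambda>x. 6 * (g x - f x)\<^sup>2)"
      by (intro integrable_mult_right L2_integrable_square d)
    fix x show "\<bar>penalty (g x - M) - penalty (f x - M) - penalty' (f x - M) * (g x - f x)\<bar> \<le> 6 * (g x - f x)\<^sup>2"
      using penalty_expansion[of "g x - M" "f x - M"] by simp
  qed
  also have "\<dots> = 6 * (l2norm D (\<lambda>x. g x - f x))\<^sup>2"
    by (simp add: l2norm_power2)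
  finally show ?thesis unfolding eq .
qed

lemma excess_diff_le:
  assumes f: "f \<in> L2 D" and g: "g \<in> L2 D" and M: "M \<ge> 0"
  shows "\<bar>excess D M g - excess D M f\<bar>
    \<le> 6 * l2norm D f * l2norm D (\<lambda>x. g x - f x) + 6 * (l2norm D (\<lambda>x. g x - f x))\<^sup>2"
proof -
  have "\<bar>LINT x|lebesgue_on D. penalty' (f x - M) * (g x - f x)\<bar>
      \<le> l2norm D (\<lambda>x. penalty' (f x - M)) * l2norm D (\<lambda>x. g x - f x)"
    by (intro L2_Cauchy_Schwarz penalty'_L2 L2_diff f g M)
  also have "\<dots> \<le> 6 * l2norm D f * l2norm D (\<lambda>x. g x - f x)"
    by (intro mult_right_mono penalty'_l2norm f M l2norm_nonneg)
  finally show ?thesis using excess_expansion[OF f g M] by linarith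
qed

lemma excess_tendsto:
  assumes f: "f \<in> L2 D" and g: "\<forall>\<^sub>F k in F. g k \<in> L2 D" and M: "M \<ge> 0"
    and lim: "((\<lambda>k. l2norm D (\<lambda>x. g k x - f x)) \<longlongrightarrow> 0) F"
  shows "((\<lambda>k. excess D M (g k)) \<longlongrightarrow> excess D M f) F"
proof -
  define e where "e = (\<lambda>k. l2norm D (\<lambda>x. g k x - f x))"
  define b where "b = (\<lambda>k. 6 * l2norm D f * e k + 6 * (e k)\<^sup>2)"
  have "(b \<longlongrightarrow> 6 * l2norm D f * 0 + 6 * 0\<^sup>2) F"
    unfolding e_def b_def by (intro tendsto_intros lim)
  then have b: "(b \<longlongrightarrow> 0) F" by simp
  have le: "\<forall>\<^sub>F k in F. norm (excess D M (g k) - excess D M f) \<le> b k"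
    using g
  proof eventually_elim
    case (elim k)
    then show ?case using excess_diff_le[OF f elim M] by (simp add: e_def b_def)
  qed
  have "((\<lambda>k. excess D M (g k) - excess D M f) \<longlongrightarrow> 0) F"
    by (rule Lim_null_comparison[OF le b])
  then show ?thesis by (simp only: LIM_zero_iff)
qed

lemma excess_nonneg: "excess D M f \<ge> 0"
  by (simp add: excess_def penalty_nonneg)

lemma excess_le_0_iff:
  assumes "f \<in> L2 D" "M \<ge> 0"
  shows "excess D M f \<le> 0 \<longleftrightarrow> (AE x in lebesgue_on D. f x \<le> M)"
proof -
  have "excess D M f = 0 \<longleftrightarrow> (AE x in lebesgue_on D. penalty (f x - M) = 0)"
    unfolding excess_def
    by (rule integral_nonneg_eq_0_iff_AE[OF penalty_integrable[OF assms]]) (simp add: penalty_nonneg)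
  then show ?thesis
    using excess_nonneg[of D M f] by (simp add: penalty_eq_0_iff)
qed

text \<open>Continuous induction. Let \<open>c\<close> be the supremum of the times up to which
  \<open>P\<close> holds throughout: \<open>lim\<close> yields \<open>P c\<close>, and
  \<open>step\<close> would lead beyond \<open>c\<close> if \<open>c < \<tau>\<close>. The
  admissible step length may depend on \<open>t\<close>, which is all that one-sided estimates
  provide.\<close>

lemma real_step_induct:
  fixes P :: "real \<Rightarrow> bool"
  assumes "0 \<le> \<tau>" "P 0"
    and step: "\<And>t. 0 \<le> t \<Longrightarrow> t < \<tau> \<Longrightarrow> P t \<Longrightarrow> \<forall>\<^sub>F h in at_right 0. t + h \<le> \<tau> \<longrightarrow> P (t + h)"
    and lim: "\<And>t. 0 < t \<Longrightarrow> t \<le> \<tau> \<Longrightarrow> (\<And>s. 0 \<le> s \<Longrightarrow> s < t \<Longrightarrow> P s) \<Longrightarrow> P t"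
  shows "P \<tau>"
proof -
  define A where "A = {t \<in> {0..\<tau>}. \<forall>s\<in>{0..t}. P s}"
  define c where "c = Sup A"
  have "0 \<in> A" using assms(1,2) by (auto simp: A_def)
  have bdd: "bdd_above A" by (auto simp: A_def intro: bdd_aboveI[of _ \<tau>])
  have c: "0 \<le> c" "c \<le> \<tau>"
    using \<open>0 \<in> A\<close> bdd by (auto simp: c_def intro: cSup_upper) (rule cSup_least, auto simp: A_def)
  have less: "P s" if "0 \<le> s" "s < c" for s
    using less_cSupD[of A s] that \<open>0 \<in> A\<close> unfolding c_def by (force simp: A_def)
  have Pc: "P c"
    using lim[of c] less c assms(2) by (cases "c = 0") auto
  have "c = \<tau>"
  proof (rule ccontr)
    assume "c \<noteq> \<tau>"
    then have "c < \<tau>" using c by simp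
    from step[OF c(1) this Pc] obtain d where d: "d > 0" "\<And>h. 0 < h \<Longrightarrow> h < d \<Longrightarrow> c + h \<le> \<tau> \<Longrightarrow> P (c + h)"
      by (auto simp: eventually_at_right_field)
    define h where "h = min (d / 2) (\<tau> - c)"
    have h: "0 < h" "h < d" "c + h \<le> \<tau>" using d(1) \<open>c < \<tau>\<close> by (auto simp: h_def)
    have "P s" if "s \<in> {0..c + h}" for s
      using less[of s] Pc d(2)[of "s - c"] that h by (cases s c rule: linorder_cases) auto
    then have "c + h \<in> A" using h c by (auto simp: A_def)
    then have "c + h \<le> c" unfolding c_def using bdd by (rule cSup_upper)
    with h show False by simp
  qed
  with Pc show ?thesis by simp
qed

text \<open>Stone-Weierstrass; two distinct points \<open>x\<close>, \<open>y\<close> are separated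
  by the linear function with gradient \<open>x - y\<close>.\<close>

lemma smooth_dense:
  fixes f :: "'a::euclidean_space \<Rightarrow> real"
  assumes "compact K" "continuous_on K f" "e > 0"
  shows "\<exists>g. smooth g \<and> (\<forall>x\<in>K. \<bar>f x - g x\<bar> < e)"
proof (rule Stone_Weierstrass_HOL[OF assms(1) _ _ _ _ _ assms(2,3)])
  fix x y :: 'a
  assume "x \<in> K \<and> y \<in> K \<and> x \<noteq> y"
  then have "(x - y) \<bullet> (x - y) \<noteq> 0" by simp
  then have "x \<bullet> (x - y) \<noteq> y \<bullet> (x - y)" by (simp add: inner_diff_left)
  then show "\<exists>g. smooth g \<and> g x \<noteq> g y"
    using smooth_inner[of "x - y"] by blast
qed (auto intro: smooth_continuous smooth_add smooth_mult)

section \<open>The maximum principle for the heat semigroup\<close>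

lemma l2norm_tendsto_zero:
  assumes "(e \<longlongrightarrow> 0) F" "\<forall>\<^sub>F h in F. l2norm D (u h) \<le> e h"
  shows "((\<lambda>h. l2norm D (u h)) \<longlongrightarrow> 0) F"
proof (rule Lim_null_comparison[OF _ assms(1)])
  show "\<forall>\<^sub>F h in F. norm (l2norm D (u h)) \<le> e h"
    using assms(2) by (simp add: l2norm_nonneg)
qed

locale heat =
  fixes D :: "'a::euclidean_space set" and \<kappa> :: real
    and S :: "real \<Rightarrow> ('a \<Rightarrow> real) \<Rightarrow> 'a \<Rightarrow> real"
  assumes bounded_dom: "bounded D" and open_dom: "open D" and kappa_pos: "\<kappa> > 0"
    and semigroup: "dirichlet_heat_semigroup D \<kappa> S"
begin

lemma dom_lmeasurable: "D \<in> lmeasurable"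
  by (rule lmeasurable_open[OF bounded_dom open_dom])

lemma dom_sets: "D \<in> sets lebesgue"
  using dom_lmeasurable by (rule fmeasurableD)

section \<open>Continuous functions on the compact closure\<close>

lemma compact_closure_dom: "compact (closure D)"
  using bounded_dom by (simp add: compact_closure)

lemma continuous_bounded:
  fixes f :: "'a \<Rightarrow> real"
  assumes "continuous_on (closure D) f"
  obtains B where "B > 0" "\<And>x. x \<in> closure D \<Longrightarrow> \<bar>f x\<bar> \<le> B"
proof -
  have "bounded (f ` closure D)"
    by (intro compact_imp_bounded compact_continuous_image assms compact_closure_dom)
  then show ?thesis using that by (auto simp: bounded_pos)
qed

lemma le_supnorm:
  assumes "continuous_on (closure D) f" "x \<in> closure D"
  shows "\<bar>f x\<bar> \<le> supnorm D f"
proof -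
  obtain B where "\<And>x. x \<in> closure D \<Longrightarrow> \<bar>f x\<bar> \<le> B"
    using continuous_bounded[OF assms(1)] by metis
  then show ?thesis
    unfolding supnorm_def using assms(2) by (intro cSUP_upper bdd_aboveI2[of _ _ B]) auto
qed

lemma continuous_measurable:
  assumes "continuous_on (closure D) f"
  shows "f \<in> borel_measurable (lebesgue_on D)"
  by (rule continuous_imp_measurable_on_sets_lebesgue[OF continuous_on_subset[OF assms closure_subset] dom_sets])

lemma continuous_L2:
  assumes "continuous_on (closure D) f"
  shows "f \<in> L2 D"
proof -
  obtain B where "\<And>x. x \<in> closure D \<Longrightarrow> \<bar>f x\<bar> \<le> B"
    using continuous_bounded[OF assms] by metis
  then show ?thesis
    using closure_subset by (intro L2_bounded(1)[OF continuous_measurable[OF assms] dom_lmeasurable, of B]) blast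
qed

text \<open>The part of \<open>D\<close> where the inequality fails is open, and an open null set is
  empty; continuity then extends the inequality to the closure.\<close>

lemma AE_le_imp_le:
  assumes f: "continuous_on (closure D) f" and g: "continuous_on (closure D) g"
    and ae: "AE x in lebesgue_on D. f x \<le> (g x :: real)" and x: "x \<in> closure D"
  shows "f x \<le> g x"
proof -
  define d where "d = (\<lambda>x. f x - g x)"
  have d: "continuous_on (closure D) d"
    unfolding d_def by (intro continuous_intros f g)
  define N where "N = D \<inter> d -` {0<..}"
  have "open N"
    unfolding N_def by (rule continuous_open_preimage[OF continuous_on_subset[OF d closure_subset] open_dom]) simp
  have "AE x in lebesgue. x \<in> D \<longrightarrow> f x \<le> g x"
    using ae dom_sets by (subst (asm) AE_restrict_space_iff) auto
  then have "AE x in lebesgue. x \<notin> N"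
    by eventually_elim (auto simp: N_def d_def)
  then have "N \<in> null_sets lebesgue"
    using \<open>open N\<close> AE_iff_null_sets[of N lebesgue] by auto
  then have "N = {}"
    using open_not_negligible[OF \<open>open N\<close>] by (auto simp: negligible_iff_null_sets)
  then have "d y \<le> 0" if "y \<in> D" for y
    using that by (force simp: N_def)
  then have "d x \<le> 0"
    by (rule continuous_le_on_closure[OF d x])
  then show ?thesis by (simp add: d_def)
qed

lemma AE_eq_imp_eq:
  assumes "continuous_on (closure D) f" "continuous_on (closure D) g"
    "AE x in lebesgue_on D. f x = (g x :: real)" "x \<in> closure D"
  shows "f x = g x"
proof -
  have "AE x in lebesgue_on D. f x \<le> g x" "AE x in lebesgue_on D. g x \<le> f x"
    using assms(3) by (eventually_elim, simp)+
  then show ?thesis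
    using AE_le_imp_le[OF assms(1,2) _ assms(4)] AE_le_imp_le[OF assms(2,1) _ assms(4)] by (meson antisym)
qed

lemma C0_continuous: "f \<in> C0 D \<Longrightarrow> continuous_on (closure D) f"
  by (simp add: C0_def)

section \<open>Pointwise calculus of the semigroup\<close>

lemmas semigroup_facts = semigroup[unfolded dirichlet_heat_semigroup_def L2_C0_semigroup_def]

lemma S_L2: "t \<ge> 0 \<Longrightarrow> f \<in> L2 D \<Longrightarrow> S t f \<in> L2 D"
  by (rule semigroup_facts[THEN conjunct1, THEN conjunct1, rule_format])

lemma S_cong_AE: "t \<ge> 0 \<Longrightarrow> f \<in> L2 D \<Longrightarrow> g \<in> L2 D \<Longrightarrow> AE x in lebesgue_on D. f x = g x \<Longrightarrow>
    AE x in lebesgue_on D. S t f x = S t g x"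
  by (rule semigroup_facts[THEN conjunct1, THEN conjunct2, THEN conjunct1, rule_format])

lemma S_linear_AE: "t \<ge> 0 \<Longrightarrow> f \<in> L2 D \<Longrightarrow> g \<in> L2 D \<Longrightarrow>
    AE x in lebesgue_on D. S t (\<lambda>y. a * f y + b * g y) x = a * S t f x + b * S t g x"
  by (rule semigroup_facts[THEN conjunct1, THEN conjunct2, THEN conjunct2, THEN conjunct1, rule_format])

lemma S_bounded: "t \<ge> 0 \<Longrightarrow> \<exists>K. \<forall>f\<in>L2 D. l2norm D (S t f) \<le> K * l2norm D f"
  by (rule semigroup_facts[THEN conjunct1, THEN conjunct2, THEN conjunct2, THEN conjunct2, THEN conjunct1, rule_format])

lemma S_zero_AE: "f \<in> L2 D \<Longrightarrow> AE x in lebesgue_on D. S 0 f x = f x"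
  by (rule semigroup_facts[THEN conjunct1, THEN conjunct2, THEN conjunct2, THEN conjunct2, THEN conjunct2,
        THEN conjunct1, rule_format])

lemma S_add_AE: "s \<ge> 0 \<Longrightarrow> t \<ge> 0 \<Longrightarrow> f \<in> L2 D \<Longrightarrow>
    AE x in lebesgue_on D. S (s + t) f x = S s (S t f) x"
  by (rule semigroup_facts[THEN conjunct1, THEN conjunct2, THEN conjunct2, THEN conjunct2, THEN conjunct2,
        THEN conjunct2, THEN conjunct1, rule_format])

lemma generator_iff: "L2_generator D S u w \<longleftrightarrow>
    w \<in> L2 D \<and> (\<exists>v. dirichlet_laplacian D u v \<and> (AE x in lebesgue_on D. w x = \<kappa> * v x))"
  by (rule semigroup_facts[THEN conjunct2, THEN conjunct1, THEN spec, THEN spec])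

lemma S_C0: "t \<ge> 0 \<Longrightarrow> f \<in> C0 D \<Longrightarrow> S t f \<in> C0 D"
  and S_supnorm: "t \<ge> 0 \<Longrightarrow> f \<in> C0 D \<Longrightarrow> supnorm D (S t f) \<le> supnorm D f"
  using semigroup_facts[THEN conjunct2, THEN conjunct2, THEN conjunct1] by auto

lemma S_uniform_limit: "f \<in> C0 D \<Longrightarrow> uniform_limit (closure D) (\<lambda>t. S t f) f (at_right 0)"
  by (rule semigroup_facts[THEN conjunct2, THEN conjunct2, THEN conjunct2, THEN conjunct1, rule_format])

lemma S_smoothing: "t > 0 \<Longrightarrow> f \<in> bounded_measurable D \<Longrightarrow> S t f \<in> C0 D"
  by (rule semigroup_facts[THEN conjunct2, THEN conjunct2, THEN conjunct2, THEN conjunct2, rule_format])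

text \<open>The pairs \<open>(t, f)\<close> with continuous \<open>f\<close> for which \<open>S t f\<close> is the continuous representative, so
  that almost everywhere identities hold at every point.\<close>
definition admissible :: "real \<Rightarrow> ('a \<Rightarrow> real) \<Rightarrow> bool" where
  "admissible t f \<longleftrightarrow> 0 \<le> t \<and> continuous_on (closure D) f \<and> (t = 0 \<longrightarrow> f \<in> C0 D)"

lemma admissible_nonneg: "admissible t f \<Longrightarrow> 0 \<le> t"
  by (simp add: admissible_def)

lemma admissible_C0: "f \<in> C0 D \<Longrightarrow> 0 \<le> t \<Longrightarrow> admissible t f"
  by (simp add: admissible_def C0_continuous)

lemma admissible_pos: "continuous_on (closure D) f \<Longrightarrow> 0 < t \<Longrightarrow> admissible t f"
  by (simp add: admissible_def)

lemma C0_linear: "f \<in> C0 D \<Longrightarrow> g \<in> C0 D \<Longrightarrow> (\<lambda>y. a * f y + b * g y) \<in> C0 D"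
  by (auto simp: C0_def intro!: continuous_intros)

lemma C0_diff: "f \<in> C0 D \<Longrightarrow> g \<in> C0 D \<Longrightarrow> (\<lambda>y. f y - g y) \<in> C0 D"
  by (auto simp: C0_def intro!: continuous_intros)

lemma admissible_linear:
  "admissible t f \<Longrightarrow> admissible t g \<Longrightarrow> admissible t (\<lambda>y. a * f y + b * g y)"
  unfolding admissible_def by (auto intro!: continuous_intros C0_linear)

lemma S_admissible:
  assumes "admissible t f"
  shows "S t f \<in> C0 D"
proof (cases "t = 0")
  case True
  then show ?thesis using assms by (simp add: admissible_def S_C0)
next
  case False
  then have t: "t > 0" and f: "continuous_on (closure D) f"
    using assms by (auto simp: admissible_def)
  obtain B where "\<And>x. x \<in> closure D \<Longrightarrow> \<bar>f x\<bar> \<le> B"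
    using continuous_bounded[OF f] by metis
  then have "bounded (f ` D)"
    using closure_subset by (auto simp: bounded_iff intro!: exI[of _ B])
  then show ?thesis
    by (intro S_smoothing t) (simp add: bounded_measurable_def continuous_measurable[OF f])
qed

lemma S_continuous: "admissible t f \<Longrightarrow> continuous_on (closure D) (S t f)"
  by (intro C0_continuous S_admissible)

lemma admissible_L2: "admissible t f \<Longrightarrow> f \<in> L2 D"
  by (simp add: admissible_def continuous_L2)

lemma S_linear:
  assumes "admissible t f" "admissible t g" "x \<in> closure D"
  shows "S t (\<lambda>y. a * f y + b * g y) x = a * S t f x + b * S t g x"
proof (rule AE_eq_imp_eq[OF _ _ _ assms(3)])
  show "continuous_on (closure D) (S t (\<lambda>y. a * f y + b * g y))"
    by (intro S_continuous admissible_linear assms)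
  show "continuous_on (closure D) (\<lambda>x. a * S t f x + b * S t g x)"
    by (intro continuous_intros S_continuous assms)
  show "AE x in lebesgue_on D. S t (\<lambda>y. a * f y + b * g y) x = a * S t f x + b * S t g x"
    using assms by (intro S_linear_AE) (auto intro: admissible_L2 admissible_nonneg)
qed

lemma S_diff:
  assumes "admissible t f" "admissible t g" "x \<in> closure D"
  shows "S t (\<lambda>y. f y - g y) x = S t f x - S t g x"
  using S_linear[OF assms, of 1 "-1"] by simp

lemma S_cmult:
  assumes "admissible t f" "x \<in> closure D"
  shows "S t (\<lambda>y. a * f y) x = a * S t f x"
  using S_linear[OF assms(1,1,2), of a 0] by simp

lemma S_cong:
  assumes "admissible t f" "admissible t g" "\<And>y. y \<in> D \<Longrightarrow> f y = g y" "x \<in> closure D"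
  shows "S t f x = S t g x"
proof (rule AE_eq_imp_eq[OF S_continuous[OF assms(1)] S_continuous[OF assms(2)] _ assms(4)])
  show "AE x in lebesgue_on D. S t f x = S t g x"
    using assms by (intro S_cong_AE AE_I2) (auto intro: admissible_L2 admissible_nonneg)
qed

lemma S_add:
  assumes "0 \<le> s" "admissible t f" "x \<in> closure D"
  shows "S (s + t) f x = S s (S t f) x"
proof (rule AE_eq_imp_eq[OF _ _ _ assms(3)])
  have "0 \<le> t" using assms(2) by (simp add: admissible_def)
  then have "admissible (s + t) f" using assms(1,2) by (auto simp: admissible_def)
  then show "continuous_on (closure D) (S (s + t) f)" by (rule S_continuous)
  show "continuous_on (closure D) (S s (S t f))"
    using assms by (intro C0_continuous S_C0 S_admissible)
  show "AE x in lebesgue_on D. S (s + t) f x = S s (S t f) x"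
    using assms \<open>0 \<le> t\<close> by (intro S_add_AE) (auto simp: admissible_L2)
qed

lemma S_zero:
  assumes "f \<in> C0 D" "x \<in> closure D"
  shows "S 0 f x = f x"
  by (rule AE_eq_imp_eq[OF C0_continuous[OF S_C0] C0_continuous S_zero_AE])
    (use assms in \<open>auto intro: continuous_L2 C0_continuous\<close>)

lemma S_contraction:
  assumes "0 \<le> t" "f \<in> C0 D" "\<And>y. y \<in> closure D \<Longrightarrow> \<bar>f y\<bar> \<le> B" "x \<in> closure D"
  shows "\<bar>S t f x\<bar> \<le> B"
proof -
  have "\<bar>S t f x\<bar> \<le> supnorm D (S t f)"
    by (intro le_supnorm C0_continuous S_C0 assms)
  also have "\<dots> \<le> supnorm D f" by (intro S_supnorm assms)
  also have "\<dots> \<le> B"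
    unfolding supnorm_def by (rule cSUP_least) (use assms in auto)
  finally show ?thesis .
qed

text \<open>For \<open>s < r\<close>, \<open>S r f - S s f\<close> equals \<open>S s\<close> applied
  to \<open>S (r - s) f - f\<close>. Contraction therefore carries the modulus of continuity at time
  0 to all times, uniformly.\<close>

lemma S_uniformly_continuous:
  assumes f: "f \<in> C0 D" and "e > 0"
  obtains d where "d > 0"
    "\<And>r s x. 0 \<le> r \<Longrightarrow> 0 \<le> s \<Longrightarrow> \<bar>r - s\<bar> < d \<Longrightarrow> x \<in> closure D \<Longrightarrow> \<bar>S r f x - S s f x\<bar> \<le> e"
proof -
  from S_uniform_limit[OF f] \<open>e > 0\<close>
  have "\<forall>\<^sub>F t in at_right 0. \<forall>x\<in>closure D. dist (S t f x) (f x) < e"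
    by (rule uniform_limitD)
  then obtain d where d: "d > 0"
    "\<And>t x. 0 < t \<Longrightarrow> t < d \<Longrightarrow> x \<in> closure D \<Longrightarrow> \<bar>S t f x - f x\<bar> < e"
    by (auto simp: eventually_at_right_field dist_real_def)
  have less: "\<bar>S r f x - S s f x\<bar> \<le> e" if rs: "0 \<le> s" "s < r" "r - s < d" and x: "x \<in> closure D" for r s x
  proof -
    define h where "h = r - s"
    have h: "0 < h" "h < d" "r = s + h" using rs by (auto simp: h_def)
    have Sh: "S h f \<in> C0 D" using h f by (simp add: S_C0)
    have "S r f x - S s f x = S s (S h f) x - S s f x"
      unfolding h(3) using S_add[OF rs(1) admissible_C0[OF f] x, of h] h by simp
    also have "\<dots> = S s (\<lambda>y. S h f y - f y) x"
      using S_diff[OF admissible_C0[OF Sh rs(1)] admissible_C0[OF f rs(1)] x] by simp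
    finally have "S r f x - S s f x = S s (\<lambda>y. S h f y - f y) x" .
    moreover have "\<bar>S s (\<lambda>y. S h f y - f y) x\<bar> \<le> e"
      by (rule S_contraction[OF rs(1) C0_diff[OF Sh f] _ x]) (use d(2)[OF h(1,2)] in \<open>auto intro: less_imp_le\<close>)
    ultimately show ?thesis by simp
  qed
  show ?thesis
  proof (rule that[OF d(1)])
    fix r s x assume *: "0 \<le> r" "0 \<le> s" "\<bar>r - s\<bar> < d" "x \<in> closure D"
    show "\<bar>S r f x - S s f x\<bar> \<le> e"
    proof (cases r s rule: linorder_cases)
      case equal
      then show ?thesis using \<open>e > 0\<close> by simp
    qed (use less[of s r x] less[of r s x] * in auto)
  qed
qed

lemma uniform_l2norm_tendsto:
  assumes "\<And>e. e > 0 \<Longrightarrow> \<forall>\<^sub>F t in F. \<forall>x\<in>D. \<bar>u t x\<bar> \<le> e" "\<And>t. u t \<in> borel_measurable (lebesgue_on D)"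
  shows "((\<lambda>t. l2norm D (u t)) \<longlongrightarrow> 0) F"
proof (rule tendstoI)
  fix e :: real assume "e > 0"
  define m where "m = sqrt (measure lebesgue D)"
  have m: "m \<ge> 0" by (simp add: m_def)
  have "\<forall>\<^sub>F t in F. \<forall>x\<in>D. \<bar>u t x\<bar> \<le> e / (m + 1)"
    by (rule assms(1)) (use \<open>e > 0\<close> m in simp)
  then show "\<forall>\<^sub>F t in F. dist (l2norm D (u t)) 0 < e"
  proof eventually_elim
    case (elim t)
    have "l2norm D (u t) \<le> \<bar>e / (m + 1)\<bar> * m"
      unfolding m_def by (rule L2_bounded(2)[OF assms(2) dom_lmeasurable]) (use elim in \<open>auto simp: m_def\<close>)
    also have "\<dots> < e" using \<open>e > 0\<close> m by (simp add: field_simps)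
    finally show ?case using l2norm_nonneg[of D "u t"] by simp
  qed
qed

lemma S_L2_continuous:
  assumes f: "f \<in> C0 D" and "0 \<le> t"
  shows "((\<lambda>r. l2norm D (\<lambda>x. S r f x - S t f x)) \<longlongrightarrow> 0) (at t within {0..})"
proof -
  \<comment> \<open>\<open>max 0 r\<close> keeps the function measurable for every real
    \<open>r\<close>, including times at which the semigroup is unspecified; within
    \<open>{0..}\<close> it changes nothing.\<close>
  have "((\<lambda>r. l2norm D (\<lambda>x. S (max 0 r) f x - S t f x)) \<longlongrightarrow> 0) (at t within {0..})"
  proof (rule uniform_l2norm_tendsto)
    fix e :: real assume "e > 0"
    with f obtain d where d: "d > 0"
      "\<And>r s x. 0 \<le> r \<Longrightarrow> 0 \<le> s \<Longrightarrow> \<bar>r - s\<bar> < d \<Longrightarrow> x \<in> closure D \<Longrightarrow> \<bar>S r f x - S s f x\<bar> \<le> e"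
      by (rule S_uniformly_continuous) blast
    show "\<forall>\<^sub>F r in at t within {0..}. \<forall>x\<in>D. \<bar>S (max 0 r) f x - S t f x\<bar> \<le> e"
      unfolding eventually_at
      by (rule exI[of _ d]) (use d \<open>0 \<le> t\<close> closure_subset[of D] in \<open>auto simp: dist_real_def max_def\<close>)
  next
    show "(\<lambda>x. S (max 0 r) f x - S t f x) \<in> borel_measurable (lebesgue_on D)" for r
      using assms by (intro borel_measurable_diff continuous_measurable C0_continuous S_C0) auto
  qed
  moreover have "\<forall>\<^sub>F r in at t within {0..}.
      l2norm D (\<lambda>x. S (max 0 r) f x - S t f x) = l2norm D (\<lambda>x. S r f x - S t f x)"
    unfolding eventually_at_filter by (rule always_eventually) (simp add: max_def)
  ultimately show ?thesis
    by (rule Lim_transform_eventually)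
qed

lemma test_function_C0:
  assumes "test_function D \<phi>"
  shows "\<phi> \<in> C0 D"
proof -
  have "frontier D \<inter> D = {}" using open_dom by (auto simp: frontier_def interior_open)
  then show ?thesis
    using test_function_eq_0[OF assms] smooth_continuous[OF test_function_smooth[OF assms]]
    by (auto simp: C0_def)
qed

section \<open>The generator along the semigroup\<close>

lemma generator_test_function:
  assumes "test_function D \<phi>"
  shows "L2_generator D S \<phi> (\<lambda>x. \<kappa> * laplacian \<phi> x)"
  unfolding generator_iff
  using dirichlet_laplacian_test_function[OF assms dom_sets]
    L2_cmult[OF test_function_L2[OF test_function_laplacian[OF assms] dom_sets]] by blast

text \<open>\<open>S t\<close> commutes with the difference quotients of the semigroup, and since
  \<open>t\<close> is fixed, an L2 bound \<open>K\<close> depending on \<open>t\<close> is enough to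
  pass to the limit.\<close>

lemma generator_S:
  assumes gen: "L2_generator D S u w" and t: "0 \<le> t"
  shows "L2_generator D S (S t u) (S t w)"
proof -
  have u: "u \<in> L2 D" and w: "w \<in> L2 D"
    and lim: "((\<lambda>h. l2norm D (\<lambda>x. (S h u x - u x) / h - w x)) \<longlongrightarrow> 0) (at_right 0)"
    using gen by (auto simp: L2_generator_def)
  obtain K where K: "\<And>f. f \<in> L2 D \<Longrightarrow> l2norm D (S t f) \<le> K * l2norm D f"
    using S_bounded[OF t] by blast
  have le: "l2norm D (\<lambda>x. (S h (S t u) x - S t u x) / h - S t w x)
      \<le> K * l2norm D (\<lambda>x. (S h u x - u x) / h - w x)" if h: "h > 0" for h
  proof -
    define q where "q = (\<lambda>x. 1 / h * S h u x + (- 1 / h) * u x)"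
    have q: "q \<in> L2 D" unfolding q_def using h by (intro L2_sum_cmult S_L2 u) auto
    have r: "(\<lambda>x. 1 * q x + (-1) * w x) \<in> L2 D" by (intro L2_sum_cmult q w)
    have "AE x in lebesgue_on D. S t q x = 1 / h * S t (S h u) x + (- 1 / h) * S t u x"
      unfolding q_def using h by (intro S_linear_AE t u S_L2) auto
    moreover have "AE x in lebesgue_on D. S t (\<lambda>x. 1 * q x + (-1) * w x) x = 1 * S t q x + (-1) * S t w x"
      by (intro S_linear_AE t q w)
    moreover have "AE x in lebesgue_on D. S (h + t) u x = S h (S t u) x"
      using h by (intro S_add_AE u t) auto
    moreover have "AE x in lebesgue_on D. S (t + h) u x = S t (S h u) x"
      using h by (intro S_add_AE u t) auto
    ultimately have "AE x in lebesgue_on D.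
        (S h (S t u) x - S t u x) / h - S t w x = S t (\<lambda>x. 1 * q x + (-1) * w x) x"
      by eventually_elim (simp add: add.commute diff_divide_distrib)
    then have "l2norm D (\<lambda>x. (S h (S t u) x - S t u x) / h - S t w x)
        = l2norm D (S t (\<lambda>x. 1 * q x + (-1) * w x))"
      by (rule l2norm_cong_AE) (use h in \<open>auto intro!: L2_diff L2_divide S_L2 u t w r[simplified]\<close>)
    also have "\<dots> \<le> K * l2norm D (\<lambda>x. 1 * q x + (-1) * w x)" by (rule K[OF r])
    also have "(\<lambda>x. 1 * q x + (-1) * w x) = (\<lambda>x. (S h u x - u x) / h - w x)"
      by (auto simp: q_def diff_divide_distrib)
    finally show ?thesis .
  qed
  have "((\<lambda>h. l2norm D (\<lambda>x. (S h (S t u) x - S t u x) / h - S t w x)) \<longlongrightarrow> 0) (at_right 0)"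
    by (rule l2norm_tendsto_zero[OF tendsto_mult_right_zero[OF lim, of K]])
      (rule eventually_mono[OF eventually_at_right_less le])
  then show ?thesis
    by (simp add: L2_generator_def S_L2 u w t)
qed

lemma generator_diff:
  assumes "L2_generator D S u w" "L2_generator D S v y"
  shows "L2_generator D S (\<lambda>x. u x - v x) (\<lambda>x. w x - y x)"
proof -
  have L2: "u \<in> L2 D" "w \<in> L2 D" "v \<in> L2 D" "y \<in> L2 D"
    and lim: "((\<lambda>h. l2norm D (\<lambda>x. (S h u x - u x) / h - w x)) \<longlongrightarrow> 0) (at_right 0)"
      "((\<lambda>h. l2norm D (\<lambda>x. (S h v x - v x) / h - y x)) \<longlongrightarrow> 0) (at_right 0)"
    using assms by (auto simp: L2_generator_def)
  have le: "l2norm D (\<lambda>x. (S h (\<lambda>x. u x - v x) x - (u x - v x)) / h - (w x - y x))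
     \<le> l2norm D (\<lambda>x. (S h u x - u x) / h - w x) + l2norm D (\<lambda>x. (S h v x - v x) / h - y x)" if h: "h > 0" for h
  proof -
    have "AE x in lebesgue_on D. S h (\<lambda>x. 1 * u x + (-1) * v x) x = 1 * S h u x + (-1) * S h v x"
      using h by (intro S_linear_AE L2) auto
    then have "AE x in lebesgue_on D. (S h (\<lambda>x. u x - v x) x - (u x - v x)) / h - (w x - y x)
        = ((S h u x - u x) / h - w x) - ((S h v x - v x) / h - y x)"
      by eventually_elim (simp add: diff_divide_distrib)
    then have "l2norm D (\<lambda>x. (S h (\<lambda>x. u x - v x) x - (u x - v x)) / h - (w x - y x))
        = l2norm D (\<lambda>x. ((S h u x - u x) / h - w x) - ((S h v x - v x) / h - y x))"
      by (rule l2norm_cong_AE) (use h in \<open>auto intro!: L2_diff L2_divide S_L2 L2\<close>)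
    also have "\<dots> \<le> l2norm D (\<lambda>x. (S h u x - u x) / h - w x) + l2norm D (\<lambda>x. (S h v x - v x) / h - y x)"
      by (rule l2norm_triangle_diff) (use h in \<open>auto intro!: L2_diff L2_divide S_L2 L2\<close>)
    finally show ?thesis .
  qed
  have "((\<lambda>h. l2norm D (\<lambda>x. (S h (\<lambda>x. u x - v x) x - (u x - v x)) / h - (w x - y x))) \<longlongrightarrow> 0) (at_right 0)"
    by (rule l2norm_tendsto_zero[OF tendsto_add_zero[OF lim]])
      (rule eventually_mono[OF eventually_at_right_less le])
  then show ?thesis
    by (simp add: L2_generator_def L2 L2_diff)
qed

text \<open>The dissipativity estimate with \<open>\<theta> y = penalty' (y - M)\<close>. The
  condition \<open>\<theta> 0 = 0\<close>, which reflects the Dirichlet boundary values, holds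
  because \<open>M \<ge> 0\<close>.\<close>

lemma generator_dissipative:
  assumes gen: "L2_generator D S u w" and M: "M \<ge> 0"
  shows "(LINT x|lebesgue_on D. penalty' (u x - M) * w x) \<le> 0"
proof -
  obtain v where v: "dirichlet_laplacian D u v" and ae: "AE x in lebesgue_on D. w x = \<kappa> * v x"
    using gen unfolding generator_iff by blast
  have L2: "u \<in> L2 D" "w \<in> L2 D" "v \<in> L2 D"
    using gen v by (auto simp: L2_generator_def dirichlet_laplacian_def)
  have s: "smooth (\<lambda>y. penalty' (y - M))"
    by (rule smooth_compose[OF smooth_diff[OF smooth_ident smooth_const] smooth_penalty'])
  have d: "((\<lambda>y. penalty' (y - M)) has_real_derivative penalty'' (y - M)) (at y)" for y
    using DERIV_shift[of penalty' "penalty'' (y - M)" y "- M"] penalty'_has_derivative[of "y - M"] by simp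
  have le: "(LINT x|lebesgue_on D. v x * penalty' (u x - M)) \<le> 0"
    by (rule dirichlet_laplacian_dissipative[OF v dom_sets s d penalty''_bounds]) (use M in \<open>simp add: penalty'_eq_0\<close>)
  have "(LINT x|lebesgue_on D. penalty' (u x - M) * w x) = (LINT x|lebesgue_on D. \<kappa> * (v x * penalty' (u x - M)))"
  proof (rule integral_cong_AE)
    show "(\<lambda>x. penalty' (u x - M) * w x) \<in> borel_measurable (lebesgue_on D)"
      "(\<lambda>x. \<kappa> * (v x * penalty' (u x - M))) \<in> borel_measurable (lebesgue_on D)"
      using L2 M by (auto intro!: borel_measurable_times intro: L2_measurable penalty'_L2)
    show "AE x in lebesgue_on D. penalty' (u x - M) * w x = \<kappa> * (v x * penalty' (u x - M))"
      using ae by eventually_elim simp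
  qed
  also have "\<dots> = \<kappa> * (LINT x|lebesgue_on D. v x * penalty' (u x - M))" by simp
  also have "\<dots> \<le> 0" using le kappa_pos by (simp add: mult_nonneg_nonpos)
  finally show ?thesis .
qed

text \<open>Convexity of the penalty gives a right derivative \<open>\<integral> penalty' (z - M) z' \<le> 0\<close>.  Continuity of \<open>z\<close>
  from both sides has to be assumed: a uniform bound for the L2 operator norms of \<open>S t\<close> is not available.\<close>
lemma excess_decreasing:
  assumes \<tau>: "0 \<le> \<tau>" and M: "M \<ge> 0"
    and gen: "\<And>s. 0 \<le> s \<Longrightarrow> s \<le> \<tau> \<Longrightarrow> L2_generator D S (z s) (a s)"
    and z': "\<And>s. 0 \<le> s \<Longrightarrow> s \<le> \<tau> \<Longrightarrow> z' s \<in> L2 D"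
    and der: "\<And>s. 0 \<le> s \<Longrightarrow> s < \<tau> \<Longrightarrow>
      ((\<lambda>h. l2norm D (\<lambda>x. (z (s + h) x - z s x) / h - z' s x)) \<longlongrightarrow> 0) (at_right 0)"
    and cont: "\<And>s. 0 \<le> s \<Longrightarrow> s \<le> \<tau> \<Longrightarrow>
      ((\<lambda>r. l2norm D (\<lambda>x. z r x - z s x)) \<longlongrightarrow> 0) (at s within {0..\<tau>})"
    and le: "\<And>s x. 0 \<le> s \<Longrightarrow> s \<le> \<tau> \<Longrightarrow> x \<in> D \<Longrightarrow> z' s x \<le> a s x"
  shows "excess D M (z \<tau>) \<le> excess D M (z 0)"
proof -
  have z: "z s \<in> L2 D" and a: "a s \<in> L2 D" if "0 \<le> s" "s \<le> \<tau>" for s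
    using gen[OF that] by (auto simp: L2_generator_def)
  define \<psi> where "\<psi> = (\<lambda>s. excess D M (z s))"
  \<comment> \<open>A nonpositive right derivative only yields growth of less than
    \<open>e * h\<close> over short steps; the slack \<open>e\<close> is removed at the end.\<close>
  have claim: "\<psi> \<tau> \<le> \<psi> 0 + e * \<tau>" if e: "e > 0" for e
  proof (rule real_step_induct[OF \<tau>, of "\<lambda>t. \<psi> t \<le> \<psi> 0 + e * t"])
    show "\<psi> 0 \<le> \<psi> 0 + e * 0" by simp
  next
    fix t assume t: "0 < t" "t \<le> \<tau>" and IH: "\<And>s. 0 \<le> s \<Longrightarrow> s < t \<Longrightarrow> \<psi> s \<le> \<psi> 0 + e * s"
    have nt: "at t within {0..<t} \<noteq> bot" using t by (simp add: at_within_eq_bot_iff) 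
    have "((\<lambda>r. l2norm D (\<lambda>x. z r x - z t x)) \<longlongrightarrow> 0) (at t within {0..<t})"
      by (rule tendsto_within_subset[OF cont[of t]]) (use t in auto)
    then have "(\<psi> \<longlongrightarrow> \<psi> t) (at t within {0..<t})"
      unfolding \<psi>_def by (intro excess_tendsto z M) (use t z in \<open>auto simp: eventually_at_filter\<close>)
    moreover have "((\<lambda>s. \<psi> 0 + e * s) \<longlongrightarrow> \<psi> 0 + e * t) (at t within {0..<t})"
      by (intro tendsto_intros)
    moreover have "\<forall>\<^sub>F s in at t within {0..<t}. \<psi> s \<le> \<psi> 0 + e * s"
      using IH by (auto simp: eventually_at_filter)
    ultimately show "\<psi> t \<le> \<psi> 0 + e * t"
      using tendsto_le[OF nt] by blast
  next
    fix t assume t: "0 \<le> t" "t < \<tau>" and IH: "\<psi> t \<le> \<psi> 0 + e * t"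
    define q where "q = (\<lambda>h. l2norm D (\<lambda>x. (z (t + h) x - z t x) / h - z' t x))"
    define N N' where "N = l2norm D (z t)" and "N' = l2norm D (z' t)"
    note zt = z[OF t(1) less_imp_le[OF t(2)]] and z't = z'[OF t(1) less_imp_le[OF t(2)]]
      and at = a[OF t(1) less_imp_le[OF t(2)]]
    \<comment> \<open>The bound for the increment of \<open>\<psi>\<close> divided by
      \<open>h\<close>: the first term is the error of the difference quotient paired with
      \<open>penalty'\<close>, the second the quadratic remainder.\<close>
    have "((\<lambda>h. 6 * N * q h + 6 * h * (q h + N')\<^sup>2) \<longlongrightarrow> 6 * N * 0 + 6 * 0 * (0 + N')\<^sup>2) (at_right 0)"
      unfolding q_def by (intro tendsto_intros der t tendsto_ident_at)
    then have "\<forall>\<^sub>F h in at_right 0. 6 * N * q h + 6 * h * (q h + N')\<^sup>2 < e"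
      using e by (intro order_tendstoD(2)) auto
    then show "\<forall>\<^sub>F h in at_right 0. t + h \<le> \<tau> \<longrightarrow> \<psi> (t + h) \<le> \<psi> 0 + e * (t + h)"
      using eventually_at_right_less[of 0]
    proof eventually_elim
      case (elim h)
      show ?case
      proof
        assume le_tau: "t + h \<le> \<tau>"
        have zh: "z (t + h) \<in> L2 D" using t elim le_tau by (intro z) auto
        define d where "d = (\<lambda>x. z (t + h) x - z t x)"
        define r where "r = (\<lambda>x. d x / h - z' t x)"
        have d: "d \<in> L2 D" unfolding d_def by (intro L2_diff zh zt)
        have r: "r \<in> L2 D" unfolding r_def by (intro L2_diff L2_divide d z't)
        have qr: "q h = l2norm D r" by (simp add: q_def r_def d_def)
        have d_eq: "d = (\<lambda>x. h * (r x + z' t x))" using elim by (auto simp: r_def)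
        have nd: "l2norm D d \<le> h * (q h + N')"
          unfolding d_eq l2norm_cmult qr N'_def using elim l2norm_triangle[OF r z't] by simp
        note T = penalty'_L2[OF zt M]
        have "(LINT x|lebesgue_on D. penalty' (z t x - M) * d x)
            = h * ((LINT x|lebesgue_on D. penalty' (z t x - M) * r x) + (LINT x|lebesgue_on D. penalty' (z t x - M) * z' t x))"
        proof -
          have "(\<lambda>x. penalty' (z t x - M) * d x) = (\<lambda>x. h * (penalty' (z t x - M) * r x + penalty' (z t x - M) * z' t x))"
            by (auto simp: d_eq algebra_simps)
          then show ?thesis
            using L2_integrable_mult[OF T r] L2_integrable_mult[OF T z't] by simp
        qed
        moreover have "(LINT x|lebesgue_on D. penalty' (z t x - M) * r x) \<le> 6 * N * q h"
        proof -
          have "(LINT x|lebesgue_on D. penalty' (z t x - M) * r x) \<le> l2norm D (\<lambda>x. penalty' (z t x - M)) * l2norm D r"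
            using L2_Cauchy_Schwarz[OF T r] by simp
          also have "\<dots> \<le> 6 * N * q h"
            unfolding qr N_def by (intro mult_right_mono penalty'_l2norm zt M l2norm_nonneg)
          finally show ?thesis .
        qed
        moreover have "(LINT x|lebesgue_on D. penalty' (z t x - M) * z' t x) \<le> 0"
        proof -
          have "(LINT x|lebesgue_on D. penalty' (z t x - M) * z' t x) \<le> (LINT x|lebesgue_on D. penalty' (z t x - M) * a t x)"
            by (rule integral_mono[OF L2_integrable_mult[OF T z't] L2_integrable_mult[OF T at]])
              (use le t in \<open>auto intro!: mult_left_mono penalty'_nonneg\<close>)
          also have "\<dots> \<le> 0"
            by (rule generator_dissipative[OF gen M]) (use t in auto)
          finally show ?thesis .
        qed
        ultimately have "(LINT x|lebesgue_on D. penalty' (z t x - M) * d x) \<le> h * (6 * N * q h)"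
          using elim by simp
        moreover have "\<psi> (t + h) - \<psi> t - (LINT x|lebesgue_on D. penalty' (z t x - M) * d x) \<le> 6 * (l2norm D d)\<^sup>2"
          using excess_expansion[OF zt zh M] by (simp add: \<psi>_def d_def)
        moreover have "(l2norm D d)\<^sup>2 \<le> (h * (q h + N'))\<^sup>2"
          by (rule power_mono[OF nd l2norm_nonneg])
        ultimately have "\<psi> (t + h) - \<psi> t \<le> h * (6 * N * q h) + 6 * (h * (q h + N'))\<^sup>2"
          by linarith
        also have "\<dots> = h * (6 * N * q h + 6 * h * (q h + N')\<^sup>2)"
          by (simp add: algebra_simps power2_eq_square)
        also have "\<dots> \<le> h * e" using elim by (intro mult_left_mono) auto
        finally show "\<psi> (t + h) \<le> \<psi> 0 + e * (t + h)" using IH by (simp add: algebra_simps)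
      qed
    qed
  qed
  show ?thesis
  proof (rule field_le_epsilon)
    fix e :: real assume "e > 0"
    have "\<psi> \<tau> \<le> \<psi> 0 + e / (\<tau> + 1) * \<tau>" using \<open>e > 0\<close> \<tau> by (intro claim) auto
    also have "e / (\<tau> + 1) * \<tau> \<le> e" using \<open>e > 0\<close> \<tau> by (simp add: field_simps)
    finally show "excess D M (z \<tau>) \<le> excess D M (z 0) + e" by (simp add: \<psi>_def)
  qed
qed

end

lemma l2norm_cong: "(\<And>x. x \<in> D \<Longrightarrow> f x = g x) \<Longrightarrow> l2norm D f = l2norm D g"
  unfolding l2norm_def by (rule arg_cong[where f=sqrt], rule Bochner_Integration.integral_cong) auto

section \<open>Strict positivity of the heat semigroup\<close>

lemma partial_deriv_ball_bump:
  fixes a :: "'a::euclidean_space"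
  shows "partial_deriv b (\<lambda>x. bump p (R - (x - a) \<bullet> (x - a))) x
    = bump ([:0,0,1:] * (p - pderiv p)) (R - (x - a) \<bullet> (x - a)) * (- 2 * ((x - a) \<bullet> b))"
proof -
  define g where "g = (\<lambda>x. R - (x - a) \<bullet> (x - a))"
  have g: "smooth g"
    unfolding g_def by (intro smooth_diff smooth_const smooth_inner_self)
  have "(g has_derivative (\<lambda>h. - 2 * ((x - a) \<bullet> h))) (at x)"
    unfolding g_def by (auto intro!: derivative_eq_intros simp: inner_commute)
  then have "partial_deriv b g x = - 2 * ((x - a) \<bullet> b)" by (rule partial_deriv_eq)
  with partial_deriv_smooth_compose[OF g bump_has_derivative[of p], of b x] show ?thesis
    by (simp add: g_def)
qed

text \<open>Chain rule for \<open>\<beta> (R - |x - a|\<^sup>2)\<close>: the Laplacian is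
  \<open>4 * |x - a|\<^sup>2 * \<beta>'' - 2 * d * \<beta>'\<close> in dimension \<open>d\<close>.
  For \<open>\<beta> = bump 1\<close> the derivatives correspond to the polynomials
  \<open>y\<^sup>2\<close> and \<open>y\<^sup>2 * (y\<^sup>2 - 2 * y)\<close>.\<close>

lemma laplacian_ball_bump:
  fixes a :: "'a::euclidean_space"
  shows "laplacian (\<lambda>x. bump 1 (R - (x - a) \<bullet> (x - a))) x
    = 4 * ((x - a) \<bullet> (x - a)) * bump ([:0,0,1:] * [:0,-2,1:]) (R - (x - a) \<bullet> (x - a))
      - 2 * real DIM('a) * bump [:0,0,1:] (R - (x - a) \<bullet> (x - a))"
proof -
  define y where "y = R - (x - a) \<bullet> (x - a)"
  have *: "[:0,0,1:] * ((1::real poly) - pderiv 1) = [:0,0,1:]"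
    "[:0,0,1:] - pderiv [:0,0,1::real:] = [:0,-2,1:]"
    by (simp_all add: pderiv_1 pderiv_pCons)
  have "partial_deriv b (partial_deriv b (\<lambda>x. bump 1 (R - (x - a) \<bullet> (x - a)))) x
    = bump ([:0,0,1:] * [:0,-2,1:]) y * (4 * (((x - a) \<bullet> b) * ((x - a) \<bullet> b))) - 2 * bump [:0,0,1:] y"
    if b: "b \<in> Basis" for b
  proof -
    have 1: "partial_deriv b (\<lambda>x. bump 1 (R - (x - a) \<bullet> (x - a)))
      = (\<lambda>x. bump [:0,0,1:] (R - (x - a) \<bullet> (x - a)) * (- 2 * ((x - a) \<bullet> b)))"
      by (rule ext) (simp only: partial_deriv_ball_bump *)
    have h: "((\<lambda>x. bump [:0,0,1:] (R - (x - a) \<bullet> (x - a))) has_derivative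
        (\<lambda>b. bump ([:0,0,1:] * [:0,-2,1:]) y * (- 2 * ((x - a) \<bullet> b)))) (at x)"
      using smooth_has_derivative[OF smooth_ball_bump[of "[:0,0,1:]" R a], of x]
      unfolding partial_deriv_ball_bump *(2) y_def .
    have D: "((\<lambda>x. bump [:0,0,1:] (R - (x - a) \<bullet> (x - a)) * (- 2 * ((x - a) \<bullet> b))) has_derivative
        (\<lambda>h. bump [:0,0,1:] (R - (x - a) \<bullet> (x - a)) * (- 2 * (h \<bullet> b))
          + bump ([:0,0,1:] * [:0,-2,1:]) y * (- 2 * ((x - a) \<bullet> h)) * (- 2 * ((x - a) \<bullet> b)))) (at x)"
      by (rule has_derivative_mult[OF h]) (auto intro!: derivative_eq_intros)
    have "A * (- 2 * 1) + B * (- 2 * \<beta>) * (- 2 * \<beta>) = B * (4 * (\<beta> * \<beta>)) - 2 * A" for A B \<beta> :: real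
      by simp
    then show ?thesis
      unfolding 1 partial_deriv_eq[OF D, of b] inner_same_Basis[OF b] y_def .
  qed
  then have "laplacian (\<lambda>x. bump 1 (R - (x - a) \<bullet> (x - a))) x
    = (\<Sum>b\<in>Basis. bump ([:0,0,1:] * [:0,-2,1:]) y * (4 * (((x - a) \<bullet> b) * ((x - a) \<bullet> b))) - 2 * bump [:0,0,1:] y)"
    unfolding laplacian_def by (intro sum.cong) auto
  also have "\<dots> = bump ([:0,0,1:] * [:0,-2,1:]) y * (4 * (\<Sum>b\<in>Basis. ((x - a) \<bullet> b) * ((x - a) \<bullet> b)))
      - real DIM('a) * (2 * bump [:0,0,1:] y)"
    by (simp only: sum_subtractf sum_distrib_left sum_constant)
  also have "(\<Sum>b\<in>Basis. ((x - a) \<bullet> b) * ((x - a) \<bullet> b)) = (x - a) \<bullet> (x - a)"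
    by (rule euclidean_inner[symmetric])
  finally show ?thesis by (simp add: y_def mult_ac)
qed

text \<open>Near the boundary of the support the second derivative of the bump dominates the first one;
  elsewhere a large multiple of the bump itself does.\<close>
lemma bump_barrier:
  assumes "\<kappa> > 0" "a > 0" "C \<ge> 0"
  obtains l where "l \<ge> 0" "\<And>y Q. a \<le> Q + y \<Longrightarrow> 0 \<le> Q \<Longrightarrow> Q \<le> b \<Longrightarrow>
    C * bump [:0,0,1:] y \<le> 4 * \<kappa> * Q * bump ([:0,0,1:] * [:0,-2,1:]) y + l * bump 1 y"
proof -
  \<comment> \<open>Threshold for \<open>w = 1 / y\<close>. Above it, 4 ensures
    \<open>w\<^sup>2 - 2 * w \<ge> w\<^sup>2 / 2\<close>, \<open>2 / a\<close> ensures
    \<open>y \<le> a / 2\<close> and thus \<open>Q \<ge> a / 2\<close>, and the last entry lets the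
    fourth power of \<open>w\<close> absorb \<open>C * w\<^sup>2\<close>.\<close>
  define W where "W = max 4 (max (2 / a) (C / (\<kappa> * a)))"
  have W: "W \<ge> 4" "W \<ge> 2 / a" "W \<ge> C / (\<kappa> * a)" by (auto simp: W_def)
  \<comment> \<open>Below the threshold this dominates \<open>C * w\<^sup>2\<close> together with
    the only negative contribution, \<open>8 * \<kappa> * Q * w ^ 3\<close>.\<close>
  define l where "l = C * W\<^sup>2 + 8 * \<kappa> * \<bar>b\<bar> * W ^ 3"
  have l: "l \<ge> 0" unfolding l_def using assms W by (intro add_nonneg_nonneg mult_nonneg_nonneg) auto
  show ?thesis
  proof (rule that[OF l])
    fix y Q assume Q: "a \<le> Q + y" "0 \<le> Q" "Q \<le> b"
    show "C * bump [:0,0,1:] y \<le> 4 * \<kappa> * Q * bump ([:0,0,1:] * [:0,-2,1:]) y + l * bump 1 y"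
    proof (cases "y > 0")
      case True
      define w where "w = 1 / y"
      have w: "w > 0" "y = 1 / w" using True by (auto simp: w_def)
      have "C * w\<^sup>2 \<le> 4 * \<kappa> * Q * (w\<^sup>2 * (w\<^sup>2 - 2 * w)) + l"
      proof (cases "w \<ge> W")
        case True
        have "2 / a \<le> w" "C / (\<kappa> * a) \<le> w" using W True by auto
        then have *: "2 \<le> w * a" "C \<le> w * (\<kappa> * a)"
          using assms(1,2) by (simp_all add: pos_divide_le_eq)
        then have "1 / w \<le> a / 2"
          using w by (simp add: field_simps)
        then have Qa: "Q \<ge> a / 2" using Q(1) w by simp
        have "C \<le> \<kappa> * a * w"
          using *(2) by (simp add: mult_ac)
        also have "\<dots> \<le> \<kappa> * a * w\<^sup>2"
          using True W(1) assms by (intro mult_left_mono) (auto simp: power2_eq_square)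
        finally have "C * w\<^sup>2 \<le> \<kappa> * a * w\<^sup>2 * w\<^sup>2" by (rule mult_right_mono) simp
        also have "\<dots> = 4 * \<kappa> * (a / 2) * (w\<^sup>2 * (w\<^sup>2 / 2))" by simp
        also have "\<dots> \<le> 4 * \<kappa> * Q * (w\<^sup>2 * (w\<^sup>2 / 2))"
          using Qa assms by (intro mult_right_mono mult_left_mono) auto
        also have "\<dots> \<le> 4 * \<kappa> * Q * (w\<^sup>2 * (w\<^sup>2 - 2 * w))"
        proof (intro mult_left_mono)
          have "4 * w \<le> w * w" using True W(1) by (intro mult_right_mono) auto
          then show "w\<^sup>2 / 2 \<le> w\<^sup>2 - 2 * w" by (simp add: power2_eq_square)
        qed (use assms Q in auto)
        finally show ?thesis using l by simp
      next
        case False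
        have "C * w\<^sup>2 \<le> C * W\<^sup>2" using False w assms by (intro mult_left_mono power_mono) auto
        moreover have "4 * \<kappa> * Q * (2 * w ^ 3) \<le> 4 * \<kappa> * \<bar>b\<bar> * (2 * W ^ 3)"
          using False w assms Q W by (intro mult_mono power_mono) auto
        moreover have "4 * \<kappa> * Q * (w\<^sup>2 * w\<^sup>2) \<ge> 0" using assms Q by simp
        ultimately show ?thesis
          by (simp add: l_def algebra_simps power2_eq_square power3_eq_cube)
      qed
      then have le: "C * w\<^sup>2 * exp (- w) \<le> (4 * \<kappa> * Q * (w\<^sup>2 * (w\<^sup>2 - 2 * w)) + l) * exp (- w)"
        by (rule mult_right_mono) simp
      have "bump [:0,0,1:] y = w\<^sup>2 * exp (- w)" "bump 1 y = exp (- w)"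
        "bump ([:0,0,1:] * [:0,-2,1:]) y = w\<^sup>2 * (w\<^sup>2 - 2 * w) * exp (- w)"
        using True by (auto simp: bump_def w_def[symmetric] power2_eq_square algebra_simps)
      note eqs = this
      show ?thesis unfolding eqs using le by (simp add: algebra_simps)
    qed (simp add: bump_def)
  qed
qed

context heat
begin

lemma dom_closure: "x \<in> D \<Longrightarrow> x \<in> closure D"
  using closure_subset by blast

text \<open>Cutoffs times uniform smooth approximants. As \<open>f\<close> may be nonzero on the
  boundary, the convergence is only pointwise in \<open>D\<close> and dominated, hence in
  L2.\<close>

lemma test_functions_dense:
  assumes f: "continuous_on (closure D) f"
  obtains \<phi> where "\<And>k::nat. test_function D (\<phi> k)"
    "(\<lambda>k. l2norm D (\<lambda>x. \<phi> k x - f x)) \<longlonglongrightarrow> 0"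
proof -
  obtain c :: "nat \<Rightarrow> 'a \<Rightarrow> real" where c: "\<And>k. test_function D (c k)" "\<And>k x. 0 \<le> c k x"
    "\<And>k x. c k x \<le> 1" "\<And>x. x \<in> D \<Longrightarrow> (\<lambda>k. c k x) \<longlonglongrightarrow> 1"
    using test_function_cutoffs[OF open_dom] by blast
  have "\<forall>k. \<exists>g. smooth g \<and> (\<forall>x\<in>closure D. \<bar>f x - g x\<bar> < inverse (real (Suc k)))"
    by (intro allI smooth_dense compact_closure_dom f) simp
  then obtain g where g: "\<And>k. smooth (g k)"
    "\<And>k x. x \<in> closure D \<Longrightarrow> \<bar>f x - g k x\<bar> < inverse (real (Suc k))"
    by metis
  obtain B where B: "B > 0" "\<And>x. x \<in> closure D \<Longrightarrow> \<bar>f x\<bar> \<le> B"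
    using continuous_bounded[OF f] by metis
  define \<phi> where "\<phi> = (\<lambda>k x. c k x * g k x)"
  have \<phi>: "test_function D (\<phi> k)" for k
    unfolding \<phi>_def by (rule test_function_mult[OF c(1) g(1)])
  have fL2: "f \<in> L2 D" by (rule continuous_L2[OF f])
  have dL2: "(\<lambda>x. \<phi> k x - f x) \<in> L2 D" for k
    by (intro L2_diff test_function_L2 \<phi> dom_sets fL2)
  have bound: "\<bar>\<phi> k x - f x\<bar> \<le> inverse (real (Suc k)) + (1 - c k x) * B" if x: "x \<in> D" for k x
  proof -
    have x': "x \<in> closure D" using x closure_subset by blast
    have "\<phi> k x - f x = c k x * (g k x - f x) - (1 - c k x) * f x"
      by (simp add: \<phi>_def algebra_simps)
    moreover have "\<bar>c k x * (g k x - f x)\<bar> \<le> 1 * inverse (real (Suc k))"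
      unfolding abs_mult using c(2,3)[of k x] g(2)[OF x', of k] by (intro mult_mono) auto
    moreover have "\<bar>(1 - c k x) * f x\<bar> \<le> (1 - c k x) * B"
      unfolding abs_mult using c(2,3)[of k x] B(2)[OF x'] by (intro mult_mono) auto
    ultimately show ?thesis by linarith
  qed
  have "(\<lambda>k. LINT x|lebesgue_on D. (\<phi> k x - f x)\<^sup>2) \<longlonglongrightarrow> (LINT x|lebesgue_on D. 0)"
  proof (rule integral_dominated_convergence)
    show "(\<lambda>x. (\<phi> k x - f x)\<^sup>2) \<in> borel_measurable (lebesgue_on D)" for k
      by (intro borel_measurable_power L2_measurable dL2)
    show "integrable (lebesgue_on D) (\<lambda>x. (1 + B)\<^sup>2)"
      by (intro finite_measure.integrable_const finite_measure_lebesgue_on dom_lmeasurable)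
    show "AE x in lebesgue_on D. (\<lambda>k. (\<phi> k x - f x)\<^sup>2) \<longlonglongrightarrow> 0"
    proof (rule AE_I2)
      fix x assume "x \<in> space (lebesgue_on D)"
      then have x: "x \<in> D" by simp
      have "(\<lambda>k. inverse (real (Suc k)) + (1 - c k x) * B) \<longlonglongrightarrow> 0 + (1 - 1) * B"
        by (intro tendsto_intros c(4)[OF x] LIMSEQ_inverse_real_of_nat)
      then have "(\<lambda>k. inverse (real (Suc k)) + (1 - c k x) * B) \<longlonglongrightarrow> 0" by simp
      then have "(\<lambda>k. \<phi> k x - f x) \<longlonglongrightarrow> 0"
        by (rule Lim_null_comparison[rotated]) (use bound[OF x] in auto)
      from tendsto_power[OF this, of 2] show "(\<lambda>k. (\<phi> k x - f x)\<^sup>2) \<longlonglongrightarrow> 0" by simp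
    qed
    show "AE x in lebesgue_on D. norm ((\<phi> k x - f x)\<^sup>2) \<le> (1 + B)\<^sup>2" for k
    proof (rule AE_I2)
      fix x assume "x \<in> space (lebesgue_on D)"
      then have x: "x \<in> D" by simp
      have "inverse (real (Suc k)) \<le> 1" by (simp add: inverse_le_1_iff)
      moreover have "(1 - c k x) * B \<le> 1 * B" using c(2)[of k x] B(1) by (intro mult_right_mono) auto
      ultimately have "\<bar>\<phi> k x - f x\<bar> \<le> 1 + B" using bound[OF x, of k] by linarith
      from power_mono[OF this, of 2] show "norm ((\<phi> k x - f x)\<^sup>2) \<le> (1 + B)\<^sup>2" by simp
    qed
  qed simp
  then have "(\<lambda>k. l2norm D (\<lambda>x. \<phi> k x - f x)) \<longlonglongrightarrow> 0"
    unfolding l2norm_def using tendsto_real_sqrt by fastforce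
  with \<phi> show ?thesis by (rule that)
qed

lemma S_right_derivative:
  assumes \<phi>: "test_function D \<phi>" and s: "0 \<le> s"
  shows "((\<lambda>h. l2norm D (\<lambda>x. (S (s + h) \<phi> x - S s \<phi> x) / h - S s (\<lambda>x. \<kappa> * laplacian \<phi> x) x))
    \<longlongrightarrow> 0) (at_right 0)"
proof (rule l2norm_tendsto_zero)
  show "((\<lambda>h. l2norm D (\<lambda>x. (S h (S s \<phi>) x - S s \<phi> x) / h - S s (\<lambda>x. \<kappa> * laplacian \<phi> x) x))
    \<longlongrightarrow> 0) (at_right 0)"
    using generator_S[OF generator_test_function[OF \<phi>] s] by (simp add: L2_generator_def)
  have "l2norm D (\<lambda>x. (S (s + h) \<phi> x - S s \<phi> x) / h - S s (\<lambda>x. \<kappa> * laplacian \<phi> x) x)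
     = l2norm D (\<lambda>x. (S h (S s \<phi>) x - S s \<phi> x) / h - S s (\<lambda>x. \<kappa> * laplacian \<phi> x) x)" if "h > 0" for h
  proof (rule l2norm_cong)
    fix x assume "x \<in> D"
    then have "S (h + s) \<phi> x = S h (S s \<phi>) x"
      using that s closure_subset by (intro S_add admissible_C0 test_function_C0 \<phi>) auto
    then show "(S (s + h) \<phi> x - S s \<phi> x) / h - S s (\<lambda>x. \<kappa> * laplacian \<phi> x) x
      = (S h (S s \<phi>) x - S s \<phi> x) / h - S s (\<lambda>x. \<kappa> * laplacian \<phi> x) x"
      by (simp add: add.commute)
  qed
  then show "\<forall>\<^sub>F h in at_right 0. l2norm D (\<lambda>x. (S (s + h) \<phi> x - S s \<phi> x) / h - S s (\<lambda>x. \<kappa> * laplacian \<phi> x) x)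
     \<le> l2norm D (\<lambda>x. (S h (S s \<phi>) x - S s \<phi> x) / h - S s (\<lambda>x. \<kappa> * laplacian \<phi> x) x)"
    by (intro eventually_mono[OF eventually_at_right_less]) simp
qed

section \<open>The comparison principle\<close>

lemma excess_S_test_function:
  assumes \<phi>: "test_function D \<phi>" and t: "0 \<le> t" and M: "M \<ge> 0"
  shows "excess D M (S t \<phi>) \<le> excess D M \<phi>"
proof -
  define w where "w = (\<lambda>x. \<kappa> * laplacian \<phi> x)"
  have gen: "L2_generator D S (S s \<phi>) (S s w)" if "0 \<le> s" for s
    unfolding w_def by (rule generator_S[OF generator_test_function[OF \<phi>] that])
  have "excess D M (S t \<phi>) \<le> excess D M (S 0 \<phi>)"
  proof (rule excess_decreasing[OF t M, of "\<lambda>s. S s \<phi>" "\<lambda>s. S s w" "\<lambda>s. S s w"])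
    show "S s w \<in> L2 D" if "0 \<le> s" for s
      using gen[OF that] by (simp add: L2_generator_def)
    show "((\<lambda>r. l2norm D (\<lambda>x. S r \<phi> x - S s \<phi> x)) \<longlongrightarrow> 0) (at s within {0..t})" if "0 \<le> s" for s
      by (rule tendsto_within_subset[OF S_L2_continuous[OF test_function_C0[OF \<phi>] that]]) auto
  qed (use gen S_right_derivative[OF \<phi>] in \<open>auto simp: w_def\<close>)
  also have "excess D M (S 0 \<phi>) = excess D M \<phi>"
    unfolding excess_def
    by (rule Bochner_Integration.integral_cong)
      (auto simp: S_zero[OF test_function_C0[OF \<phi>]] dom_closure)
  finally show ?thesis .
qed

text \<open>The approximating test functions need not stay below \<open>M\<close>, since they
  converge only in L2. The functional \<open>excess D M\<close> tolerates this: it does not increase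
  along the evolution of each of them, is continuous in L2, and is nonpositive exactly when the
  bound holds almost everywhere.\<close>

lemma S_le_const:
  assumes f: "admissible t f" and M: "M \<ge> 0" and le: "\<And>y. y \<in> D \<Longrightarrow> f y \<le> M" and x: "x \<in> closure D"
  shows "S t f x \<le> M"
proof -
  have t: "0 \<le> t" and cont: "continuous_on (closure D) f"
    using f by (auto simp: admissible_def)
  obtain \<phi> where \<phi>: "\<And>k::nat. test_function D (\<phi> k)"
    and lim: "(\<lambda>k. l2norm D (\<lambda>x. \<phi> k x - f x)) \<longlonglongrightarrow> 0"
    using test_functions_dense[OF cont] by blast
  note \<phi>L2 = test_function_L2[OF \<phi> dom_sets]
  have fL2: "f \<in> L2 D" by (rule admissible_L2[OF f])
  obtain K where K: "\<And>f. f \<in> L2 D \<Longrightarrow> l2norm D (S t f) \<le> K * l2norm D f"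
    using S_bounded[OF t] by blast
  have "l2norm D (\<lambda>x. S t (\<phi> k) x - S t f x) \<le> K * l2norm D (\<lambda>x. \<phi> k x - f x)" for k
  proof -
    have "l2norm D (\<lambda>x. S t (\<phi> k) x - S t f x) = l2norm D (S t (\<lambda>y. \<phi> k y - f y))"
      by (rule l2norm_cong) (simp add: S_diff[OF admissible_C0[OF test_function_C0[OF \<phi>] t] f] dom_closure)
    also have "\<dots> \<le> K * l2norm D (\<lambda>x. \<phi> k x - f x)"
      by (intro K L2_diff \<phi>L2 fL2)
    finally show ?thesis .
  qed
  then have "(\<lambda>k. l2norm D (\<lambda>x. S t (\<phi> k) x - S t f x)) \<longlonglongrightarrow> 0"
    by (intro l2norm_tendsto_zero[OF tendsto_mult_right_zero[OF lim, of K]]) auto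
  then have 1: "(\<lambda>k. excess D M (S t (\<phi> k))) \<longlonglongrightarrow> excess D M (S t f)"
    by (intro excess_tendsto S_L2 t fL2 M always_eventually allI \<phi>L2)
  have 2: "(\<lambda>k. excess D M (\<phi> k)) \<longlonglongrightarrow> excess D M f"
    by (intro excess_tendsto fL2 M always_eventually allI \<phi>L2 lim)
  have "excess D M (S t f) \<le> excess D M f"
    by (rule LIMSEQ_le[OF 1 2]) (use excess_S_test_function[OF \<phi> t M] in auto)
  also have "\<dots> \<le> 0"
    using le by (subst excess_le_0_iff[OF fL2 M]) (auto intro: AE_I2)
  finally have "AE x in lebesgue_on D. S t f x \<le> M"
    by (subst (asm) excess_le_0_iff[OF S_L2[OF t fL2] M])
  then show ?thesis
    by (rule AE_le_imp_le[OF S_continuous[OF f] continuous_on_const _ x])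
qed

text \<open>A nonnegative constant is a supersolution, although it is not in \<open>C0\<close>. A
  one-sided uniform error therefore passes through the semigroup without growing; the nonlinear
  estimates carry their errors in this form.\<close>

lemma S_mono_const:
  assumes f: "admissible t f" and g: "admissible t g" and M: "M \<ge> 0"
    and le: "\<And>y. y \<in> D \<Longrightarrow> f y \<le> g y + M" and x: "x \<in> closure D"
  shows "S t f x \<le> S t g x + M"
proof -
  have "S t (\<lambda>y. f y - g y) x \<le> M"
    using admissible_linear[OF f g, of 1 "-1"] le by (intro S_le_const M x) (auto simp: algebra_simps)
  then show ?thesis using S_diff[OF f g x] by simp
qed

lemma S_mono:
  assumes "admissible t f" "admissible t g" "\<And>y. y \<in> D \<Longrightarrow> f y \<le> g y" "x \<in> closure D"
  shows "S t f x \<le> S t g x"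
proof -
  have "S t f x \<le> S t g x + 0"
    by (rule S_mono_const[OF assms(1,2) _ _ assms(4)]) (simp_all add: assms(3))
  then show ?thesis by simp
qed

lemma S_nonneg:
  assumes "admissible t f" "\<And>y. y \<in> D \<Longrightarrow> 0 \<le> f y" "x \<in> closure D"
  shows "0 \<le> S t f x"
proof -
  have "admissible t (\<lambda>y. 0 * f y)"
    using admissible_linear[OF assms(1,1), of 0 0] by simp
  from S_mono[OF this assms(1) _ assms(3)] S_cmult[OF assms(1,3), of 0] assms(2) show ?thesis by simp
qed

section \<open>Subsolutions and the spreading of positivity\<close>

lemma uniformly_continuous_slices:
  fixes V :: "real \<Rightarrow> 'a \<Rightarrow> real"
  assumes V: "continuous_on ({0..\<tau>} \<times> closure D) (\<lambda>(s, x). V s x)" and e: "e > 0"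
  obtains d where "d > 0" "\<And>r s x. 0 \<le> r \<Longrightarrow> r \<le> \<tau> \<Longrightarrow> 0 \<le> s \<Longrightarrow> s \<le> \<tau> \<Longrightarrow> \<bar>r - s\<bar> < d \<Longrightarrow>
    x \<in> closure D \<Longrightarrow> \<bar>V r x - V s x\<bar> \<le> e"
proof -
  have "uniformly_continuous_on ({0..\<tau>} \<times> closure D) (\<lambda>(s, x). V s x)"
    by (intro compact_uniformly_continuous compact_Times compact_closure_dom V) auto
  then obtain d where d: "d > 0" "\<And>p p'. p \<in> {0..\<tau>} \<times> closure D \<Longrightarrow> p' \<in> {0..\<tau>} \<times> closure D \<Longrightarrow>
      dist p' p < d \<Longrightarrow> dist (case p' of (s, x) \<Rightarrow> V s x) (case p of (s, x) \<Rightarrow> V s x) < e"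
    using e unfolding uniformly_continuous_on_def by metis
  show ?thesis
  proof (rule that[OF d(1)])
    fix r s x assume "0 \<le> r" "r \<le> \<tau>" "0 \<le> s" "s \<le> \<tau>" "\<bar>r - s\<bar> < d" "x \<in> closure D"
    then show "\<bar>V r x - V s x\<bar> \<le> e"
      using d(2)[of "(s, x)" "(r, x)"] by (simp add: dist_Pair_Pair dist_real_def)
  qed
qed

text \<open>The difference \<open>z s = V s - S s (V 0)\<close> starts at 0, and its time derivative
  is at most the generator applied to \<open>z s\<close>. Hence \<open>excess D 0 (z s)\<close>
  stays 0. Requiring each \<open>V s\<close> to be a test function puts it in the domain of the
  generator.\<close>

lemma S_ge_subsolution:
  assumes \<tau>: "0 \<le> \<tau>"
    and V: "\<And>s. 0 \<le> s \<Longrightarrow> s \<le> \<tau> \<Longrightarrow> test_function D (V s)"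
    and contV: "continuous_on UNIV (\<lambda>(s, x). V s x)" and contV': "continuous_on UNIV (\<lambda>(s, x). V' s x)"
    and der: "\<And>s x. ((\<lambda>s. V s x) has_real_derivative V' s x) (at s)"
    and sub: "\<And>s x. 0 \<le> s \<Longrightarrow> s \<le> \<tau> \<Longrightarrow> x \<in> D \<Longrightarrow> V' s x \<le> \<kappa> * laplacian (V s) x"
    and x: "x \<in> closure D"
  shows "V \<tau> x \<le> S \<tau> (V 0) x"
proof -
  have slice: "continuous_on A (V s)" "continuous_on A (V' s)" for s A
  proof -
    have "continuous_on A (\<lambda>x. (s, x))"
      by (intro continuous_on_Pair continuous_on_const continuous_on_id)
    then show "continuous_on A (V s)" "continuous_on A (V' s)"
      using continuous_on_compose2[OF contV, of A "\<lambda>x. (s, x)"]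
        continuous_on_compose2[OF contV', of A "\<lambda>x. (s, x)"] by auto
  qed
  have VL2: "V s \<in> L2 D" "V' s \<in> L2 D" for s
    by (intro continuous_L2 slice)+
  define \<phi> where "\<phi> = V 0"
  have \<phi>: "test_function D \<phi>" unfolding \<phi>_def by (rule V) (use \<tau> in auto)
  note \<phi>C = test_function_C0[OF \<phi>]
  define w where "w = (\<lambda>x. \<kappa> * laplacian \<phi> x)"
  have SL2: "S s \<phi> \<in> L2 D" "S s w \<in> L2 D" if "0 \<le> s" for s
    using generator_S[OF generator_test_function[OF \<phi>] that] by (auto simp: L2_generator_def w_def)
  have lim_V: "((\<lambda>r. l2norm D (\<lambda>x. V r x - V s x)) \<longlongrightarrow> 0) (at s within {0..\<tau>})"
    if s: "0 \<le> s" "s \<le> \<tau>" for s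
  proof (rule uniform_l2norm_tendsto)
    fix e :: real assume "e > 0"
    then obtain d where d: "d > 0" "\<And>r s x. 0 \<le> r \<Longrightarrow> r \<le> \<tau> \<Longrightarrow> 0 \<le> s \<Longrightarrow> s \<le> \<tau> \<Longrightarrow> \<bar>r - s\<bar> < d \<Longrightarrow>
        x \<in> closure D \<Longrightarrow> \<bar>V r x - V s x\<bar> \<le> e"
      using uniformly_continuous_slices[OF continuous_on_subset[OF contV subset_UNIV]] by metis
    show "\<forall>\<^sub>F r in at s within {0..\<tau>}. \<forall>x\<in>D. \<bar>V r x - V s x\<bar> \<le> e"
      unfolding eventually_at
      by (rule exI[of _ d]) (use d s closure_subset[of D] in \<open>auto simp: dist_real_def\<close>)
  qed (intro borel_measurable_diff L2_measurable VL2)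
  have lim_V': "((\<lambda>h. l2norm D (\<lambda>x. (V (s + h) x - V s x) / h - V' s x)) \<longlongrightarrow> 0) (at_right 0)"
    if s: "0 \<le> s" "s < \<tau>" for s
  proof (rule uniform_l2norm_tendsto)
    fix e :: real assume "e > 0"
    then obtain d where d: "d > 0" "\<And>r s x. 0 \<le> r \<Longrightarrow> r \<le> \<tau> \<Longrightarrow> 0 \<le> s \<Longrightarrow> s \<le> \<tau> \<Longrightarrow> \<bar>r - s\<bar> < d \<Longrightarrow>
        x \<in> closure D \<Longrightarrow> \<bar>V' r x - V' s x\<bar> \<le> e"
      using uniformly_continuous_slices[OF continuous_on_subset[OF contV' subset_UNIV]] by metis
    have "\<bar>(V (s + h) x - V s x) / h - V' s x\<bar> \<le> e"
      if h: "0 < h" "h < d" "h < \<tau> - s" and x: "x \<in> D" for h x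
    proof -
      have "s < s + h" using h by simp
      from MVT2[OF this, of "\<lambda>s. V s x" "\<lambda>s. V' s x"] der
      obtain z where z: "s < z" "z < s + h" "V (s + h) x - V s x = h * V' z x" by auto
      then have "(V (s + h) x - V s x) / h = V' z x" using h by simp
      moreover have "x \<in> closure D" using x closure_subset by blast
      ultimately show ?thesis
        using d(2)[of z s x] z h s by auto
    qed
    then show "\<forall>\<^sub>F h in at_right 0. \<forall>x\<in>D. \<bar>(V (s + h) x - V s x) / h - V' s x\<bar> \<le> e"
      unfolding eventually_at_right_field
      by (intro exI[of _ "min d (\<tau> - s)"]) (use d s in auto)
  qed (intro borel_measurable_diff borel_measurable_divide L2_measurable VL2 borel_measurable_const)
  have "excess D 0 (\<lambda>x. V \<tau> x - S \<tau> \<phi> x) \<le> excess D 0 (\<lambda>x. V 0 x - S 0 \<phi> x)"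
  proof (rule excess_decreasing[OF \<tau> order_refl, of "\<lambda>s x. V s x - S s \<phi> x"
        "\<lambda>s x. \<kappa> * laplacian (V s) x - S s w x" "\<lambda>s x. V' s x - S s w x"])
    fix s assume s: "0 \<le> s" "s \<le> \<tau>"
    show "L2_generator D S (\<lambda>x. V s x - S s \<phi> x) (\<lambda>x. \<kappa> * laplacian (V s) x - S s w x)"
      unfolding w_def
      by (rule generator_diff[OF generator_test_function[OF V[OF s]] generator_S[OF generator_test_function[OF \<phi>] s(1)]])
    show "(\<lambda>x. V' s x - S s w x) \<in> L2 D"
      using s by (intro L2_diff VL2 SL2)
    show "V' s x - S s w x \<le> \<kappa> * laplacian (V s) x - S s w x" if "x \<in> D" for x
      using sub[OF s that] by simp
    have "((\<lambda>r. l2norm D (\<lambda>x. S r \<phi> x - S s \<phi> x)) \<longlongrightarrow> 0) (at s within {0..\<tau>})"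
      by (rule tendsto_within_subset[OF S_L2_continuous[OF \<phi>C s(1)]]) auto
    from tendsto_add_zero[OF lim_V[OF s] this]
    show "((\<lambda>r. l2norm D (\<lambda>x. V r x - S r \<phi> x - (V s x - S s \<phi> x))) \<longlongrightarrow> 0) (at s within {0..\<tau>})"
    proof (rule l2norm_tendsto_zero)
      have "l2norm D (\<lambda>x. V r x - S r \<phi> x - (V s x - S s \<phi> x))
          \<le> l2norm D (\<lambda>x. V r x - V s x) + l2norm D (\<lambda>x. S r \<phi> x - S s \<phi> x)" if "0 \<le> r" for r
        using l2norm_triangle_diff[OF L2_diff[OF VL2(1) VL2(1)] L2_diff[OF SL2(1) SL2(1)], OF that s(1), of r s]
        by (simp add: algebra_simps)
      then show "\<forall>\<^sub>F r in at s within {0..\<tau>}. l2norm D (\<lambda>x. V r x - S r \<phi> x - (V s x - S s \<phi> x))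
          \<le> l2norm D (\<lambda>x. V r x - V s x) + l2norm D (\<lambda>x. S r \<phi> x - S s \<phi> x)"
        by (auto simp: eventually_at_filter)
    qed
  next
    fix s assume s: "0 \<le> s" "s < \<tau>"
    from tendsto_add_zero[OF lim_V'[OF s] S_right_derivative[OF \<phi> s(1)]]
    show "((\<lambda>h. l2norm D (\<lambda>x. (V (s + h) x - S (s + h) \<phi> x - (V s x - S s \<phi> x)) / h - (V' s x - S s w x)))
      \<longlongrightarrow> 0) (at_right 0)"
    proof (rule l2norm_tendsto_zero)
      have "l2norm D (\<lambda>x. (V (s + h) x - S (s + h) \<phi> x - (V s x - S s \<phi> x)) / h - (V' s x - S s w x))
        \<le> l2norm D (\<lambda>x. (V (s + h) x - V s x) / h - V' s x)
          + l2norm D (\<lambda>x. (S (s + h) \<phi> x - S s \<phi> x) / h - S s w x)" if h: "0 < h" for h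
      proof -
        have "(\<lambda>x. (V (s + h) x - V s x) / h - V' s x) \<in> L2 D"
          "(\<lambda>x. (S (s + h) \<phi> x - S s \<phi> x) / h - S s w x) \<in> L2 D"
          using s h by (auto intro!: L2_diff L2_divide VL2 SL2)
        moreover have "(V (s + h) x - S (s + h) \<phi> x - (V s x - S s \<phi> x)) / h - (V' s x - S s w x)
            = ((V (s + h) x - V s x) / h - V' s x) - ((S (s + h) \<phi> x - S s \<phi> x) / h - S s w x)" for x
          by (simp add: diff_divide_distrib)
        ultimately show ?thesis
          by (simp only: l2norm_triangle_diff)
      qed
      then show "\<forall>\<^sub>F h in at_right 0.
        l2norm D (\<lambda>x. (V (s + h) x - S (s + h) \<phi> x - (V s x - S s \<phi> x)) / h - (V' s x - S s w x))
        \<le> l2norm D (\<lambda>x. (V (s + h) x - V s x) / h - V' s x)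
          + l2norm D (\<lambda>x. (S (s + h) \<phi> x - S s \<phi> x) / h - S s (\<lambda>x. \<kappa> * laplacian \<phi> x) x)"
        by (intro eventually_mono[OF eventually_at_right_less]) (simp add: w_def)
    qed
  qed
  also have "\<dots> \<le> 0"
  proof -
    have "V 0 y - S 0 \<phi> y = 0" if "y \<in> D" for y
      using S_zero[OF \<phi>C, of y] that closure_subset[of D] by (auto simp: \<phi>_def)
    then show ?thesis
      by (subst excess_le_0_iff) (auto intro!: L2_diff VL2 SL2 AE_I2)
  qed
  finally have "AE x in lebesgue_on D. V \<tau> x - S \<tau> \<phi> x \<le> 0"
    using \<tau> by (subst (asm) excess_le_0_iff) (auto intro!: L2_diff VL2 SL2)
  then have "AE x in lebesgue_on D. V \<tau> x \<le> S \<tau> \<phi> x"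
    by eventually_elim simp
  then show ?thesis
    unfolding \<phi>_def[symmetric]
    by (rule AE_le_imp_le[OF slice(1) S_continuous[OF admissible_C0[OF \<phi>C \<tau>]] _ x])
qed

lemma S_pos_ball:
  assumes g: "g \<in> C0 D" "\<And>y. y \<in> D \<Longrightarrow> 0 \<le> g y" and x0: "0 < g x0"
    and r: "0 < r" "cball x0 r \<subseteq> D" and t: "0 < t" and x: "x \<in> ball x0 r"
  shows "0 < S t g x"
proof -
  define m where "m = g x0 / 2"
  have m: "m > 0" using x0 by (simp add: m_def)
  have x0D: "x0 \<in> D" and xD: "x \<in> closure D"
    using r x closure_subset[of D] by force+
  have "continuous_on D g"
    using g(1) closure_subset[of D] by (auto dest: C0_continuous intro: continuous_on_subset)
  then have "isCont g x0" using x0D open_dom by (simp add: continuous_on_eq_continuous_at)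
  then obtain d where d: "d > 0" "\<And>y. dist y x0 < d \<Longrightarrow> \<bar>g y - g x0\<bar> < m"
    using m unfolding continuous_at_eps_delta dist_real_def by blast
  define \<rho> where "\<rho> = min d r / 2"
  have \<rho>: "0 < \<rho>" "\<rho> < d" "\<rho> < r" using d(1) r(1) by (auto simp: \<rho>_def min_def)
  \<comment> \<open>The squared radius \<open>\<rho>\<^sup>2 + c * s\<close> of the support grows
    from \<open>\<rho>\<^sup>2\<close>, where \<open>g\<close> is close to \<open>g x0\<close>, at
    time 0 to \<open>r\<^sup>2\<close> at time \<open>t\<close>.\<close>
  define c where "c = (r\<^sup>2 - \<rho>\<^sup>2) / t"
  have c: "c \<ge> 0" "c * t = r\<^sup>2 - \<rho>\<^sup>2"
    using t \<rho> by (auto simp: c_def power_mono)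
  \<comment> \<open>\<open>c\<close> comes from the time derivative of \<open>y\<close> and
    \<open>2 * \<kappa> * DIM('a)\<close> from the first-order term of the Laplacian. The lower
    bound \<open>\<rho>\<^sup>2\<close> applies because \<open>Q + y\<close> will be
    \<open>\<rho>\<^sup>2 + c * s\<close>.\<close>
  obtain l where l: "l \<ge> 0" "\<And>y Q. \<rho>\<^sup>2 \<le> Q + y \<Longrightarrow> 0 \<le> Q \<Longrightarrow> Q \<le> r\<^sup>2 \<Longrightarrow>
    (c + 2 * \<kappa> * real DIM('a)) * bump [:0,0,1:] y \<le> 4 * \<kappa> * Q * bump ([:0,0,1:] * [:0,-2,1:]) y + l * bump 1 y"
    using bump_barrier[of \<kappa> "\<rho>\<^sup>2" "c + 2 * \<kappa> * real DIM('a)" "r\<^sup>2"] kappa_pos \<rho>(1) c(1)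
    by (metis add_nonneg_nonneg less_imp_le mult_nonneg_nonneg of_nat_0_le_iff zero_le_numeral zero_less_power)
  define y where "y = (\<lambda>s x. \<rho>\<^sup>2 + c * s - (x - x0) \<bullet> (x - x0))"
  define V where "V = (\<lambda>s x. exp (- l * s) * bump 1 (y s x))"
  define V' where "V' = (\<lambda>s x. exp (- l * s) * (c * bump [:0,0,1:] (y s x) - l * bump 1 (y s x)))"
  have R: "\<rho>\<^sup>2 + c * s \<le> r\<^sup>2" if "s \<le> t" for s
    using mult_left_mono[OF that c(1)] c(2) by simp
  have B: "test_function D (\<lambda>x. bump 1 (y s x))" if "s \<le> t" for s
    unfolding y_def by (rule test_function_ball_bump[OF r(2) R[OF that]]) (use r in simp)
  have Vt: "test_function D (V s)" if "s \<le> t" for s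
    unfolding V_def by (rule test_function_cmult[OF B[OF that]])
  have bump_cont: "continuous_on UNIV (bump p)" for p
    by (rule smooth_continuous[OF smooth_bump])
  have "V t x \<le> S t (V 0) x"
  proof (rule S_ge_subsolution[OF less_imp_le[OF t], of V V'])
    show "test_function D (V s)" if "s \<le> t" for s by (rule Vt[OF that])
    have yc: "continuous_on UNIV (\<lambda>p. y (fst p) (snd p))"
      unfolding y_def by (intro continuous_intros)
    have bc: "continuous_on UNIV (\<lambda>p. bump q (y (fst p) (snd p)))" for q
      by (rule continuous_on_compose2[OF bump_cont yc]) simp
    show "continuous_on UNIV (\<lambda>(s, x). V s x)" "continuous_on UNIV (\<lambda>(s, x). V' s x)"
      unfolding V_def V'_def case_prod_beta by (intro continuous_intros bc)+
    show "((\<lambda>s. V s x) has_real_derivative V' s x) (at s)" for s x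
    proof -
      have yd: "((\<lambda>s. y s x) has_real_derivative c) (at s)"
        unfolding y_def by (auto intro!: derivative_eq_intros)
      have "((\<lambda>s. bump 1 (y s x)) has_real_derivative bump [:0,0,1:] (y s x) * c) (at s)"
        using DERIV_chain[OF bump_1_has_derivative yd] by (simp add: o_def)
      then have "((\<lambda>s. exp (- l * s) * bump 1 (y s x)) has_real_derivative
          exp (- l * s) * (- l) * bump 1 (y s x) + bump [:0,0,1:] (y s x) * c * exp (- l * s)) (at s)"
        by (intro DERIV_mult) (auto intro!: derivative_eq_intros)
      then show ?thesis by (simp add: V_def V'_def algebra_simps)
    qed
    fix s z assume s: "0 \<le> s" "s \<le> t" and "z \<in> D"
    define Q where "Q = (z - x0) \<bullet> (z - x0)"
    have "laplacian (V s) z = exp (- l * s) * laplacian (\<lambda>x. bump 1 (y s x)) z"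
    proof -
      have f: "smooth (\<lambda>x. bump 1 (y s x))" by (rule test_function_smooth[OF B[OF s(2)]])
      have pd: "partial_deriv b (\<lambda>x. k * u x) = (\<lambda>x. k * partial_deriv b u x)" if "smooth u" for b k and u :: "'a \<Rightarrow> real"
        by (rule ext, rule partial_deriv_eq) (intro has_derivative_mult_right smooth_has_derivative that)
      show ?thesis
        unfolding laplacian_def V_def
        by (simp add: pd[OF f] pd[OF smooth_partial_deriv[OF f]] sum_distrib_left)
    qed
    also have "\<dots> = exp (- l * s) * (4 * Q * bump ([:0,0,1:] * [:0,-2,1:]) (y s z) - 2 * real DIM('a) * bump [:0,0,1:] (y s z))"
      unfolding y_def laplacian_ball_bump Q_def ..
    finally have lap0: "laplacian (V s) z = exp (- l * s) *
        (4 * Q * bump ([:0,0,1:] * [:0,-2,1:]) (y s z) - 2 * real DIM('a) * bump [:0,0,1:] (y s z))" .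
    have lap: "\<kappa> * laplacian (V s) z = exp (- l * s) *
        (4 * \<kappa> * Q * bump ([:0,0,1:] * [:0,-2,1:]) (y s z) - 2 * \<kappa> * real DIM('a) * bump [:0,0,1:] (y s z))"
      unfolding lap0 by (simp add: algebra_simps)
    have "(c + 2 * \<kappa> * real DIM('a)) * bump [:0,0,1:] (y s z)
        \<le> 4 * \<kappa> * Q * bump ([:0,0,1:] * [:0,-2,1:]) (y s z) + l * bump 1 (y s z)"
    \<comment> \<open>Inside the support \<open>Q\<close> is at most \<open>r\<^sup>2\<close>, as
      the barrier estimate requires; outside it all bumps vanish.\<close>
    proof (cases "y s z > 0")
      case True
      then have "Q \<le> r\<^sup>2" using R[OF s(2)] by (simp add: y_def Q_def)
      moreover have "\<rho>\<^sup>2 \<le> Q + y s z" using c(1) s(1) by (simp add: y_def Q_def)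
      ultimately show ?thesis by (intro l(2)) (auto simp: Q_def)
    qed (simp add: bump_def)
    then show "V' s z \<le> \<kappa> * laplacian (V s) z"
      unfolding lap V'_def by (intro mult_left_mono) (auto simp: algebra_simps)
  qed (rule xD)
  moreover have "0 < V t x"
  proof -
    have "(norm (x - x0))\<^sup>2 < r\<^sup>2"
      using x by (intro power_strict_mono) (auto simp: dist_norm norm_minus_commute)
    then have "0 < y t x" by (simp add: y_def c(2) power2_norm_eq_inner)
    then show ?thesis by (simp add: V_def bump_pos_iff)
  qed
  \<comment> \<open>The initial barrier is at most 1 and supported where \<open>g \<ge> m\<close>,
    so \<open>m\<close> times it lies below \<open>g\<close>.\<close>
  moreover have "m * S t (V 0) x \<le> S t g x"
  proof -
    have V0: "V 0 \<in> C0 D" by (rule test_function_C0[OF Vt]) (use t in simp)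
    have adm: "admissible t (V 0)" "admissible t g"
      using t by (auto intro: admissible_C0 V0 g)
    have "m * V 0 z \<le> g z" if "z \<in> D" for z
    proof (cases "y 0 z > 0")
      case True
      then have "(norm (z - x0))\<^sup>2 < \<rho>\<^sup>2" by (simp add: y_def power2_norm_eq_inner)
      then have "norm (z - x0) < \<rho>" using \<rho>(1) power2_less_imp_less[of "norm (z - x0)" \<rho>] by simp
      then have "\<bar>g z - g x0\<bar> < m" using \<rho> by (intro d(2)) (simp add: dist_norm)
      then have "m \<le> g z" using m_def by linarith
      moreover have "V 0 z \<le> 1" using True by (simp add: V_def bump_def)
      ultimately show ?thesis using m mult_left_mono[of "V 0 z" 1 m] by linarith
    next
      case False
      then show ?thesis using g(2)[OF that] by (simp add: V_def bump_def)
    qed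
    moreover have "admissible t (\<lambda>z. m * V 0 z)"
      using admissible_linear[OF adm(1) adm(1), of m 0] by simp
    ultimately have "S t (\<lambda>z. m * V 0 z) x \<le> S t g x"
      using S_mono[OF _ adm(2) _ xD] by blast
    then show ?thesis by (simp add: S_cmult[OF adm(1) xD])
  qed
  ultimately show ?thesis
    using mult_strict_left_mono[of 0 "V t x" m] mult_left_mono[of "V t x" "S t (V 0) x" m] m by linarith
qed

text \<open>Chaining works for positivity at all times simultaneously: half of the time gives
  positivity at \<open>u\<close>, the other half carries it to \<open>v\<close>. With
  \<open>u\<close> and \<open>v\<close> in a ball of radius \<open>R / 3\<close> about
  \<open>a\<close>, their distance is below \<open>2 * R / 3\<close>, and the ball of that radius
  about \<open>u\<close> remains in \<open>D\<close>.\<close>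

lemma S_pos:
  assumes conn: "connected D" and g: "g \<in> C0 D" "\<And>y. y \<in> D \<Longrightarrow> 0 \<le> g y"
    and x0: "x0 \<in> D" "0 < g x0" and t: "0 < t" and x: "x \<in> D"
  shows "0 < S t g x"
proof -
  have "\<forall>t>0. 0 < S t g x"
  proof (rule connected_induction_simple[OF conn x0(1) x, of "\<lambda>x. \<forall>t>0. 0 < S t g x"])
    obtain R where R: "0 < R" "cball x0 R \<subseteq> D"
      using open_dom x0(1) open_contains_cball by blast
    then show "\<forall>t>0. 0 < S t g x0"
      using S_pos_ball[OF g x0(2) R] by simp
  next
    fix a assume "a \<in> D"
    then obtain R where R: "0 < R" "cball a R \<subseteq> D"
      using open_dom open_contains_cball by blast
    have step: "0 < S t g v" if u: "u \<in> ball a (R / 3)" "v \<in> ball a (R / 3)" "\<forall>t>0. 0 < S t g u" and t: "0 < t" for u v t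
    proof -
      have "cball u (2 * R / 3) \<subseteq> D"
      proof
        fix z assume "z \<in> cball u (2 * R / 3)"
        then have "dist a z \<le> R" using u(1) dist_triangle[of a z u] by simp
        then show "z \<in> D" using R by auto
      qed
      moreover have "v \<in> ball u (2 * R / 3)"
        using u(1,2) dist_triangle[of u v a] by (simp add: dist_commute)
      moreover have "S (t / 2) g \<in> C0 D" "\<And>y. y \<in> D \<Longrightarrow> 0 \<le> S (t / 2) g y"
        using t g closure_subset[of D] by (auto intro!: S_C0 S_nonneg admissible_C0)
      moreover have "0 < S (t / 2) g u" using u(3) t by simp
      ultimately have "0 < S (t / 2) (S (t / 2) g) v"
        using R(1) t by (intro S_pos_ball[of "S (t / 2) g" u "2 * R / 3"]) auto
      moreover have "v \<in> closure D"
        using u(2) R closure_subset[of D] by force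
      ultimately show ?thesis
        using S_add[of "t / 2" "t / 2" g v] t g(1) by (simp add: admissible_C0)
    qed
    show "\<exists>T. openin (top_of_set D) T \<and> a \<in> T \<and> (\<forall>x\<in>T. \<forall>y\<in>T. (\<forall>t>0. 0 < S t g x) \<longrightarrow> (\<forall>t>0. 0 < S t g y))"
    proof (intro exI[of _ "ball a (R / 3)"] conjI)
      show "openin (top_of_set D) (ball a (R / 3))"
        using R by (intro open_subset) auto
      show "a \<in> ball a (R / 3)" using R(1) by simp
      show "\<forall>x\<in>ball a (R / 3). \<forall>y\<in>ball a (R / 3). (\<forall>t>0. 0 < S t g x) \<longrightarrow> (\<forall>t>0. 0 < S t g y)"
        using step by blast
    qed
  qed
  with t show ?thesis by simp
qed

end

section \<open>Mild solutions\<close>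

text \<open>The endpoint \<open>b\<close> is left out of the hypothesis because the mild integrand
  there is \<open>S 0\<close> of a source that need not be in \<open>C0\<close>; one point does not
  affect the integral.\<close>

lemma integral_ge_const:
  fixes g :: "real \<Rightarrow> real"
  assumes g: "g integrable_on {a..b}" and "a \<le> b" and le: "\<And>s. a \<le> s \<Longrightarrow> s < b \<Longrightarrow> k \<le> g s"
  shows "k * (b - a) \<le> integral {a..b} g"
proof -
  define g' where "g' = (\<lambda>s. if s = b then k else g s)"
  have g': "g' integrable_on {a..b}"
    by (rule integrable_spike[OF g, of "{b}"]) (auto simp: g'_def)
  have "integral {a..b} (\<lambda>s. k) \<le> integral {a..b} g'"
    by (rule integral_le) (use g' le in \<open>auto simp: g'_def\<close>)
  also have "integral {a..b} g' = integral {a..b} g"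
    by (rule integral_spike[of "{b}"]) (auto simp: g'_def)
  finally show ?thesis using \<open>a \<le> b\<close> by (simp add: mult.commute)
qed

lemma abs_integral_le_const:
  fixes g :: "real \<Rightarrow> real"
  assumes g: "g integrable_on {a..b}" and "a \<le> b" and le: "\<And>s. a \<le> s \<Longrightarrow> s < b \<Longrightarrow> \<bar>g s\<bar> \<le> k"
  shows "\<bar>integral {a..b} g\<bar> \<le> k * (b - a)"
proof -
  have "- k * (b - a) \<le> integral {a..b} g"
    by (rule integral_ge_const[OF g \<open>a \<le> b\<close>]) (use le in force)
  moreover have "- k * (b - a) \<le> integral {a..b} (\<lambda>s. - g s)"
    by (rule integral_ge_const[OF integrable_neg[OF g] \<open>a \<le> b\<close>]) (use le in force)
  ultimately show ?thesis by simp
qed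

text \<open>Provides the Banach space in which a sup-norm continuous curve of functions has an
  integral.\<close>

instance bcontfun :: (metric_space, banach) banach ..

context heat
begin

text \<open>Contraction for data that may be nonzero on the boundary, obtained by applying the
  maximum principle to \<open>f\<close> and \<open>- f\<close>.\<close>

lemma S_abs_le:
  assumes f: "admissible t f" and B: "B \<ge> 0" and le: "\<And>y. y \<in> D \<Longrightarrow> \<bar>f y\<bar> \<le> B" and x: "x \<in> closure D"
  shows "\<bar>S t f x\<bar> \<le> B"
proof -
  have bounds: "f y \<le> B" "- 1 * f y \<le> B" if "y \<in> D" for y
    using le[OF that] by auto
  have "S t f x \<le> B"
    by (rule S_le_const[OF f B bounds(1) x])
  moreover have "S t (\<lambda>y. - 1 * f y) x \<le> B"
    by (rule S_le_const[OF _ B bounds(2) x]) (use admissible_linear[OF f f, of "-1" 0] in simp_all)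
  moreover have "S t (\<lambda>y. - 1 * f y) x = - 1 * S t f x"
    by (rule S_cmult[OF f x])
  ultimately show ?thesis by simp
qed

lemma C0_extension_bcontfun:
  assumes "f \<in> C0 D"
  shows "(\<lambda>x. if x \<in> closure D then f x else 0) \<in> bcontfun"
proof -
  have "continuous_on (closure D \<union> - D) (\<lambda>x. if x \<in> closure D then f x else 0)"
  proof (rule continuous_on_cases)
    show "\<forall>x. x \<in> closure D \<and> \<not> x \<in> closure D \<or> x \<in> - D \<and> x \<in> closure D \<longrightarrow> f x = 0"
      using assms open_dom by (auto simp: C0_def frontier_def interior_open)
  qed (use assms open_dom in \<open>auto simp: C0_def\<close>)
  moreover have "closure D \<union> - D = UNIV" using closure_subset by blast
  moreover obtain B where "B > 0" "\<And>x. x \<in> closure D \<Longrightarrow> \<bar>f x\<bar> \<le> B"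
    using continuous_bounded[OF C0_continuous[OF assms]] by metis
  ultimately show ?thesis by (intro bcontfun_normI[of _ B]) auto
qed

text \<open>Extended by zero, \<open>w\<close> becomes a continuous curve in the space of bounded
  continuous functions. Evaluation at a point and \<open>S h\<close> followed by evaluation are
  bounded linear functionals there, so both commute with its integral. Elements of that space need
  not vanish on the boundary, so \<open>h > 0\<close> is what makes \<open>S h\<close> of them the
  continuous representative.\<close>

lemma S_integral_commute:
  fixes w :: "real \<Rightarrow> 'a \<Rightarrow> real" and b :: real
  defines "G \<equiv> \<lambda>y. integral {0..b} (\<lambda>s. w s y)"
  assumes w: "\<And>s. s \<in> {0..b} \<Longrightarrow> w s \<in> C0 D"
    and cont: "\<And>s e. s \<in> {0..b} \<Longrightarrow> e > 0 \<Longrightarrow>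
      \<forall>\<^sub>F r in at s within {0..b}. \<forall>x\<in>closure D. \<bar>w r x - w s x\<bar> \<le> e"
    and h: "h > 0" and x: "x \<in> closure D"
  shows "G \<in> C0 D" "S h G x = integral {0..b} (\<lambda>s. S h (w s) x)"
proof -
  define W where "W = (\<lambda>s. Bcontfun (\<lambda>x. if x \<in> closure D then w s x else 0))"
  have W: "apply_bcontfun (W s) y = (if y \<in> closure D then w s y else 0)" if "s \<in> {0..b}" for s y
    unfolding W_def by (subst Bcontfun_inverse[OF C0_extension_bcontfun[OF w[OF that]]]) simp
  have "continuous_on {0..b} W"
    unfolding continuous_on_def
  proof (intro ballI tendstoI)
    fix s :: real and e :: real assume s: "s \<in> {0..b}" and "e > 0"
    then have "\<forall>\<^sub>F r in at s within {0..b}. \<forall>x\<in>closure D. \<bar>w r x - w s x\<bar> \<le> e / 2"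
      by (intro cont) auto
    moreover have "\<forall>\<^sub>F r in at s within {0..b}. r \<in> {0..b}"
      by (simp add: eventually_at_filter)
    ultimately show "\<forall>\<^sub>F r in at s within {0..b}. dist (W r) (W s) < e"
    proof eventually_elim
      case (elim r)
      have "dist (W r) (W s) \<le> e / 2"
        by (rule dist_bound) (use elim \<open>e > 0\<close> in \<open>auto simp: W[OF s] W dist_real_def\<close>)
      then show ?case using \<open>e > 0\<close> by simp
    qed
  qed
  then have int: "W integrable_on {0..b}" by (rule integrable_continuous_interval)
  have eval: "bounded_linear (\<lambda>\<phi>. apply_bcontfun \<phi> y)" for y :: 'a
    by (rule bounded_linear_intro[where K=1]) (auto intro: order_trans[OF norm_bounded])
  have G: "G y = apply_bcontfun (integral {0..b} W) y" if "y \<in> closure D" for y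
  proof -
    have "apply_bcontfun (integral {0..b} W) y = integral {0..b} ((\<lambda>\<phi>. apply_bcontfun \<phi> y) \<circ> W)"
      by (rule integral_linear[OF int eval, symmetric])
    also have "\<dots> = G y"
      unfolding G_def by (rule Henstock_Kurzweil_Integration.integral_cong) (simp add: W that)
    finally show ?thesis by simp
  qed
  have cont_W: "continuous_on (closure D) (apply_bcontfun (integral {0..b} W))"
    by (rule continuous_on_apply_bcontfun)
  then have cont_G: "continuous_on (closure D) G"
    by (rule continuous_on_eq) (simp add: G)
  have "G y = 0" if "y \<in> frontier D" for y
  proof -
    have "G y = integral {0..b} (\<lambda>s. 0)"
      unfolding G_def by (rule Henstock_Kurzweil_Integration.integral_cong) (use w that in \<open>auto simp: C0_def\<close>)
    then show ?thesis by simp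
  qed
  with cont_G show "G \<in> C0 D" by (simp add: C0_def)
  have adm: "admissible h (apply_bcontfun \<phi>)" for \<phi> :: "'a \<Rightarrow>\<^sub>C real"
    by (rule admissible_pos[OF continuous_on_apply_bcontfun h])
  have "bounded_linear (\<lambda>\<phi>. S h (apply_bcontfun \<phi>) x)"
  proof (rule bounded_linear_intro[where K=1])
    fix \<phi> \<psi> :: "'a \<Rightarrow>\<^sub>C real" and c :: real
    have "apply_bcontfun (\<phi> + \<psi>) = (\<lambda>y. 1 * apply_bcontfun \<phi> y + 1 * apply_bcontfun \<psi> y)" by auto
    then show "S h (apply_bcontfun (\<phi> + \<psi>)) x = S h (apply_bcontfun \<phi>) x + S h (apply_bcontfun \<psi>) x"
      using S_linear[OF adm adm x, of 1 \<phi> 1 \<psi>] by simp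
    have "apply_bcontfun (c *\<^sub>R \<phi>) = (\<lambda>y. c * apply_bcontfun \<phi> y)" by auto
    then show "S h (apply_bcontfun (c *\<^sub>R \<phi>)) x = c *\<^sub>R S h (apply_bcontfun \<phi>) x"
      using S_cmult[OF adm x, of c \<phi>] by simp
    show "norm (S h (apply_bcontfun \<phi>) x) \<le> norm \<phi> * 1"
      using S_abs_le[OF adm norm_ge_zero _ x, of \<phi> \<phi>] norm_bounded[of \<phi>] by simp
  qed
  from integral_linear[OF int this]
  have "S h (apply_bcontfun (integral {0..b} W)) x = integral {0..b} ((\<lambda>\<phi>. S h (apply_bcontfun \<phi>) x) \<circ> W)"
    by simp
  also have "\<dots> = integral {0..b} (\<lambda>s. S h (w s) x)"
  proof (rule Henstock_Kurzweil_Integration.integral_cong)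
    fix s assume s: "s \<in> {0..b}"
    have "S h (apply_bcontfun (W s)) x = S h (w s) x"
      by (rule S_cong[OF adm admissible_C0[OF w[OF s]] _ x]) (use h in \<open>auto simp: W[OF s] dom_closure\<close>)
    then show "((\<lambda>\<phi>. S h (apply_bcontfun \<phi>) x) \<circ> W) s = S h (w s) x" by simp
  qed
  also have "S h (apply_bcontfun (integral {0..b} W)) x = S h G x"
    by (rule S_cong[OF adm admissible_pos[OF cont_G h] _ x]) (simp add: G dom_closure)
  finally show "S h G x = integral {0..b} (\<lambda>s. S h (w s) x)" .
qed

text \<open>One component of the system, with the nonlinearity regarded as a given source
  \<open>f\<close>. Joint continuity is required up to the boundary, but no boundary values, since
  \<open>F 0\<close> may be nonzero.\<close>

definition mild :: "real \<Rightarrow> (real \<Rightarrow> 'a \<Rightarrow> real) \<Rightarrow> (real \<Rightarrow> 'a \<Rightarrow> real) \<Rightarrow> bool" where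
  "mild \<tau> f u \<longleftrightarrow> (\<forall>t\<in>{0..\<tau>}. u t \<in> C0 D) \<and>
     continuous_on ({0..\<tau>} \<times> closure D) (\<lambda>(s, x). f s x) \<and>
     (\<forall>t\<in>{0..\<tau>}. \<forall>x\<in>closure D. (\<lambda>s. S (t - s) (f s) x) integrable_on {0..t} \<and>
        u t x = S t (u 0) x + integral {0..t} (\<lambda>s. S (t - s) (f s) x))"

context
  fixes \<tau> f u
  assumes mild: "mild \<tau> f u"
begin

lemma mild_C0: "0 \<le> t \<Longrightarrow> t \<le> \<tau> \<Longrightarrow> u t \<in> C0 D"
  and mild_joint: "continuous_on ({0..\<tau>} \<times> closure D) (\<lambda>(s, x). f s x)"
  and mild_integrable: "0 \<le> t \<Longrightarrow> t \<le> \<tau> \<Longrightarrow> x \<in> closure D \<Longrightarrow> (\<lambda>s. S (t - s) (f s) x) integrable_on {0..t}"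
  and mild_formula: "0 \<le> t \<Longrightarrow> t \<le> \<tau> \<Longrightarrow> x \<in> closure D \<Longrightarrow>
    u t x = S t (u 0) x + integral {0..t} (\<lambda>s. S (t - s) (f s) x)"
  using mild by (auto simp: mild_def)

lemma mild_slice: "0 \<le> t \<Longrightarrow> t \<le> \<tau> \<Longrightarrow> continuous_on (closure D) (f t)"
proof -
  assume t: "0 \<le> t" "t \<le> \<tau>"
  have "continuous_on (closure D) (\<lambda>x. (t, x))"
    by (intro continuous_on_Pair continuous_on_const continuous_on_id)
  then show ?thesis
    using continuous_on_compose2[OF mild_joint, of "closure D" "\<lambda>x. (t, x)"] t by fastforce
qed

lemma mild_bounded:
  obtains B where "B \<ge> 0" "\<And>s x. 0 \<le> s \<Longrightarrow> s \<le> \<tau> \<Longrightarrow> x \<in> closure D \<Longrightarrow> \<bar>f s x\<bar> \<le> B"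
proof -
  have "bounded ((\<lambda>(s, x). f s x) ` ({0..\<tau>} \<times> closure D))"
    by (intro compact_imp_bounded compact_continuous_image mild_joint compact_Times compact_closure_dom) auto
  then obtain B where "B > 0" "\<forall>p\<in>{0..\<tau>} \<times> closure D. norm (case p of (s, x) \<Rightarrow> f s x) \<le> B"
    by (auto simp: bounded_pos)
  then show ?thesis by (intro that[of B]) auto
qed

text \<open>At distance at least \<open>eps\<close> from the endpoint, \<open>S (t - s)\<close>
  factors through \<open>S eps\<close>, which maps the source into \<open>C0\<close>; strong
  continuity is available for the result.\<close>

lemma mild_integrand_continuous:
  assumes t: "0 < eps" "t \<le> \<tau>" and s: "s \<in> {0..t - eps}" and e: "e > 0"
  shows "\<forall>\<^sub>F r in at s within {0..t - eps}. \<forall>x\<in>closure D. \<bar>S (t - r) (f r) x - S (t - s) (f s) x\<bar> \<le> e"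
proof -
  define g where "g = S eps (f s)"
  have fs: "continuous_on (closure D) (f s)" using s t by (intro mild_slice) auto
  have g: "g \<in> C0 D" unfolding g_def by (intro S_admissible admissible_pos fs t)
  obtain d1 where d1: "d1 > 0" "\<And>r s x. 0 \<le> r \<Longrightarrow> r \<le> \<tau> \<Longrightarrow> 0 \<le> s \<Longrightarrow> s \<le> \<tau> \<Longrightarrow> \<bar>r - s\<bar> < d1 \<Longrightarrow>
      x \<in> closure D \<Longrightarrow> \<bar>f r x - f s x\<bar> \<le> e / 2"
    using uniformly_continuous_slices[OF mild_joint, of "e / 2"] e by auto
  obtain d2 where d2: "d2 > 0"
    "\<And>r s x. 0 \<le> r \<Longrightarrow> 0 \<le> s \<Longrightarrow> \<bar>r - s\<bar> < d2 \<Longrightarrow> x \<in> closure D \<Longrightarrow> \<bar>S r g x - S s g x\<bar> \<le> e / 2"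
    using S_uniformly_continuous[OF g, of "e / 2"] e by auto
  have "\<bar>S (t - r) (f r) x - S (t - s) (f s) x\<bar> \<le> e"
    if r: "r \<in> {0..t - eps}" "\<bar>r - s\<bar> < d1" "\<bar>r - s\<bar> < d2" and x: "x \<in> closure D" for r x
  proof -
    have adm: "admissible (t - r) (f r)" "admissible (t - r) (f s)" "admissible eps (f s)"
      using r s t by (auto intro!: admissible_pos mild_slice)
    have "\<bar>S (t - r) (\<lambda>y. f r y - f s y) x\<bar> \<le> e / 2"
    proof (rule S_abs_le[OF _ _ _ x])
      show "admissible (t - r) (\<lambda>y. f r y - f s y)"
        using admissible_linear[OF adm(1,2), of 1 "-1"] by simp
      show "\<bar>f r y - f s y\<bar> \<le> e / 2" if "y \<in> D" for y
        using r s t by (intro d1(2) dom_closure[OF that]) auto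
    qed (use e in simp)
    moreover have "S (t - r) (f s) x = S (t - r - eps) g x" "S (t - s) (f s) x = S (t - s - eps) g x"
      using S_add[OF _ adm(3) x, of "t - r - eps"] S_add[OF _ adm(3) x, of "t - s - eps"] r s
      by (auto simp: g_def)
    moreover have "\<bar>S (t - r - eps) g x - S (t - s - eps) g x\<bar> \<le> e / 2"
      using r s by (intro d2(2) x) auto
    ultimately show ?thesis using S_diff[OF adm(1,2) x] by linarith
  qed
  then show ?thesis
    unfolding eventually_at
    by (intro exI[of _ "min d1 d2"]) (use d1(1) d2(1) in \<open>auto simp: dist_real_def\<close>)
qed

text \<open>As \<open>f s\<close> need not vanish on the boundary, the integrand may be discontinuous at \<open>s = t\<close>; one
  commutes \<open>S h\<close> with the integral over \<open>{0..t - eps}\<close> and lets \<open>eps\<close> tend to \<open>0\<close>.\<close>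
lemma mild_S_integral:
  assumes t: "0 \<le> t" "0 < h" "t + h \<le> \<tau>" and x: "x \<in> closure D"
  shows "S h (\<lambda>y. u t y - S t (u 0) y) x = integral {0..t} (\<lambda>s. S (t + h - s) (f s) x)"
proof -
  define J where "J = (\<lambda>y. u t y - S t (u 0) y)"
  define A where "A = integral {0..t} (\<lambda>s. S (t + h - s) (f s) x)"
  have u: "u 0 \<in> C0 D" "u t \<in> C0 D" using t by (auto intro: mild_C0)
  have J: "J \<in> C0 D" unfolding J_def using t by (intro C0_diff u S_C0)
  have J_eq: "J y = integral {0..t} (\<lambda>s. S (t - s) (f s) y)" if "y \<in> closure D" for y
    using mild_formula[of t y] that t by (simp add: J_def)
  have J_int: "(\<lambda>s. S (t - s) (f s) y) integrable_on {0..t}" if "y \<in> closure D" for y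
    using that t by (intro mild_integrable) auto
  have A_int: "(\<lambda>s. S (t + h - s) (f s) x) integrable_on {0..t}"
    by (rule integrable_subinterval_real[OF mild_integrable[of "t + h"]]) (use t x in auto)
  obtain B where B: "B \<ge> 0" "\<And>s x. 0 \<le> s \<Longrightarrow> s \<le> \<tau> \<Longrightarrow> x \<in> closure D \<Longrightarrow> \<bar>f s x\<bar> \<le> B"
    using mild_bounded by blast
  have Sf: "\<bar>S r (f s) y\<bar> \<le> B" if "0 < r" "0 \<le> s" "s \<le> \<tau>" "y \<in> closure D" for r s y
    by (rule S_abs_le[OF admissible_pos[OF mild_slice] B(1) B(2)]) (use that in \<open>auto intro: dom_closure\<close>)
  \<comment> \<open>Cutting off the last interval of length \<open>eps\<close> costs at most
    \<open>B * eps\<close> in \<open>J\<close>, which \<open>S h\<close> does not enlarge, and the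
    same amount in \<open>A\<close>.\<close>
  have main: "\<bar>S h J x - A\<bar> \<le> 2 * (B * eps)" if eps: "0 < eps" "eps < t" for eps
  proof -
    define b where "b = t - eps"
    have b: "0 \<le> b" "b \<le> t" "t - b = eps" using eps by (auto simp: b_def)
    define w where "w = (\<lambda>s. S (t - s) (f s))"
    define G where "G = (\<lambda>y. integral {0..b} (\<lambda>s. w s y))"
    have wC: "w s \<in> C0 D" if "s \<in> {0..b}" for s
      unfolding w_def using that eps t by (intro S_admissible admissible_pos mild_slice) (auto simp: b_def)
    have wcont: "\<forall>\<^sub>F r in at s within {0..b}. \<forall>x\<in>closure D. \<bar>w r x - w s x\<bar> \<le> e"
      if "s \<in> {0..b}" "e > 0" for s e
      unfolding w_def b_def using mild_integrand_continuous[of eps t s e] that eps t by (auto simp: b_def)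
    note comm = S_integral_commute[OF wC wcont t(2) x, folded G_def]
    have G: "G \<in> C0 D" by (rule comm(1))
    have "\<bar>J y - G y\<bar> \<le> B * eps" if y: "y \<in> closure D" for y
    proof -
      have "integral {0..b} (\<lambda>s. w s y) + integral {b..t} (\<lambda>s. w s y) = integral {0..t} (\<lambda>s. w s y)"
        by (rule Henstock_Kurzweil_Integration.integral_combine) (use b J_int[OF y] in \<open>auto simp: w_def\<close>)
      then have "J y - G y = integral {b..t} (\<lambda>s. w s y)"
        by (simp add: J_eq[OF y] G_def w_def)
      moreover have "\<bar>integral {b..t} (\<lambda>s. w s y)\<bar> \<le> B * (t - b)"
      proof (rule abs_integral_le_const)
        show "(\<lambda>s. w s y) integrable_on {b..t}"
          by (rule integrable_subinterval_real[of _ 0 t]) (use b J_int[OF y] in \<open>auto simp: w_def\<close>)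
        show "\<bar>w s y\<bar> \<le> B" if "b \<le> s" "s < t" for s
          unfolding w_def using that b t y by (intro Sf) auto
      qed (rule b)
      ultimately show ?thesis by (simp add: b(3))
    qed
    then have "\<bar>S h (\<lambda>y. J y - G y) x\<bar> \<le> B * eps"
      using t by (intro S_contraction C0_diff J G x) auto
    then have 1: "\<bar>S h J x - S h G x\<bar> \<le> B * eps"
      using S_diff[OF admissible_C0[OF J] admissible_C0[OF G] x, of h] t by simp
    have "S h G x = integral {0..b} (\<lambda>s. S h (w s) x)" by (rule comm(2))
    also have "\<dots> = integral {0..b} (\<lambda>s. S (t + h - s) (f s) x)"
    proof (rule Henstock_Kurzweil_Integration.integral_cong)
      fix s assume s: "s \<in> {0..b}"
      have "admissible (t - s) (f s)"
        using s eps t by (intro admissible_pos mild_slice) (auto simp: b_def)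
      from S_add[OF _ this x, of h] t show "S h (w s) x = S (t + h - s) (f s) x"
        by (simp add: w_def add_diff_eq add.commute)
    qed
    finally have G_eq: "S h G x = integral {0..b} (\<lambda>s. S (t + h - s) (f s) x)" .
    have "integral {0..b} (\<lambda>s. S (t + h - s) (f s) x) + integral {b..t} (\<lambda>s. S (t + h - s) (f s) x) = A"
      unfolding A_def by (rule Henstock_Kurzweil_Integration.integral_combine) (use b A_int in auto)
    moreover have "\<bar>integral {b..t} (\<lambda>s. S (t + h - s) (f s) x)\<bar> \<le> B * (t - b)"
    proof (rule abs_integral_le_const)
      show "(\<lambda>s. S (t + h - s) (f s) x) integrable_on {b..t}"
        by (rule integrable_subinterval_real[OF A_int]) (use b in auto)
      show "\<bar>S (t + h - s) (f s) x\<bar> \<le> B" if "b \<le> s" "s < t" for s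
        using that b t x by (intro Sf) auto
    qed (rule b)
    ultimately show ?thesis using 1 G_eq by (simp add: b(3))
  qed
  have "\<bar>S h J x - A\<bar> \<le> 0"
  proof (cases "t = 0")
    case True
    have "\<bar>S h J x\<bar> \<le> 0"
      using t True by (intro S_contraction J x) (auto simp: J_eq)
    then show ?thesis using True by (simp add: A_def)
  next
    case False
    then have "t > 0" using t by simp
    show ?thesis
    proof (rule field_le_epsilon)
      fix e :: real assume "e > 0"
      \<comment> \<open>Chosen so that \<open>2 * (B * eps) \<le> e\<close>; \<open>B + 1\<close>
        avoids division by zero.\<close>
      define eps where "eps = min (t / 2) (e / (2 * (B + 1)))"
      have eps: "0 < eps" "eps < t" "eps \<le> e / (2 * (B + 1))"
        using \<open>t > 0\<close> \<open>e > 0\<close> B(1) unfolding eps_def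
        by (auto simp: min_less_iff_disj)
      have "2 * (B * eps) \<le> 2 * ((B + 1) * (e / (2 * (B + 1))))"
        using eps B(1) by (intro mult_left_mono mult_mono) auto
      also have "\<dots> = e" using B(1) by (simp add: field_simps)
      finally show "\<bar>S h J x - A\<bar> \<le> 0 + e" using main[OF eps(1,2)] by simp
    qed
  qed
  then show ?thesis by (simp add: J_def A_def)
qed

text \<open>Split the integral at \<open>t\<close>. The part before \<open>t\<close> is
  \<open>S h\<close> applied to the integral term at time \<open>t\<close>, by
  \<open>mild_S_integral\<close>; the part after \<open>t\<close> is shifted to start at 0.\<close>

lemma mild_restart:
  assumes t: "0 \<le> t" "0 < h" "t + h \<le> \<tau>" and x: "x \<in> closure D"
  shows "(\<lambda>s. S (h - s) (f (t + s)) x) integrable_on {0..h}"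
    and "u (t + h) x = S h (u t) x + integral {0..h} (\<lambda>s. S (h - s) (f (t + s)) x)"
proof -
  define g where "g = (\<lambda>s. S (t + h - s) (f s) x)"
  have g: "g integrable_on {0..t + h}"
    unfolding g_def using t x by (intro mild_integrable) auto
  have "g integrable_on {t..t + h}"
    by (rule integrable_subinterval_real[OF g]) (use t in auto)
  then have "(g has_integral integral {t..t + h} g) {0 + t..h + t}"
    by (simp add: add.commute integrable_integral)
  then have shift: "((\<lambda>s. S (h - s) (f (t + s)) x) has_integral integral {t..t + h} g) {0..h}"
    unfolding has_integral_shift_Icc_real[symmetric] by (simp add: g_def o_def)
  then show "(\<lambda>s. S (h - s) (f (t + s)) x) integrable_on {0..h}" by blast
  have u: "u 0 \<in> C0 D" "u t \<in> C0 D" using t by (auto intro: mild_C0)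
  have St: "S t (u 0) \<in> C0 D" using t u by (intro S_C0)
  have h: "0 \<le> h" using t by simp
  have "u (t + h) x = S (t + h) (u 0) x + integral {0..t + h} g"
    unfolding g_def using t x by (intro mild_formula) auto
  also have "integral {0..t + h} g = integral {0..t} g + integral {t..t + h} g"
    by (rule Henstock_Kurzweil_Integration.integral_combine[symmetric]) (use t g in auto)
  also have "integral {0..t} g = S h (u t) x - S h (S t (u 0)) x"
    unfolding g_def using mild_S_integral[OF t x] S_diff[OF admissible_C0[OF u(2) h] admissible_C0[OF St h] x] by simp
  also have "S (t + h) (u 0) x = S h (S t (u 0)) x"
    using S_add[OF h admissible_C0[OF u(1) t(1)] x] by (simp add: add.commute)
  also have "integral {t..t + h} g = integral {0..h} (\<lambda>s. S (h - s) (f (t + s)) x)"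
    using shift by (simp add: integral_unique)
  finally show "u (t + h) x = S h (u t) x + integral {0..h} (\<lambda>s. S (h - s) (f (t + s)) x)" by simp
qed

text \<open>For short steps the source may be frozen at time \<open>t\<close>, and
  \<open>S (h - s) (u t)\<close> may be replaced by \<open>S h (u t)\<close>, both uniformly in
  space. Integrating the resulting lower bound over a step of length \<open>h\<close> gives the
  estimate.\<close>

lemma mild_lower_bound:
  assumes t: "0 \<le> t" "t < \<tau>" and l: "0 \<le> l" and c: "0 \<le> c" and e: "0 < e"
    and le: "\<And>y. y \<in> D \<Longrightarrow> - l * u t y - c \<le> f t y"
  shows "\<forall>\<^sub>F h in at_right 0. t + h \<le> \<tau> \<longrightarrow>
    (\<forall>x\<in>closure D. (1 - l * h) * S h (u t) x - h * (c + e) \<le> u (t + h) x)"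
proof -
  \<comment> \<open>Freezing the source costs \<open>e1\<close>, replacing \<open>S (h - s)\<close>
    by \<open>S h\<close> costs \<open>l * e1\<close>; together this is \<open>e\<close>.\<close>
  define e1 where "e1 = e / (1 + l)"
  have e1: "e1 > 0" "l * e1 + e1 = e"
  proof -
    have "(1 + l) * e1 = e" using l by (simp add: e1_def)
    then show "l * e1 + e1 = e" by (simp add: algebra_simps)
  qed (use e l in \<open>simp add: e1_def\<close>)
  have ut: "u t \<in> C0 D" using t by (intro mild_C0) auto
  obtain d1 where d1: "d1 > 0" "\<And>r s x. 0 \<le> r \<Longrightarrow> r \<le> \<tau> \<Longrightarrow> 0 \<le> s \<Longrightarrow> s \<le> \<tau> \<Longrightarrow> \<bar>r - s\<bar> < d1 \<Longrightarrow>
      x \<in> closure D \<Longrightarrow> \<bar>f r x - f s x\<bar> \<le> e1"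
    using uniformly_continuous_slices[OF mild_joint e1(1)] by auto
  obtain d2 where d2: "d2 > 0"
    "\<And>r s x. 0 \<le> r \<Longrightarrow> 0 \<le> s \<Longrightarrow> \<bar>r - s\<bar> < d2 \<Longrightarrow> x \<in> closure D \<Longrightarrow> \<bar>S r (u t) x - S s (u t) x\<bar> \<le> e1"
    using S_uniformly_continuous[OF ut e1(1)] by auto
  have "(1 - l * h) * S h (u t) x - h * (c + e) \<le> u (t + h) x"
    if h: "0 < h" "h < d1" "h < d2" "t + h \<le> \<tau>" and x: "x \<in> closure D" for h x
  proof -
    note restart = mild_restart[OF t(1) h(1,4) x]
    have "- l * S h (u t) x - (c + e) \<le> S (h - s) (f (t + s)) x" if s: "0 \<le> s" "s < h" for s
    proof -
      have adm: "admissible (h - s) (f (t + s))" "admissible (h - s) (u t)"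
        using s h t by (auto intro!: admissible_pos mild_slice C0_continuous[OF ut])
      have "S (h - s) (\<lambda>y. - l * u t y) x \<le> S (h - s) (f (t + s)) x + (c + e1)"
      proof (rule S_mono_const[OF _ adm(1) _ _ x])
        show "admissible (h - s) (\<lambda>y. - l * u t y)"
          using admissible_linear[OF adm(2,2), of "- l" 0] by simp
        fix y assume y: "y \<in> D"
        have "\<bar>f (t + s) y - f t y\<bar> \<le> e1"
          using s h t by (intro d1(2) dom_closure[OF y]) auto
        with le[OF y] show "- l * u t y \<le> f (t + s) y + (c + e1)" by linarith
      qed (use c e1 in simp)
      moreover have "S (h - s) (\<lambda>y. - l * u t y) x = - l * S (h - s) (u t) x"
        by (rule S_cmult[OF adm(2) x])
      moreover have "l * S (h - s) (u t) x \<le> l * (S h (u t) x + e1)"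
        using d2(2)[of "h - s" h x] s h x l by (intro mult_left_mono) auto
      ultimately show ?thesis using e1(2) by (simp add: algebra_simps)
    qed
    from integral_ge_const[OF restart(1) less_imp_le[OF h(1)] this]
    have "(- l * S h (u t) x - (c + e)) * h \<le> integral {0..h} (\<lambda>s. S (h - s) (f (t + s)) x)"
      by simp
    then show ?thesis unfolding restart(2) by (simp add: algebra_simps)
  qed
  then show ?thesis
    unfolding eventually_at_right_field
    by (intro exI[of _ "min d1 d2"]) (use d1(1) d2(1) in auto)
qed

end

end

text \<open>\<open>v\<close> is the positive part of \<open>u\<close>, and \<open>w\<close> has its
  component \<open>i\<close> set to 0 as well, so that quasi-positivity applies at \<open>w\<close>.
  Going from \<open>w\<close> to \<open>v\<close> costs \<open>L * (u $ i + b)\<close>, going from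
  \<open>v\<close> to \<open>u\<close> costs \<open>L * CARD('n) * b\<close>. Neither point leaves
  the ball, because truncation does not increase the norm.\<close>

lemma quasi_positive_lower_bound:
  fixes F :: "real^'n \<Rightarrow> real^'n"
  assumes qp: "quasi_positive F" and L: "L-lipschitz_on (cball 0 R) F"
    and u: "norm u \<le> R" and b: "b \<ge> 0" "\<And>j. - b \<le> u $ j"
  shows "- L * u $ i - L * (1 + real CARD('n)) * b \<le> F u $ i"
proof -
  define v where "v = (\<chi> j. max 0 (u $ j))"
  define w where "w = (\<chi> j. if j = i then 0 else max 0 (u $ j))"
  have L0: "L \<ge> 0" using L by (rule lipschitz_on_nonneg)
  have vw: "norm v \<le> norm u" "norm w \<le> norm u"
    by (rule norm_le_componentwise_cart; auto simp: v_def w_def)+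
  have lip: "\<bar>F p $ i - F q $ i\<bar> \<le> L * norm (p - q)" if "norm p \<le> R" "norm q \<le> R" for p q
  proof -
    have "\<bar>F p $ i - F q $ i\<bar> \<le> norm (F p - F q)"
      using component_le_norm_cart[of "F p - F q" i] by simp
    also have "\<dots> \<le> L * norm (p - q)"
      using lipschitz_onD[OF L, of p q] that by (simp add: dist_norm)
    finally show ?thesis .
  qed
  have "0 \<le> F w $ i"
    using qp unfolding quasi_positive_def w_def by auto
  moreover have "norm (v - w) \<le> max 0 (u $ i)"
  proof -
    have "norm (v - w) \<le> (\<Sum>j\<in>UNIV. \<bar>(v - w) $ j\<bar>)" by (rule norm_le_l1_cart)
    also have "\<dots> = (\<Sum>j\<in>UNIV. if j = i then max 0 (u $ i) else 0)"
      by (rule sum.cong) (auto simp: v_def w_def)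
    finally show ?thesis by simp
  qed
  then have "L * norm (v - w) \<le> L * (u $ i + b)"
    using b(1) b(2)[of i] L0 by (intro mult_left_mono) auto
  moreover have "norm (u - v) \<le> real CARD('n) * b"
  proof -
    have "norm (u - v) \<le> (\<Sum>j\<in>UNIV. \<bar>(u - v) $ j\<bar>)" by (rule norm_le_l1_cart)
    also have "\<dots> \<le> (\<Sum>j\<in>(UNIV::'n set). b)"
    proof (rule sum_mono)
      fix j show "\<bar>(u - v) $ j\<bar> \<le> b" using b(1) b(2)[of j] by (simp add: v_def max_def)
    qed
    finally show ?thesis by simp
  qed
  then have "L * norm (u - v) \<le> L * (real CARD('n) * b)"
    using L0 by (rule mult_left_mono)
  moreover have "\<bar>F u $ i - F v $ i\<bar> \<le> L * norm (u - v)" "\<bar>F v $ i - F w $ i\<bar> \<le> L * norm (v - w)"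
    using u vw by (auto intro!: lip)
  ultimately show ?thesis by (simp add: algebra_simps)
qed

lemma locally_lipschitz_on_cball:
  fixes F :: "real^'n \<Rightarrow> real^'n"
  assumes "locally_lipschitz F"
  obtains L where "L-lipschitz_on (cball 0 R) F"
proof -
  \<comment> \<open>The one-point time set is a dummy parameter; compactness of the ball turns the
    local constants into a single one.\<close>
  have "local_lipschitz {0::real} (cball 0 R) (\<lambda>_. F)"
  proof (rule local_lipschitzI)
    fix t :: real and x :: "real^'n"
    obtain r L where "r > 0" "L-lipschitz_on (cball x r) F"
      using assms unfolding locally_lipschitz_def by blast
    then show "\<exists>u>0. \<exists>L. \<forall>t\<in>cball t u \<inter> {0}. L-lipschitz_on (cball x u \<inter> cball 0 R) F"
      by (intro exI[of _ r] conjI exI[of _ L]) (auto intro: lipschitz_on_subset)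
  qed
  from local_lipschitz_compact_implies_lipschitz[OF this]
  show ?thesis using that by auto
qed

section \<open>Positivity of trajectories\<close>

lemma left_limit_le:
  fixes \<phi> \<psi> :: "real \<Rightarrow> real"
  assumes "continuous_on {0..\<tau>} \<phi>" "continuous_on {0..\<tau>} \<psi>" and t: "0 < t" "t \<le> \<tau>"
    and le: "\<And>s. 0 \<le> s \<Longrightarrow> s < t \<Longrightarrow> \<psi> s \<le> \<phi> s"
  shows "\<psi> t \<le> \<phi> t"
proof -
  have nt: "at t within {0..<t} \<noteq> bot" using t by (simp add: at_within_eq_bot_iff)
  have "(\<phi> \<longlongrightarrow> \<phi> t) (at t within {0..\<tau>})" "(\<psi> \<longlongrightarrow> \<psi> t) (at t within {0..\<tau>})"
    using assms by (auto simp: continuous_on_def)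
  then have "(\<phi> \<longlongrightarrow> \<phi> t) (at t within {0..<t})" "(\<psi> \<longlongrightarrow> \<psi> t) (at t within {0..<t})"
    using t by (auto elim!: tendsto_within_subset)
  moreover have "\<forall>\<^sub>F s in at t within {0..<t}. \<psi> s \<le> \<phi> s"
    using le by (auto simp: eventually_at_filter)
  ultimately show ?thesis using tendsto_le[OF nt] by blast
qed

lemma (in heat) S_continuous_time:
  assumes "f \<in> C0 D" "x \<in> closure D"
  shows "continuous_on {0..\<tau>} (\<lambda>t. S t f x)"
  unfolding continuous_on_iff
proof (intro ballI allI impI)
  fix t e :: real assume t: "t \<in> {0..\<tau>}" and "e > 0"
  then obtain d where d: "d > 0"
    "\<And>r s x. 0 \<le> r \<Longrightarrow> 0 \<le> s \<Longrightarrow> \<bar>r - s\<bar> < d \<Longrightarrow> x \<in> closure D \<Longrightarrow> \<bar>S r f x - S s f x\<bar> \<le> e / 2"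
    using S_uniformly_continuous[OF assms(1), of "e / 2"] by auto
  have "\<bar>S r f x - S t f x\<bar> < e" if "r \<in> {0..\<tau>}" "\<bar>r - t\<bar> < d" for r
    using d(2)[of r t x] that t assms(2) \<open>e > 0\<close> by auto
  then show "\<exists>d>0. \<forall>r\<in>{0..\<tau>}. dist r t < d \<longrightarrow> dist (S r f x) (S t f x) < e"
    using d(1) by (auto simp: dist_real_def)
qed

text \<open>A trajectory restricted to a compact time interval, with one bound and one Lipschitz
  constant. Conclusions are drawn at the endpoint \<open>\<tau>\<close>; other times are covered by
  other instances.\<close>

locale bounded_trajectory =
  fixes D :: "(real^'d) set" and \<kappa> :: "'n::finite \<Rightarrow> real"
    and S :: "'n \<Rightarrow> real \<Rightarrow> (real^'d \<Rightarrow> real) \<Rightarrow> real^'d \<Rightarrow> real"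
    and F :: "real^'n \<Rightarrow> real^'n" and U :: "real \<Rightarrow> real^'d \<Rightarrow> real^'n" and \<tau> R L :: real
  assumes heat: "heat D (\<kappa> i) (S i)"
    and mild: "heat.mild D (S i) \<tau> (\<lambda>s y. F (U s y) $ i) (\<lambda>s y. U s y $ i)"
    and tau_nonneg: "0 \<le> \<tau>"
    and quasi_positive: "quasi_positive F"
    and lipschitz: "L-lipschitz_on (cball 0 R) F"
    and bounded: "0 \<le> s \<Longrightarrow> s \<le> \<tau> \<Longrightarrow> y \<in> closure D \<Longrightarrow> norm (U s y) \<le> R"
    and continuous: "y \<in> closure D \<Longrightarrow> continuous_on {0..\<tau>} (\<lambda>s. U s y)"
    and initial: "y \<in> D \<Longrightarrow> 0 \<le> U 0 y $ i"
begin

lemma L_nonneg: "0 \<le> L"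
  using lipschitz by (rule lipschitz_on_nonneg)

lemma U_C0: "0 \<le> t \<Longrightarrow> t \<le> \<tau> \<Longrightarrow> (\<lambda>y. U t y $ i) \<in> C0 D"
  by (rule heat.mild_C0[OF heat mild])

lemma initial_closure: "y \<in> closure D \<Longrightarrow> 0 \<le> U 0 y $ i"
proof (cases "y \<in> D")
  case False
  assume "y \<in> closure D"
  then have "y \<in> frontier D"
    using False heat.open_dom[OF heat] by (simp add: frontier_def interior_open)
  then show ?thesis using U_C0[of 0 i] tau_nonneg by (simp add: C0_def)
qed (rule initial)

lemma lower_bound_step:
  assumes t: "0 \<le> t" "t < \<tau>" and b: "b \<ge> 0" and e: "e > 0"
    and ge: "\<And>j y. y \<in> closure D \<Longrightarrow> - b \<le> U t y $ j"
  shows "\<forall>\<^sub>F h in at_right 0. t + h \<le> \<tau> \<longrightarrow>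
    (\<forall>x\<in>closure D. (1 - L * h) * S i h (\<lambda>y. U t y $ i) x - h * (L * (1 + real CARD('n)) * b + e) \<le> U (t + h) x $ i)"
proof (rule heat.mild_lower_bound[OF heat mild t L_nonneg _ e])
  show "0 \<le> L * (1 + real CARD('n)) * b" using L_nonneg b by simp
  fix y assume "y \<in> D"
  then have y: "y \<in> closure D" using closure_subset by blast
  show "- L * U t y $ i - L * (1 + real CARD('n)) * b \<le> F (U t y) $ i"
    by (rule quasi_positive_lower_bound[OF quasi_positive lipschitz bounded[OF _ _ y] b ge[OF y]]) (use t in auto)
qed

text \<open>The rate \<open>C + 1\<close> leaves room for the error: with slack \<open>b t\<close>,
  one step lowers the bound by at most \<open>h * (C + 1) * b t\<close>, and
  \<open>1 + (C + 1) * h \<le> exp ((C + 1) * h)\<close>. All components are treated together, since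
  the estimate for one of them uses the lower bound \<open>- b t\<close> for each.\<close>

lemma almost_nonneg:
  assumes \<eta>: "\<eta> > 0"
  shows "\<forall>i. \<forall>x\<in>closure D. - \<eta> * exp ((L * (1 + real CARD('n)) + 1) * \<tau>) \<le> U \<tau> x $ i"
proof -
  define C where "C = L * (1 + real CARD('n))"
  define b where "b = (\<lambda>t. \<eta> * exp ((C + 1) * t))"
  have C: "C \<ge> 0" using L_nonneg by (simp add: C_def)
  have b: "b t > 0" for t using \<eta> by (simp add: b_def)
  have "\<forall>i. \<forall>x\<in>closure D. - b \<tau> \<le> U \<tau> x $ i"
  proof (rule real_step_induct[OF tau_nonneg, of "\<lambda>t. \<forall>i. \<forall>x\<in>closure D. - b t \<le> U t x $ i"])
    show "\<forall>i. \<forall>x\<in>closure D. - b 0 \<le> U 0 x $ i"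
      using initial_closure b[of 0] by (meson le_minus_iff less_imp_le neg_le_0_iff_le order_trans)
  next
    fix t assume t: "0 < t" "t \<le> \<tau>"
      and IH: "\<And>s. 0 \<le> s \<Longrightarrow> s < t \<Longrightarrow> \<forall>i. \<forall>x\<in>closure D. - b s \<le> U s x $ i"
    show "\<forall>i. \<forall>x\<in>closure D. - b t \<le> U t x $ i"
    proof (intro allI ballI)
      fix i x assume x: "x \<in> closure D"
      show "- b t \<le> U t x $ i"
        by (rule left_limit_le[OF _ _ t])
          (use IH x in \<open>auto simp: b_def intro!: continuous_intros continuous\<close>)
    qed
  next
    fix t assume t: "0 \<le> t" "t < \<tau>" and IH: "\<forall>i. \<forall>x\<in>closure D. - b t \<le> U t x $ i"
    have "\<forall>\<^sub>F h in at_right 0. t + h \<le> \<tau> \<longrightarrow> (\<forall>x\<in>closure D. - b (t + h) \<le> U (t + h) x $ i)" for i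
    proof -
      have "\<forall>\<^sub>F h in at_right 0. t + h \<le> \<tau> \<longrightarrow>
          (\<forall>x\<in>closure D. (1 - L * h) * S i h (\<lambda>y. U t y $ i) x - h * (C * b t + b t) \<le> U (t + h) x $ i)"
        unfolding C_def by (rule lower_bound_step[OF t]) (use b[of t] IH in auto)
      moreover have "\<forall>\<^sub>F h in at_right 0. h < 1 / (L + 1)"
        by (rule order_tendstoD(2)[OF tendsto_ident_at]) (use L_nonneg in simp)
      ultimately show ?thesis
        using eventually_at_right_less[of 0]
      proof eventually_elim
        case (elim h)
        have "L * h \<le> (L + 1) * h" using elim by simp
        also have "\<dots> \<le> (L + 1) * (1 / (L + 1))" using elim L_nonneg by (intro mult_left_mono) auto
        finally have Lh: "0 \<le> L * h" "L * h \<le> 1" using elim L_nonneg by auto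
        show ?case
        proof (intro impI ballI)
          fix x assume le_tau: "t + h \<le> \<tau>" and x: "x \<in> closure D"
          have adm: "heat.admissible D h (\<lambda>y. U t y $ i)"
            using t elim by (intro heat.admissible_C0[OF heat] U_C0) auto
          \<comment> \<open>The zero function is written as a multiple of \<open>U t y $ i\<close>
            so that linearity evaluates the semigroup on it.\<close>
          have adm0: "heat.admissible D h (\<lambda>y. 0 * U t y $ i)"
            using heat.admissible_linear[OF heat adm adm, where a=0 and b=0] by simp
          have "S i h (\<lambda>y. 0 * U t y $ i) x \<le> S i h (\<lambda>y. U t y $ i) x + b t"
          proof (rule heat.S_mono_const[OF heat adm0 adm less_imp_le[OF b] _ x])
            fix y assume "y \<in> D"
            then have "- b t \<le> U t y $ i" using IH closure_subset by blast
            then show "0 * U t y $ i \<le> U t y $ i + b t" by simp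
          qed
          then have "- b t \<le> S i h (\<lambda>y. U t y $ i) x"
            using heat.S_cmult[OF heat adm x, where a=0] by simp
          then have "(1 - L * h) * (- b t) \<le> (1 - L * h) * S i h (\<lambda>y. U t y $ i) x"
            using Lh by (intro mult_left_mono) auto
          \<comment> \<open>Shrinking a negative bound by the factor \<open>1 - L * h\<close> can
            only raise it.\<close>
          moreover have "- b t \<le> (1 - L * h) * (- b t)"
            using mult_nonneg_nonneg[OF Lh(1) less_imp_le[OF b]] by (simp add: algebra_simps)
          ultimately have "- b t - h * (C * b t + b t) \<le> U (t + h) x $ i"
            using elim le_tau x by fastforce
          moreover have "b t * (1 + (C + 1) * h) \<le> b t * exp ((C + 1) * h)"
            using b[of t] exp_ge_add_one_self by (intro mult_left_mono) auto
          moreover have "b t * exp ((C + 1) * h) = b (t + h)"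
            by (simp add: b_def distrib_left exp_add)
          ultimately show "- b (t + h) \<le> U (t + h) x $ i"
            by (simp add: algebra_simps)
        qed
      qed
    qed
    then have "\<forall>\<^sub>F h in at_right 0. \<forall>i. t + h \<le> \<tau> \<longrightarrow> (\<forall>x\<in>closure D. - b (t + h) \<le> U (t + h) x $ i)"
      by (rule eventually_all_finite)
    then show "\<forall>\<^sub>F h in at_right 0. t + h \<le> \<tau> \<longrightarrow> (\<forall>i. \<forall>x\<in>closure D. - b (t + h) \<le> U (t + h) x $ i)"
      by eventually_elim blast
  qed
  then show ?thesis by (simp add: b_def C_def)
qed

lemma nonneg:
  assumes x: "x \<in> closure D"
  shows "0 \<le> U \<tau> x $ i"
proof (rule field_le_epsilon)
  fix e :: real assume "e > 0"
  define E where "E = exp ((L * (1 + real CARD('n)) + 1) * \<tau>)"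
  have "E > 0" by (simp add: E_def)
  then have "- (e / E) * E \<le> U \<tau> x $ i"
    unfolding E_def using \<open>e > 0\<close> x by (intro almost_nonneg[rule_format]) auto
  then show "0 \<le> U \<tau> x $ i + e" using \<open>E > 0\<close> by simp
qed

text \<open>With nonnegativity at all times up to \<open>\<tau>\<close>, the one-step estimate holds
  with \<open>b = 0\<close>, leaving only the damping \<open>1 - L * h\<close> and an arbitrary
  error rate \<open>e\<close>. The induction keeps the accumulated error \<open>e * t\<close>, and
  \<open>e\<close> is removed last.\<close>

lemma lower_bound_S:
  assumes nonneg: "\<And>s y i. 0 \<le> s \<Longrightarrow> s \<le> \<tau> \<Longrightarrow> y \<in> closure D \<Longrightarrow> 0 \<le> U s y $ i" and x: "x \<in> closure D"
  shows "exp (- 2 * L * \<tau>) * S j \<tau> (\<lambda>y. U 0 y $ j) x \<le> U \<tau> x $ j"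
proof -
  define g where "g = (\<lambda>y. U 0 y $ j)"
  have g: "g \<in> C0 D" unfolding g_def using tau_nonneg by (intro U_C0) auto
  have claim: "\<forall>x\<in>closure D. exp (- 2 * L * \<tau>) * S j \<tau> g x - e * \<tau> \<le> U \<tau> x $ j" if e: "e > 0" for e
  proof (rule real_step_induct[OF tau_nonneg, of "\<lambda>t. \<forall>x\<in>closure D. exp (- 2 * L * t) * S j t g x - e * t \<le> U t x $ j"])
    show "\<forall>x\<in>closure D. exp (- 2 * L * 0) * S j 0 g x - e * 0 \<le> U 0 x $ j"
      using heat.S_zero[OF heat g] by (simp add: g_def)
  next
    fix t assume t: "0 < t" "t \<le> \<tau>"
      and IH: "\<And>s. 0 \<le> s \<Longrightarrow> s < t \<Longrightarrow> \<forall>x\<in>closure D. exp (- 2 * L * s) * S j s g x - e * s \<le> U s x $ j"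
    show "\<forall>x\<in>closure D. exp (- 2 * L * t) * S j t g x - e * t \<le> U t x $ j"
    proof
      fix x assume x: "x \<in> closure D"
      show "exp (- 2 * L * t) * S j t g x - e * t \<le> U t x $ j"
        by (rule left_limit_le[OF _ _ t])
          (use IH x in \<open>auto intro!: continuous_intros continuous heat.S_continuous_time[OF heat g]\<close>)
    qed
  next
    fix t assume t: "0 \<le> t" "t < \<tau>"
      and IH: "\<forall>x\<in>closure D. exp (- 2 * L * t) * S j t g x - e * t \<le> U t x $ j"
    have "\<forall>\<^sub>F h in at_right 0. t + h \<le> \<tau> \<longrightarrow>
        (\<forall>x\<in>closure D. (1 - L * h) * S j h (\<lambda>y. U t y $ j) x - h * (L * (1 + real CARD('n)) * 0 + e) \<le> U (t + h) x $ j)"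
      by (rule lower_bound_step[OF t]) (use nonneg t e in auto)
    moreover have "\<forall>\<^sub>F h in at_right 0. h < 1 / (2 * (L + 1))"
      by (rule order_tendstoD(2)[OF tendsto_ident_at]) (use L_nonneg in simp)
    ultimately show "\<forall>\<^sub>F h in at_right 0. t + h \<le> \<tau> \<longrightarrow>
        (\<forall>x\<in>closure D. exp (- 2 * L * (t + h)) * S j (t + h) g x - e * (t + h) \<le> U (t + h) x $ j)"
      using eventually_at_right_less[of 0]
    proof eventually_elim
      case (elim h)
      have "L * h \<le> (L + 1) * h" using elim by simp
      also have "\<dots> \<le> (L + 1) * (1 / (2 * (L + 1)))" using elim L_nonneg by (intro mult_left_mono) auto
      also have "\<dots> = 1 / 2" using L_nonneg by (simp add: field_simps)
      finally have Lh: "0 \<le> L * h" "L * h \<le> 1 / 2" using elim L_nonneg by auto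
      \<comment> \<open>This is where the factor 2 in the exponent comes from:
        \<open>(1 + 2 * q) * (1 - q) \<ge> 1\<close> for \<open>q\<close> between 0 and
        \<open>1 / 2\<close>.\<close>
      have exp_le: "exp (- 2 * L * h) \<le> 1 - L * h"
      proof -
        have "(L * h) * (L * h) \<le> 1 / 2 * (L * h)" using Lh by (intro mult_right_mono) auto
        then have "1 \<le> (1 + 2 * (L * h)) * (1 - L * h)" by (simp add: algebra_simps)
        also have "\<dots> \<le> exp (2 * (L * h)) * (1 - L * h)"
          using Lh exp_ge_add_one_self[of "2 * (L * h)"] by (intro mult_right_mono) auto
        finally show ?thesis by (simp add: exp_minus field_simps)
      qed
      show ?case
      proof (intro impI ballI)
        fix x assume le_tau: "t + h \<le> \<tau>" and x: "x \<in> closure D"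
        have h: "0 \<le> h" using elim by simp
        have Ut: "(\<lambda>y. U t y $ j) \<in> C0 D" using t by (intro U_C0) auto
        have Sg: "S j t g \<in> C0 D" by (rule heat.S_C0[OF heat t(1) g])
        note adm = heat.admissible_C0[OF heat Ut h] heat.admissible_C0[OF heat Sg h]
        define p where "p = S j h (\<lambda>y. U t y $ j) x"
        have p0: "0 \<le> p"
          unfolding p_def by (rule heat.S_nonneg[OF heat adm(1) _ x])
            (use nonneg t closure_subset[of D] in auto)
        have "S j h (\<lambda>y. exp (- 2 * L * t) * S j t g y) x \<le> p + e * t"
          unfolding p_def
        proof (rule heat.S_mono_const[OF heat _ adm(1) _ _ x])
          show "heat.admissible D h (\<lambda>y. exp (- 2 * L * t) * S j t g y)"
            using heat.admissible_linear[OF heat adm(2,2), where a="exp (- 2 * L * t)" and b=0] by simp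
          show "exp (- 2 * L * t) * S j t g y \<le> U t y $ j + e * t" if "y \<in> D" for y
            using IH that closure_subset[of D] by (auto simp: algebra_simps)
        qed (use e t in simp)
        moreover have "S j h (\<lambda>y. exp (- 2 * L * t) * S j t g y) x = exp (- 2 * L * t) * S j (t + h) g x"
          using heat.S_cmult[OF heat adm(2) x] heat.S_add[OF heat h heat.admissible_C0[OF heat g t(1)] x]
          by (simp add: add.commute)
        ultimately have "exp (- 2 * L * t) * S j (t + h) g x \<le> p + e * t" by simp
        then have "exp (- 2 * L * h) * (exp (- 2 * L * t) * S j (t + h) g x) \<le> exp (- 2 * L * h) * (p + e * t)"
          by (rule mult_left_mono) simp
        also have "\<dots> = exp (- 2 * L * h) * p + exp (- 2 * L * h) * (e * t)" by (rule distrib_left)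
        \<comment> \<open>Exchanging the exponential for \<open>1 - L * h\<close> in front of
          \<open>p\<close> relies on \<open>p \<ge> 0\<close>; in front of the error it is simply
          bounded by 1.\<close>
        also have "\<dots> \<le> (1 - L * h) * p + 1 * (e * t)"
          using exp_le p0 Lh e t by (intro add_mono mult_right_mono) auto
        also have "\<dots> \<le> U (t + h) x $ j + h * e + e * t"
          using elim le_tau x by (auto simp: p_def algebra_simps)
        finally have "exp (- 2 * L * h) * (exp (- 2 * L * t) * S j (t + h) g x) \<le> U (t + h) x $ j + h * e + e * t" .
        moreover have "exp (- 2 * L * (t + h)) * q = exp (- 2 * L * h) * (exp (- 2 * L * t) * q)" for q
          unfolding mult.assoc[symmetric] exp_add[symmetric] by (simp add: algebra_simps)
        ultimately show "exp (- 2 * L * (t + h)) * S j (t + h) g x - e * (t + h) \<le> U (t + h) x $ j"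
          by (simp only: distrib_left mult.commute[of h e])
      qed
    qed
  qed
  have "exp (- 2 * L * \<tau>) * S j \<tau> g x \<le> U \<tau> x $ j"
  proof (rule field_le_epsilon)
    fix e :: real assume "e > 0"
    then have "exp (- 2 * L * \<tau>) * S j \<tau> g x - e / (\<tau> + 1) * \<tau> \<le> U \<tau> x $ j"
      using tau_nonneg x by (intro claim[rule_format]) auto
    moreover have "e / (\<tau> + 1) * \<tau> \<le> e" using \<open>e > 0\<close> tau_nonneg by (simp add: field_simps)
    ultimately show "exp (- 2 * L * \<tau>) * S j \<tau> g x \<le> U \<tau> x $ j + e" by linarith
  qed
  then show ?thesis by (simp add: g_def)
qed

end

text \<open>Spatial continuity at the fixed time \<open>s\<close> combines with uniform convergence
  in time, which bounds the change from \<open>s\<close> to \<open>r\<close> at the moving point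
  \<open>y\<close>.\<close>

lemma mild_solution_jointly_continuous:
  fixes U :: "real \<Rightarrow> real^'d \<Rightarrow> real^'n"
  assumes U: "mild_solution D S F T U" and \<tau>: "ereal \<tau> < T"
  shows "continuous_on ({0..\<tau>} \<times> closure D) (\<lambda>(s, x). U s x)"
  unfolding continuous_on_iff
proof (intro ballI allI impI)
  fix p and e :: real assume p: "p \<in> {0..\<tau>} \<times> closure D" and e: "e > 0"
  then obtain s x where px: "p = (s, x)" and s: "s \<in> {0..\<tau>}" and x: "x \<in> closure D" by blast
  have sub: "{0..\<tau>} \<subseteq> time_interval T"
    using \<tau> by (auto simp: time_interval_def intro: le_less_trans[of "ereal _" "ereal \<tau>"])
  have "continuous_on (closure D) (\<lambda>x. U s x $ i)" for i
    using U s sub by (auto simp: mild_solution_def C0_def)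
  then have "continuous_on (closure D) (\<lambda>x. \<chi> i. U s x $ i)"
    by (rule continuous_on_vec_lambda)
  then have "continuous_on (closure D) (U s)" by simp
  with x e obtain d1 where d1: "d1 > 0" "\<And>y. y \<in> closure D \<Longrightarrow> dist y x < d1 \<Longrightarrow> dist (U s y) (U s x) < e / 2"
    unfolding continuous_on_iff by (meson half_gt_zero)
  have "uniform_limit (closure D) U (U s) (at s within time_interval T)"
    using U s sub by (auto simp: mild_solution_def)
  then have "\<forall>\<^sub>F r in at s within time_interval T. \<forall>y\<in>closure D. dist (U r y) (U s y) < e / 2"
    by (rule uniform_limitD) (use e in simp)
  then obtain d2 where d2: "d2 > 0" "\<And>r y. r \<in> time_interval T \<Longrightarrow> r \<noteq> s \<Longrightarrow> dist r s < d2 \<Longrightarrow>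
      y \<in> closure D \<Longrightarrow> dist (U r y) (U s y) < e / 2"
    unfolding eventually_at by blast
  have "dist (U r y) (U s x) < e"
    if r: "r \<in> {0..\<tau>}" and y: "y \<in> closure D" and d: "dist (r, y) (s, x) < min d1 d2" for r y
  proof -
    have "dist r s < d2" "dist y x < d1"
      using d dist_fst_le[of "(r, y)" "(s, x)"] dist_snd_le[of "(r, y)" "(s, x)"] by auto
    then have "dist (U r y) (U s y) < e / 2" "dist (U s y) (U s x) < e / 2"
      using d1(2)[OF y] d2(2)[of r y] r sub y e by (cases "r = s"; auto)+
    then show ?thesis using dist_triangle[of "U r y" "U s x" "U s y"] by linarith
  qed
  then show "\<exists>d>0. \<forall>q\<in>{0..\<tau>} \<times> closure D. dist q p < d \<longrightarrow>
      dist (case q of (s, x) \<Rightarrow> U s x) (case p of (s, x) \<Rightarrow> U s x) < e"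
    using d1(1) d2(1) by (intro exI[of _ "min d1 d2"]) (auto simp: px)
qed

theorem theorem5p1:
  fixes \<Omega> :: "(real^'d) set"
    and \<kappa> :: "'n::finite \<Rightarrow> real"
    and S :: "'n \<Rightarrow> real \<Rightarrow> (real^'d \<Rightarrow> real) \<Rightarrow> real^'d \<Rightarrow> real"
    and F :: "real^'n \<Rightarrow> real^'n"
    and T :: ereal
    and U :: "real \<Rightarrow> real^'d \<Rightarrow> real^'n"
  assumes "bounded \<Omega>" "connected \<Omega>" "open \<Omega>" "C2_boundary \<Omega>"
    and "\<And>i. \<kappa> i > 0"
    and "\<And>i. dirichlet_heat_semigroup \<Omega> (\<kappa> i) (S i)"
    and "locally_lipschitz F"
    and "quasi_positive F"
    and "maximal_positive_trajectory \<Omega> S F T U"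
    and "\<And>i x. x \<in> \<Omega> \<Longrightarrow> U 0 x $ i \<ge> 0"
  shows "(\<forall>i. \<forall>x\<in>\<Omega>. \<forall>t. 0 \<le> t \<and> ereal t < T \<longrightarrow> U t x $ i \<ge> 0) \<and>
         (\<forall>j. (\<exists>x\<in>\<Omega>. U 0 x $ j \<noteq> 0) \<longrightarrow>
            (\<forall>t. 0 < t \<and> ereal t < T \<longrightarrow> (\<forall>x\<in>\<Omega>. U t x $ j > 0)))"
proof -
  have heat: "heat \<Omega> (\<kappa> i) (S i)" for i
    using assms by unfold_locales
  have U: "mild_solution \<Omega> S F T U"
    using assms(9) by (simp add: maximal_positive_trajectory_def)
  have dom: "x \<in> closure \<Omega>" if "x \<in> \<Omega>" for x
    using that closure_subset by blast
  \<comment> \<open>Any \<open>\<tau> < T\<close> is admissible: joint continuity on a compact set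
    bounds \<open>U\<close> by some \<open>R\<close>, and \<open>F\<close> is Lipschitz on the
    corresponding ball. The constants vary with \<open>\<tau>\<close>, which does no harm to
    qualitative positivity.\<close>
  have traj: "\<exists>R L. bounded_trajectory \<Omega> \<kappa> S F U \<tau> R L" if \<tau>: "0 \<le> \<tau>" "ereal \<tau> < T" for \<tau>
  proof -
    have sub: "{0..\<tau>} \<subseteq> time_interval T"
      using \<tau> by (auto simp: time_interval_def intro: le_less_trans[of "ereal _" "ereal \<tau>"])
    note joint = mild_solution_jointly_continuous[OF U \<tau>(2)]
    have "compact ((\<lambda>(s, x). U s x) ` ({0..\<tau>} \<times> closure \<Omega>))"
      using assms(1) by (intro compact_continuous_image joint compact_Times) (auto simp: compact_closure)
    then obtain R where R: "\<And>s x. 0 \<le> s \<Longrightarrow> s \<le> \<tau> \<Longrightarrow> x \<in> closure \<Omega> \<Longrightarrow> norm (U s x) \<le> R"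
      by (fastforce dest: compact_imp_bounded simp: bounded_iff)
    obtain L where L: "L-lipschitz_on (cball 0 R) F"
      using locally_lipschitz_on_cball[OF assms(7)] by blast
    have "bounded_trajectory \<Omega> \<kappa> S F U \<tau> R L"
    proof (rule bounded_trajectory.intro)
      show "heat \<Omega> (\<kappa> i) (S i)" for i by (rule heat)
      show "continuous_on {0..\<tau>} (\<lambda>s. U s y)" if "y \<in> closure \<Omega>" for y
      proof -
        have "continuous_on {0..\<tau>} (\<lambda>s. (s, y))"
          by (intro continuous_on_Pair continuous_on_const continuous_on_id)
        from continuous_on_compose2[OF joint this] show ?thesis using that by fastforce
      qed
      show "heat.mild \<Omega> (S i) \<tau> (\<lambda>s y. F (U s y) $ i) (\<lambda>s y. U s y $ i)" for i
        unfolding heat.mild_def[OF heat]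
      proof (intro conjI ballI)
        have "continuous_on ({0..\<tau>} \<times> closure \<Omega>) (\<lambda>p. F (case p of (s, x) \<Rightarrow> U s x))"
          by (rule continuous_on_compose2[OF lipschitz_on_continuous_on[OF L] joint]) (auto intro: R)
        then have "continuous_on ({0..\<tau>} \<times> closure \<Omega>) (\<lambda>p. F (case p of (s, x) \<Rightarrow> U s x) $ i)"
          by (rule continuous_on_component)
        then show "continuous_on ({0..\<tau>} \<times> closure \<Omega>) (\<lambda>(s, x). F (U s x) $ i)"
          by (simp add: case_prod_beta)
      qed (use U sub in \<open>auto simp: mild_solution_def\<close>)
    qed (use \<tau> assms(8,10) R L in auto)
    then show ?thesis by blast
  qed
  have U_nonneg: "0 \<le> U t x $ i" if "0 \<le> t" "ereal t < T" "x \<in> closure \<Omega>" for t x i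
    using traj[OF that(1,2)] bounded_trajectory.nonneg[OF _ that(3)] by blast
  have "0 < U t x $ j" if x0: "x0 \<in> \<Omega>" "U 0 x0 $ j \<noteq> 0" and t: "0 < t" "ereal t < T" and x: "x \<in> \<Omega>" for j x0 t x
  proof -
    obtain R L where "bounded_trajectory \<Omega> \<kappa> S F U t R L"
      using traj[of t] t by auto
    then interpret bounded_trajectory \<Omega> \<kappa> S F U t R L .
    have "0 < S j t (\<lambda>y. U 0 y $ j) x"
    proof (rule heat.S_pos[OF heat assms(2) U_C0 _ x0(1) _ t(1) x])
      show "0 < U 0 x0 $ j" using x0 assms(10)[of x0 j] by simp
    qed (use t assms(10) in auto)
    then have "0 < exp (- 2 * L * t) * S j t (\<lambda>y. U 0 y $ j) x" by simp
    also have "\<dots> \<le> U t x $ j"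
    proof (rule lower_bound_S[OF _ dom[OF x]])
      fix s y i assume s: "0 \<le> s" "s \<le> t" and "y \<in> closure \<Omega>"
      moreover have "ereal s < T" using s(2) t(2) by (auto intro: le_less_trans[of "ereal _" "ereal t"])
      ultimately show "0 \<le> U s y $ i" by (intro U_nonneg)
    qed
    finally show ?thesis .
  qed
  then show ?thesis using U_nonneg dom by blast
qed

end
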